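(* Let $n\geq 2$, let $\mathbb{K}$ be a field of characteristic different from $2$, and let $m\geq 1$. If $f$ is an $m$-fold presentation of a Leibniz $n$-algebra $\mathscr{L}$ over $\mathbb{K}$, then an isomorphism $$H_{m+1}(\mathscr{L},{}_{n}\mathsf{lie})_{\mathbb{G}}\cong\frac{\langle f_{\varnothing},\dots,f_{\varnothing}\rangle\cap\bigcap_{i\in\langle m\rangle}K[f_{i}]}{\sum_{I_{1}\cup\dots\cup I_{n}=\langle m\rangle}\Bigl\langle\bigcap_{i\in I_{1}}K[f_{i}],\dots,\bigcap_{i\in I_{n}}K[f_{i}]\Bigr\rangle}$$ exists.
   Context: A Leibniz $n$-algebra over $\mathbb{K}$ is a $\mathbb{K}$-vector space $\mathscr{L}$ with an $n$-linear operation $[-,\dots,-]\colon\mathscr{L}^n\to\mathscr{L}$ satisfying $$[[l_{1},\dots,l_{n}],l'_{1},\dots,l'_{n-1}]=\sum_{1\leq i\leq n}[l_{1},\dots,l_{i-1},[l_{i},l'_{1},\dots,l'_{n-1}],l_{i+1},\dots,l_{n}].$$ It is a Lie $n$-algebra if moreover $[l_1,\dots,l_n]=\mathrm{sgn}(\sigma)[l_{\sigma(1)},\dots,l_{\sigma(n)}]$ for all $\sigma\in S_n$. Homomorphisms are linear maps preserving the bracket; isomorphisms are bijective homomorphisms. Ideals are subspaces $\mathscr{N}$ such that $[l_1,\dots,l_n]\in\mathscr{N}$ whenever some $l_i\in\mathscr{N}$. For $\sigma\in S_n$ put $\langle l_1,\dots,l_n\rangle_\sigma=[l_1,\dots,l_n]-\mathrm{sgn}(\sigma)[l_{\sigma(1)},\dots,l_{\sigma(n)}]$.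 For ideals $\mathscr{N}_1,\dots,\mathscr{N}_n$ of $\mathscr{L}$, the relative commutator $\langle\mathscr{N}_1,\dots,\mathscr{N}_n\rangle$ is the ideal of $\mathscr{L}$ generated by all $\langle l_1,\dots,l_n\rangle_\sigma$ with $l_1\in\mathscr{N}_1,\dots,l_n\in\mathscr{N}_n$ and $\sigma\in S_n$. The functor ${}_{n}\mathsf{lie}$ from Leibniz $n$-algebras to Lie $n$-algebras, $\mathscr{L}\mapsto\mathscr{L}/\langle\mathscr{L},\dots,\mathscr{L}\rangle$, is left adjoint to the inclusion. Homology. $\mathbb{G}=(G,\delta,\epsilon)$ is the comonad on Leibniz $n$-algebras induced by the forgetful/free adjunction to sets. For a Leibniz $n$-algebra $\mathscr{L}$, $\mathbb{G}\mathscr{L}$ is the simplicial object with $G^{k+1}\mathscr{L}$ in degree $k\geq 0$, faces $\partial_i=G^i\epsilon_{G^{k-i}\mathscr{L}}\colon G^{k+1}\mathscr{L}\to G^k\mathscr{L}$ and degeneracies $\sigma_i=G^i\delta_{G^{k-i}\mathscr{L}}$, $0\leq i\leq k$. For a functor $I$, $H_{m+1}(\mathscr{L},I)_{\mathbb{G}}=H_m(N\,I\,\mathbb{G}\mathscr{L})$ for $m\geq 0$, where $N$ is the Moore normalisation: $N_kS=\bigcap_{i=0}^{k-1}\ker(\partial_i\colon S_k\to S_{k-1})$ for $k>0$, $N_0S=S_0$, $N_kS=0$ for $k<0$, with differential $d_k$ induced by $\partial_k$ (its image is an ideal), and $H_m=\ker d_m/\mathrm{im}\, d_{m+1}$, computed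 here in Lie $n$-algebras. Higher presentations. Let $\langle m\rangle=\{1,\dots,m\}$. An $m$-fold arrow is a functor $f$ from the poset of subsets of $\langle m\rangle$ (ordered by inclusion) to the category of Leibniz $n$-algebras; write $f_I=f(I)$, and $f_i\colon f_\varnothing\to f_{\{i\}}$ for the map induced by $\varnothing\subseteq\{i\}$; $K[f_i]$ is the kernel of $f_i$. It is an $m$-fold extension if for all $I\subsetneq\langle m\rangle$ the induced map $f_I\to\lim_{J\supsetneq I}f_J$ is surjective. An $m$-fold presentation of $\mathscr{L}$ is an $m$-fold extension $f$ with $f_{\langle m\rangle}=\mathscr{L}$ and with $f_I$ projective (with respect to surjective homomorphisms) for all $I\subsetneq\langle m\rangle$. The sum is a sum of ideals of $f_\varnothing$, over all $n$-tuples $(I_1,\dots,I_n)$ of (possibly empty) subsets of $\langle m\rangle$ with union $\langle m\rangle$; an empty intersection means $f_\varnothing$. *)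

theory Defs
  imports "HOL-Algebra.Module" "HOL-Algebra.QuotRing" "HOL-Combinatorics.Permutations"
begin

section \<open>Leibniz and Lie n-algebras\<close>

text \<open>
  The n-ary bracket takes its arguments as a list of length \<open>n\<close>, so \<open>l\<^sub>i\<close> is \<open>xs ! (i - 1)\<close>;
  its values on other lists are irrelevant. The fields \<open>mult\<close> and \<open>one\<close> inherited from
  \<^typ>\<open>('k, 'a) module\<close> are not used.
\<close>

record ('k, 'a) nalg = "('k, 'a) module" +
  bracket :: "'a list \<Rightarrow> 'a"

locale leibniz_algebra = K?: field K + module K L for n :: nat and K (structure) and L (structure) +
  assumes bracket_closed:
      "\<lbrakk>length xs = n; set xs \<subseteq> carrier L\<rbrakk> \<Longrightarrow> bracket L xs \<in> carrier L"
    and bracket_add: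
      "\<lbrakk>length xs = n; set xs \<subseteq> carrier L; i < n; x \<in> carrier L; y \<in> carrier L\<rbrakk> \<Longrightarrow>
        bracket L (xs[i := x \<oplus>\<^bsub>L\<^esub> y]) = bracket L (xs[i := x]) \<oplus>\<^bsub>L\<^esub> bracket L (xs[i := y])"
    and bracket_smult:
      "\<lbrakk>length xs = n; set xs \<subseteq> carrier L; i < n; a \<in> carrier K; x \<in> carrier L\<rbrakk> \<Longrightarrow>
        bracket L (xs[i := a \<odot>\<^bsub>L\<^esub> x]) = a \<odot>\<^bsub>L\<^esub> bracket L (xs[i := x])"
    and leibniz_identity:
      "\<lbrakk>length xs = n; set xs \<subseteq> carrier L; length ys = n - 1; set ys \<subseteq> carrier L\<rbrakk> \<Longrightarrow>
        bracket L (bracket L xs # ys) =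
          (\<Oplus>\<^bsub>L\<^esub>i\<in>{..<n}. bracket L (xs[i := bracket L (xs ! i # ys)]))"

locale lie_algebra = leibniz_algebra +
  assumes bracket_alternating:
      "\<lbrakk>length xs = n; set xs \<subseteq> carrier L; \<sigma> permutes {..<n}\<rbrakk> \<Longrightarrow>
        bracket L xs = [sign \<sigma>] \<cdot>\<^bsub>L\<^esub> bracket L (permute_list \<sigma> xs)"

definition nalg_hom ::
  "nat \<Rightarrow> ('k, 'r) ring_scheme \<Rightarrow> ('k, 'a) nalg \<Rightarrow> ('k, 'b) nalg \<Rightarrow> ('a \<Rightarrow> 'b) set" where
  "nalg_hom n K A B = {h. h \<in> carrier A \<rightarrow> carrier B \<and>
     (\<forall>x\<in>carrier A. \<forall>y\<in>carrier A. h (x \<oplus>\<^bsub>A\<^esub> y) = h x \<oplus>\<^bsub>B\<^esub> h y) \<and>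
     (\<forall>a\<in>carrier K. \<forall>x\<in>carrier A. h (a \<odot>\<^bsub>A\<^esub> x) = a \<odot>\<^bsub>B\<^esub> h x) \<and>
     (\<forall>xs. length xs = n \<and> set xs \<subseteq> carrier A \<longrightarrow> h (bracket A xs) = bracket B (map h xs))}"

text \<open>Isomorphism in the category of Lie n-algebras.\<close>

definition lie_isomorphic ::
  "nat \<Rightarrow> ('k, 'r) ring_scheme \<Rightarrow> ('k, 'a) nalg \<Rightarrow> ('k, 'b) nalg \<Rightarrow> bool" where
  "lie_isomorphic n K A B \<longleftrightarrow> lie_algebra n K A \<and> lie_algebra n K B \<and>
     (\<exists>h \<in> nalg_hom n K A B. bij_betw h (carrier A) (carrier B))"

definition nalg_ideal :: "nat \<Rightarrow> ('k, 'r) ring_scheme \<Rightarrow> ('k, 'a) nalg \<Rightarrow> 'a set \<Rightarrow> bool" where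
  "nalg_ideal n K L N \<longleftrightarrow> submodule N K L \<and>
     (\<forall>xs. length xs = n \<and> set xs \<subseteq> carrier L \<and> (\<exists>x\<in>set xs. x \<in> N) \<longrightarrow> bracket L xs \<in> N)"

definition generated_ideal ::
  "nat \<Rightarrow> ('k, 'r) ring_scheme \<Rightarrow> ('k, 'a) nalg \<Rightarrow> 'a set \<Rightarrow> 'a set" where
  "generated_ideal n K L S = \<Inter>{N. nalg_ideal n K L N \<and> S \<subseteq> N}"

definition ideal_sum :: "('k, 'a) nalg \<Rightarrow> 'i set \<Rightarrow> ('i \<Rightarrow> 'a set) \<Rightarrow> 'a set" where
  "ideal_sum L T N = {\<Oplus>\<^bsub>L\<^esub>t\<in>T. x t | x. x \<in> (\<Pi> t\<in>T. N t)}"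

text \<open>
  For a subspace \<open>S\<close> of \<open>L\<close> closed under the bracket and an ideal \<open>N \<subseteq> S\<close> of \<open>S\<close>, the quotient
  \<open>S/N\<close> is \<open>quot_alg (L\<lparr>carrier := S\<rparr>) N\<close>. As in \<^term>\<open>FactRing\<close>, its elements
  are cosets, and the operations are the unions over all representatives.
\<close>

definition quot_alg :: "('k, 'a) nalg \<Rightarrow> 'a set \<Rightarrow> ('k, 'a set) nalg" where
  "quot_alg L N = \<lparr>carrier = a_rcosets\<^bsub>L\<^esub> N, monoid.mult = undefined, one = undefined,
     zero = N, add = set_add L,
     smult = (\<lambda>a X. \<Union>x\<in>X. N +>\<^bsub>L\<^esub> (a \<odot>\<^bsub>L\<^esub> x)),
     bracket = (\<lambda>Xs. \<Union>xs\<in>{xs. list_all2 (\<in>) xs Xs}. N +>\<^bsub>L\<^esub> bracket L xs)\<rparr>"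


section \<open>Relative commutators and the reflection to Lie n-algebras\<close>

definition rel_commutator ::
  "nat \<Rightarrow> ('k, 'r) ring_scheme \<Rightarrow> ('k, 'a) nalg \<Rightarrow> 'a set list \<Rightarrow> 'a set" where
  "rel_commutator n K L Ns = generated_ideal n K L
     {bracket L xs \<ominus>\<^bsub>L\<^esub> [sign \<sigma>] \<cdot>\<^bsub>L\<^esub> bracket L (permute_list \<sigma> xs) | xs \<sigma>.
        length xs = n \<and> (\<forall>i<n. xs ! i \<in> Ns ! i) \<and> \<sigma> permutes {..<n}}"

definition nlie :: "nat \<Rightarrow> ('k, 'r) ring_scheme \<Rightarrow> ('k, 'a) nalg \<Rightarrow> ('k, 'a set) nalg" where
  "nlie n K L = quot_alg L (rel_commutator n K L (replicate n (carrier L)))"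

definition nlie_map :: "nat \<Rightarrow> ('k, 'r) ring_scheme \<Rightarrow> ('k, 'a) nalg \<Rightarrow> ('k, 'b) nalg \<Rightarrow>
    ('a \<Rightarrow> 'b) \<Rightarrow> 'a set \<Rightarrow> 'b set" where
  "nlie_map n K A B h X = (\<Union>x\<in>X. rel_commutator n K B (replicate n (carrier B)) +>\<^bsub>B\<^esub> h x)"


section \<open>Free Leibniz n-algebras\<close>

text \<open>
  All iterates \<open>G\<^sup>k L\<close> have to live in one type. \<open>Obj a\<close> stands for the element \<open>a\<close> of the given
  algebra \<open>L\<close>. A set \<open>X\<close> of terms can itself serve as a set of generators, \<open>Var x\<close> being the
  generator belonging to \<open>x \<in> X\<close>; the free algebra on \<open>X\<close> consists of one chosen representative for
  each class of terms over \<open>X\<close> modulo the Leibniz n-algebra laws, so that its carrier is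
  again a set of terms.
\<close>

datatype ('k, 'a) lterm =
    Obj (the_obj: 'a)
  | Var "('k, 'a) lterm"
  | Zero
  | Add "('k, 'a) lterm" "('k, 'a) lterm"
  | Smult 'k "('k, 'a) lterm"
  | Bracket "('k, 'a) lterm list"

inductive_set terms_over ::
    "nat \<Rightarrow> ('k, 'r) ring_scheme \<Rightarrow> ('k, 'a) lterm set \<Rightarrow> ('k, 'a) lterm set"
  for n K X where
  Var: "x \<in> X \<Longrightarrow> Var x \<in> terms_over n K X"
| Zero: "Zero \<in> terms_over n K X"
| Add: "\<lbrakk>s \<in> terms_over n K X; t \<in> terms_over n K X\<rbrakk> \<Longrightarrow> Add s t \<in> terms_over n K X"
| Smult: "\<lbrakk>a \<in> carrier K; t \<in> terms_over n K X\<rbrakk> \<Longrightarrow> Smult a t \<in> terms_over n K X"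
| Bracket: "\<lbrakk>length ts = n; \<forall>t\<in>set ts. t \<in> terms_over n K X\<rbrakk> \<Longrightarrow> Bracket ts \<in> terms_over n K X"

inductive term_eq ::
    "nat \<Rightarrow> ('k, 'r) ring_scheme \<Rightarrow> ('k, 'a) lterm set \<Rightarrow> ('k, 'a) lterm \<Rightarrow> ('k, 'a) lterm \<Rightarrow> bool"
  for n K X where
  refl: "t \<in> terms_over n K X \<Longrightarrow> term_eq n K X t t"
| sym: "term_eq n K X s t \<Longrightarrow> term_eq n K X t s"
| trans: "\<lbrakk>term_eq n K X s t; term_eq n K X t u\<rbrakk> \<Longrightarrow> term_eq n K X s u"
| cong_add: "\<lbrakk>term_eq n K X s s'; term_eq n K X t t'\<rbrakk> \<Longrightarrow> term_eq n K X (Add s t) (Add s' t')"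
| cong_smult: "\<lbrakk>a \<in> carrier K; term_eq n K X s t\<rbrakk> \<Longrightarrow> term_eq n K X (Smult a s) (Smult a t)"
| cong_bracket: "\<lbrakk>length ts = n; set ts \<subseteq> terms_over n K X; i < n; term_eq n K X s t\<rbrakk> \<Longrightarrow>
    term_eq n K X (Bracket (ts[i := s])) (Bracket (ts[i := t]))"
| add_assoc: "\<lbrakk>s \<in> terms_over n K X; t \<in> terms_over n K X; u \<in> terms_over n K X\<rbrakk> \<Longrightarrow>
    term_eq n K X (Add (Add s t) u) (Add s (Add t u))"
| add_comm: "\<lbrakk>s \<in> terms_over n K X; t \<in> terms_over n K X\<rbrakk> \<Longrightarrow>
    term_eq n K X (Add s t) (Add t s)"
| add_zero: "t \<in> terms_over n K X \<Longrightarrow> term_eq n K X (Add Zero t) t"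
| smult_zero: "t \<in> terms_over n K X \<Longrightarrow> term_eq n K X (Smult \<zero>\<^bsub>K\<^esub> t) Zero"
| smult_one: "t \<in> terms_over n K X \<Longrightarrow> term_eq n K X (Smult \<one>\<^bsub>K\<^esub> t) t"
| smult_assoc: "\<lbrakk>a \<in> carrier K; b \<in> carrier K; t \<in> terms_over n K X\<rbrakk> \<Longrightarrow>
    term_eq n K X (Smult (a \<otimes>\<^bsub>K\<^esub> b) t) (Smult a (Smult b t))"
| smult_l_distr: "\<lbrakk>a \<in> carrier K; b \<in> carrier K; t \<in> terms_over n K X\<rbrakk> \<Longrightarrow>
    term_eq n K X (Smult (a \<oplus>\<^bsub>K\<^esub> b) t) (Add (Smult a t) (Smult b t))"
| smult_r_distr: "\<lbrakk>a \<in> carrier K; s \<in> terms_over n K X; t \<in> terms_over n K X\<rbrakk> \<Longrightarrow>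
    term_eq n K X (Smult a (Add s t)) (Add (Smult a s) (Smult a t))"
| bracket_add: "\<lbrakk>length ts = n; set ts \<subseteq> terms_over n K X; i < n;
      s \<in> terms_over n K X; t \<in> terms_over n K X\<rbrakk> \<Longrightarrow>
    term_eq n K X (Bracket (ts[i := Add s t])) (Add (Bracket (ts[i := s])) (Bracket (ts[i := t])))"
| bracket_smult: "\<lbrakk>length ts = n; set ts \<subseteq> terms_over n K X; i < n;
      a \<in> carrier K; t \<in> terms_over n K X\<rbrakk> \<Longrightarrow>
    term_eq n K X (Bracket (ts[i := Smult a t])) (Smult a (Bracket (ts[i := t])))"
| leibniz: "\<lbrakk>length ts = n; set ts \<subseteq> terms_over n K X;
      length us = n - 1; set us \<subseteq> terms_over n K X\<rbrakk> \<Longrightarrow>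
    term_eq n K X (Bracket (Bracket ts # us))
      (foldr Add (map (\<lambda>i. Bracket (ts[i := Bracket (ts ! i # us)])) [0..<n]) Zero)"

definition canon ::
  "nat \<Rightarrow> ('k, 'r) ring_scheme \<Rightarrow> ('k, 'a) lterm set \<Rightarrow> ('k, 'a) lterm \<Rightarrow> ('k, 'a) lterm" where
  "canon n K X t = (SOME s. term_eq n K X t s)"

definition free_alg ::
  "nat \<Rightarrow> ('k, 'r) ring_scheme \<Rightarrow> ('k, 'a) lterm set \<Rightarrow> ('k, ('k, 'a) lterm) nalg" where
  "free_alg n K X = \<lparr>carrier = canon n K X ` terms_over n K X, monoid.mult = undefined, one = undefined,
     zero = canon n K X Zero, add = (\<lambda>s t. canon n K X (Add s t)),
     smult = (\<lambda>a t. canon n K X (Smult a t)), bracket = (\<lambda>ts. canon n K X (Bracket ts))\<rparr>"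

definition gen ::
  "nat \<Rightarrow> ('k, 'r) ring_scheme \<Rightarrow> ('k, 'a) lterm set \<Rightarrow> ('k, 'a) lterm \<Rightarrow> ('k, 'a) lterm" where
  "gen n K X x = canon n K X (Var x)"

text \<open>\<open>free_lift B \<phi>\<close> is the homomorphism from \<open>free_alg n K X\<close> to \<open>B\<close> that extends
  \<open>\<phi> : X \<rightarrow> carrier B\<close>, for any \<open>X\<close>.\<close>

primrec free_lift :: "('k, 'b) nalg \<Rightarrow> (('k, 'a) lterm \<Rightarrow> 'b) \<Rightarrow> ('k, 'a) lterm \<Rightarrow> 'b" where
  "free_lift B \<phi> (Obj a) = undefined"
| "free_lift B \<phi> (Var x) = \<phi> x"
| "free_lift B \<phi> Zero = \<zero>\<^bsub>B\<^esub>"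
| "free_lift B \<phi> (Add s t) = free_lift B \<phi> s \<oplus>\<^bsub>B\<^esub> free_lift B \<phi> t"
| "free_lift B \<phi> (Smult a t) = a \<odot>\<^bsub>B\<^esub> free_lift B \<phi> t"
| "free_lift B \<phi> (Bracket ts) = bracket B (map (free_lift B \<phi>) ts)"


section \<open>The comonad and comonadic homology\<close>

definition obj_copy :: "('k, 'a) nalg \<Rightarrow> ('k, ('k, 'a) lterm) nalg" where
  "obj_copy L = \<lparr>carrier = Obj ` carrier L, monoid.mult = undefined, one = undefined,
     zero = Obj \<zero>\<^bsub>L\<^esub>, add = (\<lambda>s t. Obj (the_obj s \<oplus>\<^bsub>L\<^esub> the_obj t)),
     smult = (\<lambda>a t. Obj (a \<odot>\<^bsub>L\<^esub> the_obj t)), bracket = (\<lambda>ts. Obj (bracket L (map the_obj ts)))\<rparr>"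

definition G_obj ::
  "nat \<Rightarrow> ('k, 'r) ring_scheme \<Rightarrow> ('k, ('k, 'a) lterm) nalg \<Rightarrow> ('k, ('k, 'a) lterm) nalg" where
  "G_obj n K A = free_alg n K (carrier A)"

text \<open>\<open>G_map n K B h\<close> is \<open>G h : G A \<rightarrow> G B\<close> for \<open>h : A \<rightarrow> B\<close>.\<close>

definition G_map :: "nat \<Rightarrow> ('k, 'r) ring_scheme \<Rightarrow> ('k, ('k, 'a) lterm) nalg \<Rightarrow>
    (('k, 'a) lterm \<Rightarrow> ('k, 'a) lterm) \<Rightarrow> ('k, 'a) lterm \<Rightarrow> ('k, 'a) lterm" where
  "G_map n K B h = free_lift (G_obj n K B) (\<lambda>x. gen n K (carrier B) (h x))"

definition G_counit :: "('k, ('k, 'a) lterm) nalg \<Rightarrow> ('k, 'a) lterm \<Rightarrow> ('k, 'a) lterm" where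
  "G_counit A = free_lift A (\<lambda>x. x)"

definition G_comult :: "nat \<Rightarrow> ('k, 'r) ring_scheme \<Rightarrow> ('k, ('k, 'a) lterm) nalg \<Rightarrow>
    ('k, 'a) lterm \<Rightarrow> ('k, 'a) lterm" where
  "G_comult n K A = free_lift (G_obj n K (G_obj n K A))
     (\<lambda>x. gen n K (carrier (G_obj n K A)) (gen n K (carrier A) x))"

definition G_pow :: "nat \<Rightarrow> ('k, 'r) ring_scheme \<Rightarrow> nat \<Rightarrow>
    ('k, ('k, 'a) lterm) nalg \<Rightarrow> ('k, ('k, 'a) lterm) nalg" where
  "G_pow n K i = G_obj n K ^^ i"

text \<open>\<open>G_pow_map n K i B h\<close> is \<open>G\<^sup>i h : G\<^sup>i A \<rightarrow> G\<^sup>i B\<close> for \<open>h : A \<rightarrow> B\<close>.\<close>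

primrec G_pow_map :: "nat \<Rightarrow> ('k, 'r) ring_scheme \<Rightarrow> nat \<Rightarrow> ('k, ('k, 'a) lterm) nalg \<Rightarrow>
    (('k, 'a) lterm \<Rightarrow> ('k, 'a) lterm) \<Rightarrow> ('k, 'a) lterm \<Rightarrow> ('k, 'a) lterm" where
  "G_pow_map n K 0 B h = h"
| "G_pow_map n K (Suc i) B h = G_map n K (G_pow n K i B) (G_pow_map n K i B h)"

text \<open>
  \<open>face S k i\<close> is \<open>\<partial>\<^sub>i : S\<^sub>k \<rightarrow> S\<^sub>k\<^sub>-\<^sub>1\<close>, relevant for \<open>k > 0\<close> and \<open>i \<le> k\<close> only;
  \<open>degen S k i\<close> is \<open>\<sigma>\<^sub>i : S\<^sub>k \<rightarrow> S\<^sub>k\<^sub>+\<^sub>1\<close> for \<open>i \<le> k\<close>.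
\<close>

record ('k, 'a) simplicial =
  obj :: "nat \<Rightarrow> ('k, 'a) nalg"
  face :: "nat \<Rightarrow> nat \<Rightarrow> 'a \<Rightarrow> 'a"
  degen :: "nat \<Rightarrow> nat \<Rightarrow> 'a \<Rightarrow> 'a"

definition G_resolution ::
  "nat \<Rightarrow> ('k, 'r) ring_scheme \<Rightarrow> ('k, 'a) nalg \<Rightarrow> ('k, ('k, 'a) lterm) simplicial" where
  "G_resolution n K L = \<lparr>
     obj = (\<lambda>k. G_pow n K (k + 1) (obj_copy L)),
     face = (\<lambda>k i. G_pow_map n K i (G_pow n K (k - i) (obj_copy L))
                     (G_counit (G_pow n K (k - i) (obj_copy L)))),
     degen = (\<lambda>k i. G_pow_map n K i (G_pow n K (k - i + 2) (obj_copy L))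
                      (G_comult n K (G_pow n K (k - i) (obj_copy L))))\<rparr>"

definition map_simplicial :: "(('k, 'a) nalg \<Rightarrow> ('k, 'b) nalg) \<Rightarrow>
    (('k, 'a) nalg \<Rightarrow> ('k, 'a) nalg \<Rightarrow> ('a \<Rightarrow> 'a) \<Rightarrow> 'b \<Rightarrow> 'b) \<Rightarrow>
    ('k, 'a) simplicial \<Rightarrow> ('k, 'b) simplicial" where
  "map_simplicial I Imap S = \<lparr>
     obj = (\<lambda>k. I (obj S k)),
     face = (\<lambda>k i. Imap (obj S k) (obj S (k - 1)) (face S k i)),
     degen = (\<lambda>k i. Imap (obj S k) (obj S (k + 1)) (degen S k i))\<rparr>"

definition moore :: "('k, 'a) simplicial \<Rightarrow> nat \<Rightarrow> 'a set" where
  "moore S k = {x \<in> carrier (obj S k). \<forall>i<k. face S k i x = \<zero>\<^bsub>obj S (k - 1)\<^esub>}"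

definition moore_cycles :: "('k, 'a) simplicial \<Rightarrow> nat \<Rightarrow> 'a set" where
  "moore_cycles S m = {x \<in> moore S m. m > 0 \<longrightarrow> face S m m x = \<zero>\<^bsub>obj S (m - 1)\<^esub>}"

definition moore_boundaries :: "('k, 'a) simplicial \<Rightarrow> nat \<Rightarrow> 'a set" where
  "moore_boundaries S m = face S (m + 1) (m + 1) ` moore S (m + 1)"

definition moore_homology :: "('k, 'a) simplicial \<Rightarrow> nat \<Rightarrow> ('k, 'a set) nalg" where
  "moore_homology S m = quot_alg ((obj S m)\<lparr>carrier := moore_cycles S m\<rparr>) (moore_boundaries S m)"

text \<open>Note the index shift: \<open>H\<^sub>j(L, I)\<close> is the homology of the Moore complex in degree \<open>j - 1\<close>.\<close>

definition G_homology :: "nat \<Rightarrow> ('k, 'r) ring_scheme \<Rightarrow> nat \<Rightarrow> ('k, 'a) nalg \<Rightarrow>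
    (('k, ('k, 'a) lterm) nalg \<Rightarrow> ('k, 'b) nalg) \<Rightarrow>
    (('k, ('k, 'a) lterm) nalg \<Rightarrow> ('k, ('k, 'a) lterm) nalg \<Rightarrow>
      (('k, 'a) lterm \<Rightarrow> ('k, 'a) lterm) \<Rightarrow> 'b \<Rightarrow> 'b) \<Rightarrow> ('k, 'b set) nalg" where
  "G_homology n K j L I Imap = moore_homology (map_simplicial I Imap (G_resolution n K L)) (j - 1)"


section \<open>Higher presentations\<close>

text \<open>
  An m-fold arrow: \<open>vertex f I\<close> is \<open>f\<^sub>I\<close>, and \<open>edge f I J\<close> is the map \<open>f\<^sub>I \<rightarrow> f\<^sub>J\<close> for \<open>I \<subseteq> J\<close>.
  Taking all \<open>f\<^sub>I\<close> over one type \<open>'a\<close> loses no generality, as any finite family of sets embeds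
  into a common type.
\<close>

record ('k, 'a) cube =
  vertex :: "nat set \<Rightarrow> ('k, 'a) nalg"
  edge :: "nat set \<Rightarrow> nat set \<Rightarrow> 'a \<Rightarrow> 'a"

definition fold_arrow :: "nat \<Rightarrow> ('k, 'r) ring_scheme \<Rightarrow> nat \<Rightarrow> ('k, 'a) cube \<Rightarrow> bool" where
  "fold_arrow n K m f \<longleftrightarrow>
     (\<forall>I\<subseteq>{1..m}. leibniz_algebra n K (vertex f I)) \<and>
     (\<forall>J\<subseteq>{1..m}. \<forall>I\<subseteq>J. edge f I J \<in> nalg_hom n K (vertex f I) (vertex f J)) \<and>
     (\<forall>I\<subseteq>{1..m}. \<forall>x\<in>carrier (vertex f I). edge f I I x = x) \<and>
     (\<forall>M\<subseteq>{1..m}. \<forall>J\<subseteq>M. \<forall>I\<subseteq>J. \<forall>x\<in>carrier (vertex f I). edge f J M (edge f I J x) = edge f I M x)"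

definition proper_supersets :: "nat \<Rightarrow> nat set \<Rightarrow> nat set set" where
  "proper_supersets m I = {J. I \<subset> J \<and> J \<subseteq> {1..m}}"

text \<open>The underlying set of the limit of \<open>f\<^sub>J\<close> over \<open>J \<supset> I\<close>: the compatible families.\<close>

definition cube_limit :: "nat \<Rightarrow> ('k, 'a) cube \<Rightarrow> nat set \<Rightarrow> (nat set \<Rightarrow> 'a) set" where
  "cube_limit m f I = {x \<in> (\<Pi>\<^sub>E J\<in>proper_supersets m I. carrier (vertex f J)).
     \<forall>J\<in>proper_supersets m I. \<forall>M\<in>proper_supersets m I. J \<subseteq> M \<longrightarrow> edge f J M (x J) = x M}"

definition fold_extension :: "nat \<Rightarrow> ('k, 'r) ring_scheme \<Rightarrow> nat \<Rightarrow> ('k, 'a) cube \<Rightarrow> bool" where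
  "fold_extension n K m f \<longleftrightarrow> fold_arrow n K m f \<and>
     (\<forall>I\<subset>{1..m}. (\<lambda>y. \<lambda>J\<in>proper_supersets m I. edge f I J y) ` carrier (vertex f I) = cube_limit m f I)"

text \<open>
  Projectivity with respect to surjective homomorphisms. A definition can only quantify over algebras
  on a fixed type; \<^typ>\<open>('k, 'a) lterm\<close> is large enough to contain the free algebra on the elements
  of \<open>P\<close>, and \<open>projective_lift\<close> below shows that the lifting property for algebras on arbitrary types
  follows.
\<close>

definition projective_alg :: "nat \<Rightarrow> ('k, 'r) ring_scheme \<Rightarrow> ('k, 'a) nalg \<Rightarrow> bool" where
  "projective_alg n K P \<longleftrightarrow>
     (\<forall>(B :: ('k, ('k, 'a) lterm) nalg) (C :: ('k, ('k, 'a) lterm) nalg). \<forall>p g.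
        leibniz_algebra n K B \<and> leibniz_algebra n K C \<and>
        p \<in> nalg_hom n K B C \<and> p ` carrier B = carrier C \<and> g \<in> nalg_hom n K P C \<longrightarrow>
        (\<exists>h \<in> nalg_hom n K P B. \<forall>x\<in>carrier P. p (h x) = g x))"

definition fold_presentation ::
  "nat \<Rightarrow> ('k, 'r) ring_scheme \<Rightarrow> nat \<Rightarrow> ('k, 'a) cube \<Rightarrow> ('k, 'a) nalg \<Rightarrow> bool" where
  "fold_presentation n K m f L \<longleftrightarrow> fold_extension n K m f \<and> vertex f {1..m} = L \<and>
     (\<forall>I\<subset>{1..m}. projective_alg n K (vertex f I))"

text \<open>\<open>kernel_inter f I\<close> is the intersection of the \<open>K[f\<^sub>i]\<close>, \<open>i \<in> I\<close>, inside the initial vertex.\<close>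

definition kernel_inter :: "('k, 'a) cube \<Rightarrow> nat set \<Rightarrow> 'a set" where
  "kernel_inter f I = carrier (vertex f {}) \<inter>
     (\<Inter>i\<in>I. a_kernel (vertex f {}) (vertex f {i}) (edge f {} {i}))"

definition covers :: "nat \<Rightarrow> nat \<Rightarrow> nat set list set" where
  "covers n m = {Is. length Is = n \<and> \<Union>(set Is) = {1..m}}"

definition hopf_numerator :: "nat \<Rightarrow> ('k, 'r) ring_scheme \<Rightarrow> nat \<Rightarrow> ('k, 'a) cube \<Rightarrow> 'a set" where
  "hopf_numerator n K m f =
     rel_commutator n K (vertex f {}) (replicate n (carrier (vertex f {}))) \<inter> kernel_inter f {1..m}"

definition hopf_denominator :: "nat \<Rightarrow> ('k, 'r) ring_scheme \<Rightarrow> nat \<Rightarrow> ('k, 'a) cube \<Rightarrow> 'a set" where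
  "hopf_denominator n K m f = ideal_sum (vertex f {}) (covers n m)
     (\<lambda>Is. rel_commutator n K (vertex f {}) (map (kernel_inter f) Is))"

definition field_char :: "('k, 'r) ring_scheme \<Rightarrow> nat" where
  "field_char K = (if \<exists>p::nat. p > 0 \<and> [p] \<cdot>\<^bsub>K\<^esub> \<one>\<^bsub>K\<^esub> = \<zero>\<^bsub>K\<^esub>
     then (LEAST p::nat. p > 0 \<and> [p] \<cdot>\<^bsub>K\<^esub> \<one>\<^bsub>K\<^esub> = \<zero>\<^bsub>K\<^esub>) else 0)"


section \<open>Free algebras are free, and projectivity does not depend on the test type\<close>

lemma terms_over_foldr:
  "set ts \<subseteq> terms_over n K X \<Longrightarrow> foldr Add ts Zero \<in> terms_over n K X"
  by (induction ts) (auto intro: terms_over.intros)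

lemma terms_over_BracketI:
  "length ts = n \<Longrightarrow> set ts \<subseteq> terms_over n K X \<Longrightarrow> Bracket ts \<in> terms_over n K X"
  by (auto intro: terms_over.Bracket)

lemma terms_over_Bracket_update:
  assumes "length ts = n" "set ts \<subseteq> terms_over n K X" "t \<in> terms_over n K X"
  shows "Bracket (ts[i := t]) \<in> terms_over n K X"
  using assms set_update_subset_insert[of ts i t] by (intro terms_over_BracketI) auto

lemma term_eq_terms_over:
  assumes "field K" "n > 0" "term_eq n K X s t"
  shows "s \<in> terms_over n K X \<and> t \<in> terms_over n K X"
proof -
  interpret field K by fact
  show ?thesis using assms(3)
  proof induction
    case (leibniz ts us)
    have b: "Bracket (t # us) \<in> terms_over n K X" if "t \<in> terms_over n K X" for t
      using leibniz assms(2) that by (intro terms_over_BracketI) auto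
    have "Bracket (ts[i := Bracket (ts ! i # us)]) \<in> terms_over n K X" if "i < n" for i
      using leibniz that by (intro terms_over_Bracket_update b) auto
    then show ?case
      using b leibniz by (auto intro!: terms_over_foldr intro: terms_over_BracketI)
  qed (auto intro!: terms_over.Var terms_over.Zero terms_over.Add terms_over.Smult terms_over_Bracket_update)
qed

lemma canon_eq: "t \<in> terms_over n K X \<Longrightarrow> term_eq n K X t (canon n K X t)"
  unfolding canon_def by (rule someI) (rule term_eq.refl)

lemma canon_cong: "term_eq n K X s t \<Longrightarrow> canon n K X s = canon n K X t"
  unfolding canon_def by (rule arg_cong[where f = Eps]) (blast intro: term_eq.sym term_eq.trans)

lemma canon_terms_over:
  "field K \<Longrightarrow> n > 0 \<Longrightarrow> t \<in> terms_over n K X \<Longrightarrow> canon n K X t \<in> terms_over n K X"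
  using canon_eq term_eq_terms_over by blast

lemma canon_Add:
  "s \<in> terms_over n K X \<Longrightarrow> t \<in> terms_over n K X \<Longrightarrow>
    canon n K X (Add (canon n K X s) (canon n K X t)) = canon n K X (Add s t)"
  by (intro canon_cong[symmetric] term_eq.cong_add canon_eq)

lemma canon_Smult:
  "a \<in> carrier K \<Longrightarrow> t \<in> terms_over n K X \<Longrightarrow>
    canon n K X (Smult a (canon n K X t)) = canon n K X (Smult a t)"
  by (intro canon_cong[symmetric] term_eq.cong_smult canon_eq)

lemma canon_Bracket:
  assumes "field K" "n > 0" "length ts = n" "set ts \<subseteq> terms_over n K X"
  shows "canon n K X (Bracket (map (canon n K X) ts)) = canon n K X (Bracket ts)"
proof -
  let ?c = "canon n K X"
  have "term_eq n K X (Bracket ts) (Bracket (map ?c (take k ts) @ drop k ts))" if "k \<le> n" for k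
    using that
  proof (induction k)
    case 0
    then show ?case using assms by (auto intro!: term_eq.refl terms_over_BracketI)
  next
    case (Suc k)
    let ?us = "map ?c (take k ts) @ drop k ts"
    have k: "k < length ts" using Suc assms by simp
    have us: "length ?us = n" "set ?us \<subseteq> terms_over n K X"
      using assms Suc by (auto dest!: in_set_takeD in_set_dropD intro: canon_terms_over)
    have "term_eq n K X (Bracket (?us[k := ts ! k])) (Bracket (?us[k := ?c (ts ! k)]))"
      using us k assms by (intro term_eq.cong_bracket canon_eq) auto
    moreover have "?us[k := ts ! k] = ?us"
      using k by (intro nth_equalityI) (auto simp: nth_list_update nth_append)
    moreover have "?us[k := ?c (ts ! k)] = map ?c (take (Suc k) ts) @ drop (Suc k) ts"
      using k by (intro nth_equalityI) (auto simp: nth_list_update nth_append min_def less_Suc_eq)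
    ultimately show ?case using Suc term_eq.trans by fastforce
  qed
  from this[of n] show ?thesis using assms canon_cong by fastforce
qed

lemma (in abelian_monoid) foldr_eq_finsum:
  "distinct xs \<Longrightarrow> g \<in> set xs \<rightarrow> carrier G \<Longrightarrow>
    foldr (\<lambda>x y. g x \<oplus> y) xs \<zero> = finsum G g (set xs)"
  by (induction xs) (auto simp: finsum_insert Pi_def)

lemma free_alg_simps:
  "carrier (free_alg n K X) = canon n K X ` terms_over n K X"
  "\<zero>\<^bsub>free_alg n K X\<^esub> = canon n K X Zero"
  "s \<oplus>\<^bsub>free_alg n K X\<^esub> t = canon n K X (Add s t)"
  "a \<odot>\<^bsub>free_alg n K X\<^esub> t = canon n K X (Smult a t)"
  "bracket (free_alg n K X) ts = canon n K X (Bracket ts)"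
  by (simp_all add: free_alg_def)

lemma list_canonE:
  assumes "set xs \<subseteq> canon n K X ` terms_over n K X"
  obtains ts where "xs = map (canon n K X) ts" "set ts \<subseteq> terms_over n K X" "length ts = length xs"
proof -
  have "\<exists>ts. xs = map (canon n K X) ts \<and> set ts \<subseteq> terms_over n K X"
    using assms
  proof (induction xs)
    case (Cons x xs)
    then obtain ts t where "xs = map (canon n K X) ts" "set ts \<subseteq> terms_over n K X"
      "x = canon n K X t" "t \<in> terms_over n K X" by auto
    then show ?case by (intro exI[of _ "t # ts"]) auto
  qed auto
  then show thesis using that by auto
qed

theorem leibniz_algebra_free_alg:
  assumes "field K" "n > 0"
  shows "leibniz_algebra n K (free_alg n K X)"
proof -
  interpret field K by fact
  let ?F = "free_alg n K X" and ?c = "canon n K X" and ?T = "terms_over n K X"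
  note T = terms_over.Zero terms_over.Add terms_over.Smult
  have ab: "abelian_group ?F"
  proof (rule abelian_groupI)
    fix x assume "x \<in> carrier ?F"
    then obtain t where t: "x = ?c t" "t \<in> ?T" by (auto simp: free_alg_simps)
    have "term_eq n K X (Add (Smult (\<ominus>\<^bsub>K\<^esub> \<one>\<^bsub>K\<^esub>) t) t) (Add (Smult (\<ominus>\<^bsub>K\<^esub> \<one>\<^bsub>K\<^esub>) t) (Smult \<one>\<^bsub>K\<^esub> t))"
      using t by (intro term_eq.cong_add term_eq.refl T term_eq.smult_one[THEN term_eq.sym]) auto
    moreover have "term_eq n K X \<dots> (Smult (\<ominus>\<^bsub>K\<^esub> \<one>\<^bsub>K\<^esub> \<oplus>\<^bsub>K\<^esub> \<one>\<^bsub>K\<^esub>) t)"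
      using t by (intro term_eq.smult_l_distr[THEN term_eq.sym]) auto
    moreover have "term_eq n K X \<dots> Zero"
      using t by (simp add: l_neg term_eq.smult_zero)
    ultimately have "?c (Add (Smult (\<ominus>\<^bsub>K\<^esub> \<one>\<^bsub>K\<^esub>) t) t) = ?c Zero"
      by (intro canon_cong) (blast intro: term_eq.trans)
    then show "\<exists>y\<in>carrier ?F. y \<oplus>\<^bsub>?F\<^esub> x = \<zero>\<^bsub>?F\<^esub>"
      using t by (intro bexI[of _ "?c (Smult (\<ominus>\<^bsub>K\<^esub> \<one>\<^bsub>K\<^esub>) t)"]) (auto simp: free_alg_simps canon_Add T)
  next
    fix x y z assume "x \<in> carrier ?F" "y \<in> carrier ?F" "z \<in> carrier ?F"
    then show "x \<oplus>\<^bsub>?F\<^esub> y \<oplus>\<^bsub>?F\<^esub> z = x \<oplus>\<^bsub>?F\<^esub> (y \<oplus>\<^bsub>?F\<^esub> z)"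
      by (auto simp: free_alg_simps canon_Add T) (auto intro: canon_cong term_eq.add_assoc)
  next
    fix x assume "x \<in> carrier ?F"
    then show "\<zero>\<^bsub>?F\<^esub> \<oplus>\<^bsub>?F\<^esub> x = x"
      by (auto simp: free_alg_simps canon_Add T) (auto intro: canon_cong term_eq.add_zero)
  qed (auto simp: free_alg_simps canon_Add T canon_terms_over assms
         intro!: canon_cong term_eq.add_comm T)
  have mod: "module K ?F"
    by (rule moduleI[OF is_cring ab], auto simp: free_alg_simps canon_Add canon_Smult T)
       (auto intro!: canon_cong term_eq.smult_l_distr term_eq.smult_r_distr term_eq.smult_assoc
           term_eq.smult_one T)
  interpret F: module K ?F by fact
  show ?thesis
  proof (intro leibniz_algebra.intro leibniz_algebra_axioms.intro mod \<open>field K\<close>)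
    fix xs :: "('a, 'c) lterm list" assume "length xs = n" and xs: "set xs \<subseteq> carrier ?F"
    then obtain ts where ts: "xs = map ?c ts" "set ts \<subseteq> ?T" "length ts = n"
      by (metis free_alg_simps(1) list_canonE)
    show "bracket ?F xs \<in> carrier ?F"
      using ts assms by (auto simp: free_alg_simps canon_Bracket intro!: imageI terms_over_BracketI)
    have upd: "set (ts[i := t]) \<subseteq> ?T" if "t \<in> ?T" for i t
      using set_update_subset_insert[of ts i t] that ts by auto
    have br: "bracket ?F (xs[i := ?c t]) = ?c (Bracket (ts[i := t]))" if "t \<in> ?T" for i t
      using upd[OF that] ts assms by (simp add: free_alg_simps canon_Bracket map_update[symmetric])
    {
      fix i x y assume i: "i < n" and "x \<in> carrier ?F" "y \<in> carrier ?F"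
      then obtain s t where st: "x = ?c s" "y = ?c t" "s \<in> ?T" "t \<in> ?T" by (auto simp: free_alg_simps)
      have "x \<oplus>\<^bsub>?F\<^esub> y = ?c (Add s t)" using st by (simp add: free_alg_simps canon_Add)
      then show "bracket ?F (xs[i := x \<oplus>\<^bsub>?F\<^esub> y]) = bracket ?F (xs[i := x]) \<oplus>\<^bsub>?F\<^esub> bracket ?F (xs[i := y])"
        using st i ts(2,3)
        by (simp add: br T(2) free_alg_simps(3) canon_Add terms_over_Bracket_update)
           (intro canon_cong term_eq.bracket_add)
    next
      fix i a x assume i: "i < n" and a: "a \<in> carrier K" and "x \<in> carrier ?F"
      then obtain t where t: "x = ?c t" "t \<in> ?T" by (auto simp: free_alg_simps)
      have "a \<odot>\<^bsub>?F\<^esub> x = ?c (Smult a t)" using t a by (simp add: free_alg_simps canon_Smult)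
      then show "bracket ?F (xs[i := a \<odot>\<^bsub>?F\<^esub> x]) = a \<odot>\<^bsub>?F\<^esub> bracket ?F (xs[i := x])"
        using t i a ts(2,3)
        by (simp add: br T(3) free_alg_simps(4) canon_Smult terms_over_Bracket_update)
           (intro canon_cong term_eq.bracket_smult)
    next
      fix ys :: "('a, 'c) lterm list" assume "length ys = n - 1" "set ys \<subseteq> carrier ?F"
      then obtain us where us: "ys = map ?c us" "set us \<subseteq> ?T" "length us = n - 1"
        by (metis free_alg_simps(1) list_canonE)
      have bT: "Bracket (t # us) \<in> ?T" if "t \<in> ?T" for t
        using us that assms by (intro terms_over_BracketI) auto
      have b: "bracket ?F (?c t # ys) = ?c (Bracket (t # us))" if "t \<in> ?T" for t
        using canon_Bracket[of K n "t # us" X] us that assms by (simp add: free_alg_simps)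
      let ?g = "\<lambda>i. Bracket (ts[i := Bracket (ts ! i # us)])"
      have gT: "?g i \<in> ?T" if "i < n" for i
        using ts that by (intro terms_over_Bracket_update bT) auto
      have g: "bracket ?F (xs[i := bracket ?F (xs ! i # ys)]) = ?c (?g i)" if "i < n" for i
      proof -
        have "ts ! i \<in> ?T" "xs ! i = ?c (ts ! i)" using that ts by auto
        then show ?thesis using br[OF bT] by (simp add: b)
      qed
      have fold: "?c (foldr Add (map ?g is) Zero) = foldr (\<lambda>i y. ?c (?g i) \<oplus>\<^bsub>?F\<^esub> y) is \<zero>\<^bsub>?F\<^esub>"
        if "set is \<subseteq> {..<n}" for "is" using that
      proof (induction "is")
        case (Cons i js)
        then have "foldr Add (map ?g js) Zero \<in> ?T"
          by (intro terms_over_foldr) (auto intro!: gT)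
        with Cons gT[of i] show ?case by (simp add: free_alg_simps(3) flip: Cons(1) canon_Add)
      qed (simp add: free_alg_simps)
      have "bracket ?F (bracket ?F xs # ys) = ?c (Bracket (Bracket ts # us))"
      proof -
        have "bracket ?F xs = ?c (Bracket ts)" "Bracket ts \<in> ?T"
          using ts assms by (simp_all add: free_alg_simps(5) canon_Bracket terms_over_BracketI)
        then show ?thesis using b by simp
      qed
      also have "\<dots> = ?c (foldr Add (map ?g [0..<n]) Zero)"
        using ts us by (intro canon_cong term_eq.leibniz)
      also have "\<dots> = foldr (\<lambda>i y. ?c (?g i) \<oplus>\<^bsub>?F\<^esub> y) [0..<n] \<zero>\<^bsub>?F\<^esub>"
        by (intro fold) auto
      also have "\<dots> = (\<Oplus>\<^bsub>?F\<^esub>i\<in>{..<n}. ?c (?g i))"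
        using gT by (subst F.foldr_eq_finsum) (auto simp: free_alg_simps(1) atLeast0LessThan intro!: imageI)
      also have "\<dots> = (\<Oplus>\<^bsub>?F\<^esub>i\<in>{..<n}. bracket ?F (xs[i := bracket ?F (xs ! i # ys)]))"
        by (intro F.finsum_cong') (auto simp: g free_alg_simps(1) gT intro!: imageI)
      finally show "bracket ?F (bracket ?F xs # ys) =
        (\<Oplus>\<^bsub>?F\<^esub>i\<in>{..<n}. bracket ?F (xs[i := bracket ?F (xs ! i # ys)]))" .
    }
  qed
qed

lemma free_lift_closed:
  assumes "leibniz_algebra n K B" "\<phi> \<in> X \<rightarrow> carrier B" "t \<in> terms_over n K X"
  shows "free_lift B \<phi> t \<in> carrier B"
proof -
  interpret leibniz_algebra n K B by fact
  show ?thesis using assms(3)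
    by induction (use assms(2) in \<open>auto intro!: bracket_closed\<close>)
qed

lemma free_lift_cong:
  assumes "leibniz_algebra n K B" "n > 0" "\<phi> \<in> X \<rightarrow> carrier B" "term_eq n K X s t"
  shows "free_lift B \<phi> s = free_lift B \<phi> t"
proof -
  interpret leibniz_algebra n K B by fact
  note cl = free_lift_closed[OF assms(1,3)]
  have cll: "set (map (free_lift B \<phi>) ts) \<subseteq> carrier B" if "set ts \<subseteq> terms_over n K X" for ts
    using that cl by auto
  show ?thesis using assms(4)
  proof induction
    case (add_assoc s t u)
    then show ?case using cl by (auto simp: M.add.m_assoc)
  next
    case (add_comm s t)
    then show ?case using cl by (auto simp: M.add.m_comm)
  next
    case (leibniz ts us)
    let ?h = "free_lift B \<phi>"
    let ?b = "\<lambda>i. bracket B ((map ?h ts)[i := bracket B (map ?h ts ! i # map ?h us)])"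
    have bc: "?b i \<in> carrier B" if "i < n" for i
    proof -
      have "bracket B (map ?h ts ! i # map ?h us) \<in> carrier B"
        using that leibniz cl assms(2) by (intro bracket_closed) (auto simp: subset_iff)
      then show ?thesis
        using leibniz cll[of ts] set_update_subset_insert[of "map ?h ts" i]
        by (intro bracket_closed) (auto, blast)
    qed
    have "?h (Bracket (Bracket ts # us)) = (\<Oplus>\<^bsub>B\<^esub>i\<in>{..<n}. ?b i)"
      using leibniz_identity[of "map ?h ts" "map ?h us"] leibniz cll by auto
    also have "\<dots> = foldr (\<lambda>i y. ?b i \<oplus>\<^bsub>B\<^esub> y) [0..<n] \<zero>\<^bsub>B\<^esub>"
      using bc by (subst M.foldr_eq_finsum) (auto simp: atLeast0LessThan)
    also have "\<dots> = ?h (foldr Add (map (\<lambda>i. Bracket (ts[i := Bracket (ts ! i # us)])) is) Zero)"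
      if "is = [0..<n]" for "is"
    proof -
      have "set is \<subseteq> {..<n}" using that by auto
      then have "foldr (\<lambda>i y. ?b i \<oplus>\<^bsub>B\<^esub> y) is \<zero>\<^bsub>B\<^esub> =
        ?h (foldr Add (map (\<lambda>i. Bracket (ts[i := Bracket (ts ! i # us)])) is) Zero)"
        using leibniz(1) by (induction "is") (auto simp: map_update)
      then show ?thesis using that by simp
    qed
    finally show ?case by simp
  next
    case (bracket_add ts i s t)
    then show ?case using leibniz_algebra.bracket_add[OF assms(1), of "map (free_lift B \<phi>) ts" i "free_lift B \<phi> s" "free_lift B \<phi> t"] cl cll[of ts]
      by (auto simp: map_update)
  next
    case (bracket_smult ts i a t)
    then show ?case using leibniz_algebra.bracket_smult[OF assms(1), of "map (free_lift B \<phi>) ts" i a "free_lift B \<phi> t"] cl cll[of ts]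
      by (auto simp: map_update)
  qed (use cl in \<open>auto simp: map_update smult_assoc1 smult_l_distr smult_r_distr\<close>)
qed

theorem free_lift_hom:
  assumes "leibniz_algebra n K B" "n > 0" "\<phi> \<in> X \<rightarrow> carrier B"
  shows "free_lift B \<phi> \<in> nalg_hom n K (free_alg n K X) B"
    and "x \<in> X \<Longrightarrow> free_lift B \<phi> (gen n K X x) = \<phi> x"
proof -
  interpret leibniz_algebra n K B by fact
  have K: "field K" by unfold_locales
  have c: "free_lift B \<phi> (canon n K X t) = free_lift B \<phi> t" if "t \<in> terms_over n K X" for t
    using free_lift_cong[OF assms canon_eq[OF that]] by simp
  show "x \<in> X \<Longrightarrow> free_lift B \<phi> (gen n K X x) = \<phi> x"
    by (simp add: gen_def c terms_over.Var)
  have "set xs \<subseteq> carrier (free_alg n K X) \<Longrightarrow> set xs \<subseteq> terms_over n K X" for xs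
    using canon_terms_over[OF K assms(2)] by (auto simp: free_alg_simps)
  then show "free_lift B \<phi> \<in> nalg_hom n K (free_alg n K X) B"
    using free_lift_closed[OF assms(1,3)] canon_terms_over[OF K assms(2)]
    by (auto simp: nalg_hom_def free_alg_simps c canon_Add canon_Smult
        terms_over.Add terms_over.Smult terms_over_BracketI)
qed

theorem free_alg_hom_unique:
  assumes "leibniz_algebra n K B" "n > 0"
    and h: "h \<in> nalg_hom n K (free_alg n K X) B" and h': "h' \<in> nalg_hom n K (free_alg n K X) B"
    and gens: "\<And>x. x \<in> X \<Longrightarrow> h (gen n K X x) = h' (gen n K X x)"
    and y: "y \<in> carrier (free_alg n K X)"
  shows "h y = h' y"
proof -
  interpret B: leibniz_algebra n K B by fact
  have K: "field K" by unfold_locales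
  interpret F: leibniz_algebra n K "free_alg n K X" by (rule leibniz_algebra_free_alg[OF K assms(2)])
  let ?c = "canon n K X" and ?F = "free_alg n K X"
  have P0: "\<zero>\<^bsub>K\<^esub> \<in> carrier K" by simp
  have zero: "g (?c Zero) = \<zero>\<^bsub>B\<^esub>" if "g \<in> nalg_hom n K ?F B" for g
  proof -
    have "g (\<zero>\<^bsub>K\<^esub> \<odot>\<^bsub>?F\<^esub> \<zero>\<^bsub>?F\<^esub>) = \<zero>\<^bsub>K\<^esub> \<odot>\<^bsub>B\<^esub> g \<zero>\<^bsub>?F\<^esub>" and "g \<zero>\<^bsub>?F\<^esub> \<in> carrier B"
      using that P0 F.M.zero_closed unfolding nalg_hom_def by (blast, blast)
    moreover have "\<zero>\<^bsub>K\<^esub> \<odot>\<^bsub>?F\<^esub> \<zero>\<^bsub>?F\<^esub> = \<zero>\<^bsub>?F\<^esub>" by simp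
    ultimately have "g \<zero>\<^bsub>?F\<^esub> = \<zero>\<^bsub>B\<^esub>" by (metis B.smult_l_null)
    then show ?thesis by (simp only: free_alg_simps(2))
  qed
  have "h (?c t) = h' (?c t)" if "t \<in> terms_over n K X" for t using that
  proof induction
    case (Var x)
    then show ?case using gens by (simp add: gen_def)
  next
    case Zero
    show ?case unfolding zero[OF h] zero[OF h'] ..
  next
    case (Add s t)
    have e: "g (?c (Add s t)) = g (?c s) \<oplus>\<^bsub>B\<^esub> g (?c t)" if "g \<in> nalg_hom n K ?F B" for g
    proof -
      have "?c s \<oplus>\<^bsub>?F\<^esub> ?c t = ?c (Add s t)" "?c s \<in> carrier ?F" "?c t \<in> carrier ?F"
        using Add by (auto simp: canon_Add free_alg_simps)
      with that show ?thesis unfolding nalg_hom_def mem_Collect_eq by metis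
    qed
    show ?case using e[OF h] e[OF h'] Add by simp
  next
    case (Smult a t)
    have e: "g (?c (Smult a t)) = a \<odot>\<^bsub>B\<^esub> g (?c t)" if "g \<in> nalg_hom n K ?F B" for g
    proof -
      have "a \<odot>\<^bsub>?F\<^esub> ?c t = ?c (Smult a t)" "?c t \<in> carrier ?F"
        using Smult by (auto simp: canon_Smult free_alg_simps)
      with that Smult show ?thesis unfolding nalg_hom_def mem_Collect_eq by metis
    qed
    show ?case using e[OF h] e[OF h'] Smult by simp
  next
    case (Bracket ts)
    have e: "g (?c (Bracket ts)) = bracket B (map (g \<circ> ?c) ts)" if "g \<in> nalg_hom n K ?F B" for g
    proof -
      have "bracket ?F (map ?c ts) = ?c (Bracket ts)" "set (map ?c ts) \<subseteq> carrier ?F"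
        using Bracket K assms(2) by (auto simp: canon_Bracket subset_iff free_alg_simps)
      with that Bracket(1) show ?thesis unfolding nalg_hom_def mem_Collect_eq
        by (metis length_map map_map)
    qed
    show ?case unfolding e[OF h] e[OF h']
      by (rule arg_cong[where f = "bracket B"]) (use Bracket in auto)
  qed
  then show ?thesis using y by (auto simp: free_alg_simps)
qed

theorem leibniz_algebra_obj_copy:
  assumes "leibniz_algebra n K L"
  shows "leibniz_algebra n K (obj_copy L)"
proof -
  interpret L: leibniz_algebra n K L by fact
  let ?C = "obj_copy L"
  have simps: "carrier ?C = Obj ` carrier L" "\<zero>\<^bsub>?C\<^esub> = Obj \<zero>\<^bsub>L\<^esub>"
    "s \<oplus>\<^bsub>?C\<^esub> t = Obj (the_obj s \<oplus>\<^bsub>L\<^esub> the_obj t)" "a \<odot>\<^bsub>?C\<^esub> t = Obj (a \<odot>\<^bsub>L\<^esub> the_obj t)"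
    "bracket ?C ts = Obj (bracket L (map the_obj ts))" for s t a ts
    by (simp_all add: obj_copy_def)
  have ab: "abelian_group ?C"
  proof (rule abelian_groupI)
    fix x assume "x \<in> carrier ?C"
    then obtain a where "x = Obj a" "a \<in> carrier L" by (auto simp: simps)
    then show "\<exists>y\<in>carrier ?C. y \<oplus>\<^bsub>?C\<^esub> x = \<zero>\<^bsub>?C\<^esub>"
      by (intro bexI[of _ "Obj (\<ominus>\<^bsub>L\<^esub> a)"]) (auto simp: simps L.M.l_neg)
  qed (auto simp: simps L.M.add.m_assoc L.M.add.m_comm L.M.add.m_lcomm)
  have mod: "module K ?C"
    by (rule moduleI[OF L.K.is_cring ab])
       (auto simp: simps L.smult_l_distr L.smult_r_distr L.smult_assoc1)
  interpret C: module K ?C by fact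
  have sum: "finsum ?C g A = Obj (finsum L (the_obj \<circ> g) A)"
    if "finite A" "g \<in> A \<rightarrow> carrier ?C" for g and A :: "nat set" using that
  proof induction
    case (insert i A)
    moreover have "the_obj \<circ> g \<in> A \<rightarrow> carrier L" "the_obj (g i) \<in> carrier L"
      using insert by (auto simp: simps Pi_def image_iff)
    ultimately show ?case
      by (auto simp: C.finsum_insert L.M.finsum_insert simps(3) Pi_def)
  qed (simp add: simps)
  have the: "the_obj x \<in> carrier L" if "x \<in> carrier ?C" for x
    using that by (auto simp: simps(1))
  have thes: "set (map the_obj xs) \<subseteq> carrier L" if "set xs \<subseteq> carrier ?C" for xs
    using that the by auto
  show ?thesis
  proof (intro leibniz_algebra.intro leibniz_algebra_axioms.intro mod)
    show "field K" by unfold_locales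
    fix xs assume xs: "length xs = n" "set xs \<subseteq> carrier ?C"
    then show bc: "bracket ?C xs \<in> carrier ?C"
      using thes[of xs] unfolding simps(5)
      by (intro simps(1)[THEN equalityD2, THEN subsetD] imageI L.bracket_closed) auto
    {
      fix i x y assume "i < n" "x \<in> carrier ?C" "y \<in> carrier ?C"
      then show "bracket ?C (xs[i := x \<oplus>\<^bsub>?C\<^esub> y]) = bracket ?C (xs[i := x]) \<oplus>\<^bsub>?C\<^esub> bracket ?C (xs[i := y])"
        using xs L.bracket_add[of "map the_obj xs" i "the_obj x" "the_obj y"] the thes
        by (auto simp: simps(3-5) map_update)
    next
      fix i a x assume "i < n" "a \<in> carrier K" "x \<in> carrier ?C"
      then show "bracket ?C (xs[i := a \<odot>\<^bsub>?C\<^esub> x]) = a \<odot>\<^bsub>?C\<^esub> bracket ?C (xs[i := x])"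
        using xs L.bracket_smult[of "map the_obj xs" i a "the_obj x"] the thes
        by (auto simp: simps(3-5) map_update)
    next
      fix ys assume ys: "length ys = n - 1" "set ys \<subseteq> carrier ?C"
      have bc: "bracket ?C zs \<in> carrier ?C" if "length zs = n" "set zs \<subseteq> carrier ?C" for zs
        using that thes[of zs] unfolding simps(5)
        by (intro simps(1)[THEN equalityD2, THEN subsetD] imageI L.bracket_closed) auto
      have mem: "bracket ?C (xs[i := bracket ?C (xs ! i # ys)]) \<in> carrier ?C" if "i < n" for i
      proof -
        have "bracket ?C (xs ! i # ys) \<in> carrier ?C"
          using that xs ys by (intro bc) (auto simp: subset_iff)
        then show ?thesis using xs set_update_subset_insert[of xs i "bracket ?C (xs ! i # ys)"]
          by (intro bc) auto
      qed
      have "(\<Oplus>\<^bsub>?C\<^esub>i\<in>{..<n}. bracket ?C (xs[i := bracket ?C (xs ! i # ys)])) =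
        Obj (\<Oplus>\<^bsub>L\<^esub>i\<in>{..<n}. the_obj (bracket ?C (xs[i := bracket ?C (xs ! i # ys)])))"
        using mem by (subst sum) (auto simp: comp_def)
      also have "\<dots> = Obj (\<Oplus>\<^bsub>L\<^esub>i\<in>{..<n}.
        bracket L ((map the_obj xs)[i := bracket L (map the_obj xs ! i # map the_obj ys)]))"
        using the[OF mem] xs
        by (intro arg_cong[where f = Obj] L.M.finsum_cong') (auto simp: simps map_update)
      also have "\<dots> = bracket ?C (bracket ?C xs # ys)"
        using L.leibniz_identity[of "map the_obj xs" "map the_obj ys"] xs ys thes
        by (simp add: simps(5))
      finally show "bracket ?C (bracket ?C xs # ys) =
        (\<Oplus>\<^bsub>?C\<^esub>i\<in>{..<n}. bracket ?C (xs[i := bracket ?C (xs ! i # ys)]))" ..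
    }
  qed
qed

lemma nalg_hom_comp:
  "g \<in> nalg_hom n K A B \<Longrightarrow> h \<in> nalg_hom n K B C \<Longrightarrow> (\<lambda>x. h (g x)) \<in> nalg_hom n K A C"
proof -
  assume g: "g \<in> nalg_hom n K A B" and h: "h \<in> nalg_hom n K B C"
  have "h (g (bracket A xs)) = bracket C (map (\<lambda>x. h (g x)) xs)"
    if xs: "length xs = n" "set xs \<subseteq> carrier A" for xs
  proof -
    have "g (bracket A xs) = bracket B (map g xs)" using g xs by (simp add: nalg_hom_def)
    moreover have "h (bracket B (map g xs)) = bracket C (map h (map g xs))"
    proof -
      have "set (map g xs) \<subseteq> carrier B" using g xs by (auto simp: nalg_hom_def)
      then show ?thesis using h xs(1) unfolding nalg_hom_def mem_Collect_eq by (metis length_map)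
    qed
    ultimately show ?thesis by (simp add: comp_def)
  qed
  with g h show ?thesis by (simp add: nalg_hom_def Pi_iff)
qed

theorem projective_lift:
  fixes B :: "('k, 'b) nalg" and C :: "('k, 'c) nalg" and P :: "('k, 'a) nalg"
  assumes P: "leibniz_algebra n K P" "projective_alg n K P" and "n > 0"
    and B: "leibniz_algebra n K B" and C: "leibniz_algebra n K C"
    and p: "p \<in> nalg_hom n K B C" "p ` carrier B = carrier C" and g: "g \<in> nalg_hom n K P C"
  shows "\<exists>h \<in> nalg_hom n K P B. \<forall>x\<in>carrier P. p (h x) = g x"
proof -
  interpret P: leibniz_algebra n K P by fact
  have K: "field K" by unfold_locales
  let ?C = "obj_copy P" let ?F = "G_obj n K ?C"
  note C' = leibniz_algebra_obj_copy[OF P(1)]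
  have F: "leibniz_algebra n K ?F"
    unfolding G_obj_def by (rule leibniz_algebra_free_alg[OF K \<open>n > 0\<close>])
  have \<epsilon>: "G_counit ?C \<in> nalg_hom n K ?F ?C" "\<And>x. x \<in> carrier ?C \<Longrightarrow> G_counit ?C (gen n K (carrier ?C) x) = x"
    unfolding G_obj_def G_counit_def using free_lift_hom[OF C' \<open>n > 0\<close>, of "\<lambda>x. x" "carrier ?C"] by auto
  have gen: "gen n K (carrier ?C) x \<in> carrier ?F" if "x \<in> carrier ?C" for x
    using that by (auto simp: G_obj_def gen_def free_alg_simps intro: terms_over.Var)
  have surj: "G_counit ?C ` carrier ?F = carrier ?C"
    using \<epsilon> gen by (auto simp: nalg_hom_def image_iff) (metis \<epsilon>(2))
  have obj: "Obj \<in> nalg_hom n K P ?C" and unobj: "the_obj \<in> nalg_hom n K ?C P"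
    by (auto simp: nalg_hom_def obj_copy_def comp_def)
  obtain s where s: "s \<in> nalg_hom n K P ?F" "\<And>x. x \<in> carrier P \<Longrightarrow> G_counit ?C (s x) = Obj x"
    using P(2)[unfolded projective_alg_def, rule_format, of ?F ?C "G_counit ?C" Obj] F C' \<epsilon> surj obj by blast
  have "\<forall>x\<in>carrier ?C. \<exists>b\<in>carrier B. p b = g (the_obj x)"
    using g p(2) by (auto simp: obj_copy_def nalg_hom_def image_iff Pi_def) (metis imageE)
  then obtain b where b: "b \<in> carrier ?C \<rightarrow> carrier B" "\<And>x. x \<in> carrier ?C \<Longrightarrow> p (b x) = g (the_obj x)"
    by (metis Pi_I)
  note l = free_lift_hom[OF B \<open>n > 0\<close> b(1), folded G_obj_def]
  have eq: "p (free_lift B b y) = g (the_obj (G_counit ?C y))" if "y \<in> carrier ?F" for y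
    using free_alg_hom_unique[OF C \<open>n > 0\<close>, of "\<lambda>y. p (free_lift B b y)" "carrier ?C"
        "\<lambda>y. g (the_obj (G_counit ?C y))" y] that l \<epsilon> b(2)
      nalg_hom_comp[OF l(1) p(1)] nalg_hom_comp[OF nalg_hom_comp[OF \<epsilon>(1) unobj] g]
    by (simp add: G_obj_def)
  show ?thesis
  proof (intro bexI ballI)
    show "(\<lambda>x. free_lift B b (s x)) \<in> nalg_hom n K P B" by (rule nalg_hom_comp[OF s(1) l(1)])
    fix x assume "x \<in> carrier P"
    then show "p (free_lift B b (s x)) = g x" using s eq by (auto simp: nalg_hom_def Pi_def)
  qed
qed

end

theory Submission
  imports Defs
begin

text \<open>
  The theorem expresses the homology of \<open>L\<close> through the commutators of an arbitrary m-fold presentation.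
  The reason is that both sides are computed by one and the same quotient of the resolution.

  Everything rests on one construction, \<open>joint_commutator\<close>: for a family of ideals, the span of all commutators
  \<open>[l\<^sub>1, \<dots>, l\<^sub>n] - sgn \<sigma> [l\<^bsub>\<sigma> 1\<^esub>, \<dots>, l\<^bsub>\<sigma> n\<^esub>]\<close> whose arguments meet every member of the family. It is an
  ideal (\<open>ideal_joint_commutator\<close>). For the empty family it is the kernel \<open>V P\<close> of the reflection
  \<open>P \<rightarrow> nlie P\<close>, and for the kernels \<open>K[f\<^sub>i]\<close> it is the denominator of the formula. So the right-hand
  side is \<open>V P \<inter> \<Inter>\<^sub>i K[f\<^sub>i]\<close> modulo \<open>D P\<close>, where \<open>P = f\<^sub>\<emptyset>\<close> and \<open>D P\<close> is the joint commutator of the kernels.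
  Multilinearity has one consequence that is used over and over (\<open>joint_commutator_difference\<close>): if two
  homomorphisms agree modulo an ideal \<open>N\<close>, their difference maps a joint commutator into one that involves \<open>N\<close> in addition.

  An extension lifts compatible families of elements from any upward closed set of vertices to the whole
  cube, and therefore it also lifts maps out of cubes of projective algebras (\<open>extend_cube_map\<close>). Two conclusions:

  \<^item> If all vertices of the cube are projective, the terminal one included, then the cube has sections in all directions.
    The resulting endomorphisms \<open>e\<^sub>j\<close> of \<open>P\<close> kill the kernel in direction \<open>j\<close> and preserve the others.
    An element \<open>x\<close> of \<open>V P\<close> in all kernels equals \<open>x - e\<^sub>j x\<close>, so that one direction after the other enters
    the joint commutator: the right-hand side of the formula vanishes for such a cube
    (\<open>projective_cube_commutators\<close>). In the same way, elements whose images are commutators can be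
    corrected by commutators (\<open>projective_cube_lift_commutators\<close>).

  \<^item> Two maps from a presentation to an extension that agree at the terminal vertex induce the same map on the right-hand side
    (\<open>cube_maps_agree_modulo_commutators\<close>). Changing the map in one direction at a time
    reduces this to maps that agree on one face in direction \<open>k\<close>; on the opposite face, the previous point applies.
    Hence the right-hand side depends on \<open>L\<close> only.

  The faces of the comonadic resolution \<open>X\<close> of \<open>L\<close> form a presentation of \<open>L\<close> with initial vertex
  \<open>X\<^bsub>m-1\<^esub>\<close> (\<open>resolution_cube_extension\<close>): adding a direction amounts to taking the counit \<open>G F \<rightarrow> F\<close>, which the insertion of generators
  splits naturally on underlying sets. It remains to treat this presentation. As in the long exact sequence for
  \<open>V X \<rightarrow> X \<rightarrow> nlie X\<close>, consider the elements \<open>t\<close> of \<open>X\<^sub>m\<close> with \<open>\<partial>\<^sub>i t = 0\<close> for \<open>i < m\<close> and \<open>\<partial>\<^sub>m t \<in> V X\<^bsub>m-1\<^esub>\<close>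
  (\<open>lifted_cycles\<close>). They map onto the m-cycles of \<open>nlie X\<close> by the quotient map, and onto the numerator
  \<open>V X\<^bsub>m-1\<^esub> \<inter> \<Inter>\<^sub>i ker \<partial>\<^sub>i\<close> by \<open>\<partial>\<^sub>m\<close>. The faces before the last one form a cube of free algebras, so by the first
  point the elements of \<open>V X\<^sub>m\<close> they annihilate form a joint commutator, which \<open>\<partial>\<^sub>m\<close>
  maps onto \<open>D X\<^bsub>m-1\<^esub>\<close>. Therefore an element goes to a boundary under the first map precisely when it goes to \<open>D X\<^bsub>m-1\<^esub>\<close>
  under the second one, and the two quotients coincide.
\<close>


section \<open>Homomorphisms, subalgebras and quotients\<close>

text \<open>
  Ideals, quotients and homomorphisms are defined for plain records only, so the locale fixes the
  record type; for \<open>n = 0\<close> the Leibniz identity would involve brackets of a wrong length.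
\<close>

locale nalgebra = leibniz_algebra n K L
  for n :: nat and K :: "('k, 'r) ring_scheme" (structure) and L :: "('k, 'a) nalg" (structure) +
  assumes n_pos: "n > 0"

lemma nalgebraI: "leibniz_algebra n K L \<Longrightarrow> n > 0 \<Longrightarrow> nalgebra n K L"
  by (simp add: nalgebra_def nalgebra_axioms_def)

lemma nalg_homI:
  assumes "\<And>x. x \<in> carrier A \<Longrightarrow> h x \<in> carrier B"
    and "\<And>x y. x \<in> carrier A \<Longrightarrow> y \<in> carrier A \<Longrightarrow> h (x \<oplus>\<^bsub>A\<^esub> y) = h x \<oplus>\<^bsub>B\<^esub> h y"
    and "\<And>a x. a \<in> carrier K \<Longrightarrow> x \<in> carrier A \<Longrightarrow> h (a \<odot>\<^bsub>A\<^esub> x) = a \<odot>\<^bsub>B\<^esub> h x"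
    and "\<And>xs. length xs = n \<Longrightarrow> set xs \<subseteq> carrier A \<Longrightarrow> h (bracket A xs) = bracket B (map h xs)"
  shows "h \<in> nalg_hom n K A B"
  using assms by (auto simp: nalg_hom_def)

lemma
  assumes "h \<in> nalg_hom n K A B"
  shows nalg_hom_closed: "\<And>x. x \<in> carrier A \<Longrightarrow> h x \<in> carrier B"
    and nalg_hom_add: "\<And>x y. x \<in> carrier A \<Longrightarrow> y \<in> carrier A \<Longrightarrow> h (x \<oplus>\<^bsub>A\<^esub> y) = h x \<oplus>\<^bsub>B\<^esub> h y"
    and nalg_hom_smult: "\<And>a x. a \<in> carrier K \<Longrightarrow> x \<in> carrier A \<Longrightarrow> h (a \<odot>\<^bsub>A\<^esub> x) = a \<odot>\<^bsub>B\<^esub> h x"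
    and nalg_hom_bracket:
      "\<And>xs. length xs = n \<Longrightarrow> set xs \<subseteq> carrier A \<Longrightarrow> h (bracket A xs) = bracket B (map h xs)"
  using assms by (auto simp: nalg_hom_def)

lemma nalg_hom_id: "(\<lambda>x. x) \<in> nalg_hom n K A A"
  by (rule nalg_homI) auto

lemma
  assumes "nalgebra n K A" "nalgebra n K B" and h: "h \<in> nalg_hom n K A B"
  shows nalg_hom_zero: "h \<zero>\<^bsub>A\<^esub> = \<zero>\<^bsub>B\<^esub>"
    and nalg_hom_uminus: "\<And>x. x \<in> carrier A \<Longrightarrow> h (\<ominus>\<^bsub>A\<^esub> x) = \<ominus>\<^bsub>B\<^esub> h x"
    and nalg_hom_minus: "\<And>x y. x \<in> carrier A \<Longrightarrow> y \<in> carrier A \<Longrightarrow> h (x \<ominus>\<^bsub>A\<^esub> y) = h x \<ominus>\<^bsub>B\<^esub> h y"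
proof -
  interpret A: nalgebra n K A by fact
  interpret B: nalgebra n K B by fact
  note [simp] = nalg_hom_closed[OF h]
  have "h \<zero>\<^bsub>A\<^esub> \<oplus>\<^bsub>B\<^esub> h \<zero>\<^bsub>A\<^esub> = h \<zero>\<^bsub>A\<^esub>"
    using nalg_hom_add[OF h, of "\<zero>\<^bsub>A\<^esub>" "\<zero>\<^bsub>A\<^esub>"] by simp
  then show z: "h \<zero>\<^bsub>A\<^esub> = \<zero>\<^bsub>B\<^esub>" by (metis A.M.zero_closed B.M.add.r_cancel_one' nalg_hom_closed[OF h])
  show u: "h (\<ominus>\<^bsub>A\<^esub> x) = \<ominus>\<^bsub>B\<^esub> h x" if x: "x \<in> carrier A" for x
  proof -
    have "h (\<ominus>\<^bsub>A\<^esub> x) \<oplus>\<^bsub>B\<^esub> h x = \<zero>\<^bsub>B\<^esub>"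
      using nalg_hom_add[OF h, of "\<ominus>\<^bsub>A\<^esub> x" x] x by (simp add: A.M.l_neg z)
    then show ?thesis using x by (intro B.M.minus_equality[symmetric]) auto
  qed
  show "h (x \<ominus>\<^bsub>A\<^esub> y) = h x \<ominus>\<^bsub>B\<^esub> h y" if "x \<in> carrier A" "y \<in> carrier A" for x y
    using that by (simp add: a_minus_def nalg_hom_add[OF h] u)
qed

lemma additive_finsum:
  assumes "abelian_monoid A" "abelian_monoid B"
    and "\<And>x. x \<in> carrier A \<Longrightarrow> h x \<in> carrier B"
    and "\<And>x y. x \<in> carrier A \<Longrightarrow> y \<in> carrier A \<Longrightarrow> h (x \<oplus>\<^bsub>A\<^esub> y) = h x \<oplus>\<^bsub>B\<^esub> h y"
    and "h \<zero>\<^bsub>A\<^esub> = \<zero>\<^bsub>B\<^esub>" "finite I" "\<And>i. i \<in> I \<Longrightarrow> g i \<in> carrier A"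
  shows "h (finsum A g I) = (\<Oplus>\<^bsub>B\<^esub>i\<in>I. h (g i))"
proof -
  interpret A: abelian_monoid A by fact
  interpret B: abelian_monoid B by fact
  show ?thesis using assms(6,7)
  proof (induction I)
    case (insert i I)
    then have "finsum A g (insert i I) = g i \<oplus>\<^bsub>A\<^esub> finsum A g I"
      by (intro A.finsum_insert) auto
    moreover have "(\<Oplus>\<^bsub>B\<^esub>j\<in>insert i I. h (g j)) = h (g i) \<oplus>\<^bsub>B\<^esub> (\<Oplus>\<^bsub>B\<^esub>j\<in>I. h (g j))"
      using insert assms(3) by (intro B.finsum_insert) auto
    ultimately show ?case using insert assms(4) A.finsum_closed[of g I] by (auto simp: Pi_def)
  qed (simp add: assms(5))
qed

lemma set_subset_imageE:
  assumes "set xs \<subseteq> p ` C"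
  obtains ys where "xs = map p ys" "set ys \<subseteq> C" "length ys = length xs"
proof -
  have "\<exists>ys. xs = map p ys \<and> set ys \<subseteq> C"
    using assms
  proof (induction xs)
    case (Cons x xs)
    then obtain ys y where "xs = map p ys" "set ys \<subseteq> C" "x = p y" "y \<in> C" by auto
    then show ?case by (intro exI[of _ "y # ys"]) auto
  qed auto
  then show thesis using that by auto
qed

lemma set_list_update_subset: "set xs \<subseteq> C \<Longrightarrow> x \<in> C \<Longrightarrow> set (xs[i := x]) \<subseteq> C"
  using set_update_subset_insert[of xs i x] by auto

lemma (in nalgebra) leibniz_summand_closed:
  assumes "length xs = n" "set xs \<subseteq> carrier L" "length ys = n - 1" "set ys \<subseteq> carrier L" "i < n"
  shows "bracket L (xs ! i # ys) \<in> carrier L"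
    and "bracket L (xs[i := bracket L (xs ! i # ys)]) \<in> carrier L"
proof -
  show "bracket L (xs ! i # ys) \<in> carrier L" using assms by (intro bracket_closed) auto
  then show "bracket L (xs[i := bracket L (xs ! i # ys)]) \<in> carrier L"
    using assms by (intro bracket_closed set_list_update_subset) auto
qed

text \<open>
  The algebras constructed below are images of subalgebras, so their axioms follow from these two
  transfer principles.
\<close>

lemma nalgebra_surj_image:
  assumes "nalgebra n K A" and p: "p \<in> nalg_hom n K A B"
    and surj: "p ` carrier A = carrier B" and zero: "p \<zero>\<^bsub>A\<^esub> = \<zero>\<^bsub>B\<^esub>"
  shows "nalgebra n K B"
proof -
  interpret A: nalgebra n K A by fact
  note pc = nalg_hom_closed[OF p] and padd = nalg_hom_add[OF p, symmetric]
    and psm = nalg_hom_smult[OF p, symmetric] and pbr = nalg_hom_bracket[OF p, symmetric]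
  have ab: "abelian_group B"
  proof (rule abelian_groupI)
    fix x assume "x \<in> carrier B"
    then obtain a where a: "x = p a" "a \<in> carrier A" using surj by auto
    then show "\<exists>y\<in>carrier B. y \<oplus>\<^bsub>B\<^esub> x = \<zero>\<^bsub>B\<^esub>"
      using zero pc by (intro bexI[of _ "p (\<ominus>\<^bsub>A\<^esub> a)"]) (simp_all add: padd A.M.l_neg)
  next
    show "\<zero>\<^bsub>B\<^esub> \<in> carrier B" using zero pc[of "\<zero>\<^bsub>A\<^esub>"] by simp
  qed (auto simp: padd pc A.M.add.m_assoc A.M.add.m_comm A.M.add.m_lcomm simp flip: zero surj)
  have mod: "module K B"
    by (rule moduleI[OF A.K.is_cring ab])
       (auto simp: padd psm pc A.smult_l_distr A.smult_r_distr A.smult_assoc1 simp flip: surj)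
  interpret B: module K B by fact
  show ?thesis
  proof (intro nalgebraI A.n_pos leibniz_algebra.intro leibniz_algebra_axioms.intro mod)
    show "field K" by unfold_locales
    fix xs assume xs: "length xs = n" "set xs \<subseteq> carrier B"
    then obtain us where us: "xs = map p us" "set us \<subseteq> carrier A" "length us = n"
      by (metis set_subset_imageE surj)
    show "bracket B xs \<in> carrier B" using us by (simp add: pbr pc A.bracket_closed)
    note upd = us set_list_update_subset[OF us(2)]
    {
      fix i x y assume "i < n" "x \<in> carrier B" "y \<in> carrier B"
      then obtain a b where "x = p a" "y = p b" "a \<in> carrier A" "b \<in> carrier A"
        unfolding surj[symmetric] by blast
      then show "bracket B (xs[i := x \<oplus>\<^bsub>B\<^esub> y]) = bracket B (xs[i := x]) \<oplus>\<^bsub>B\<^esub> bracket B (xs[i := y])"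
        using upd A.bracket_add[of us i a b] A.bracket_closed \<open>i < n\<close>
        by (simp add: padd pbr map_update[symmetric])
    next
      fix i a x assume "i < n" "a \<in> carrier K" "x \<in> carrier B"
      moreover from this obtain u where "x = p u" "u \<in> carrier A" using surj by auto
      ultimately show "bracket B (xs[i := a \<odot>\<^bsub>B\<^esub> x]) = a \<odot>\<^bsub>B\<^esub> bracket B (xs[i := x])"
        using upd A.bracket_smult[of us i a u] A.bracket_closed
        by (simp add: psm pbr map_update[symmetric])
    next
      fix ys assume "length ys = n - 1" "set ys \<subseteq> carrier B"
      then obtain vs where vs: "ys = map p vs" "set vs \<subseteq> carrier A" "length vs = n - 1"
        by (metis set_subset_imageE surj)
      note cl = A.leibniz_summand_closed[OF us(3,2) vs(3,2)]
      have br: "bracket B (p u # ys) = p (bracket A (u # vs))" if "u \<in> carrier A" for u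
        using pbr[of "u # vs"] vs that A.n_pos by simp
      have e: "bracket B (xs[i := bracket B (xs ! i # ys)]) = p (bracket A (us[i := bracket A (us ! i # vs)]))"
        if "i < n" for i
      proof -
        have "us ! i \<in> carrier A" using us that by auto
        then have "xs[i := bracket B (xs ! i # ys)] = map p (us[i := bracket A (us ! i # vs)])"
          using us that br by (simp add: map_update)
        then show ?thesis using upd cl(1)[OF that] by (simp only: pbr length_list_update)
      qed
      have "bracket B (bracket B xs # ys) = p (bracket A (bracket A us # vs))"
        using us br A.bracket_closed by (simp add: pbr)
      also have "\<dots> = p (\<Oplus>\<^bsub>A\<^esub>i\<in>{..<n}. bracket A (us[i := bracket A (us ! i # vs)]))"
        using A.leibniz_identity us vs by simp
      also have "\<dots> = (\<Oplus>\<^bsub>B\<^esub>i\<in>{..<n}. p (bracket A (us[i := bracket A (us ! i # vs)])))"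
        using cl zero by (intro additive_finsum[OF A.M.abelian_monoid_axioms B.abelian_monoid_axioms])
          (auto simp: padd pc)
      also have "\<dots> = (\<Oplus>\<^bsub>B\<^esub>i\<in>{..<n}. bracket B (xs[i := bracket B (xs ! i # ys)]))"
        using cl by (intro B.finsum_cong') (auto simp: e pc)
      finally show "bracket B (bracket B xs # ys) =
        (\<Oplus>\<^bsub>B\<^esub>i\<in>{..<n}. bracket B (xs[i := bracket B (xs ! i # ys)]))" .
    }
  qed
qed

lemma (in nalgebra) nalgebra_subalgebra:
  assumes S: "submodule S K L"
    and br: "\<And>xs. length xs = n \<Longrightarrow> set xs \<subseteq> S \<Longrightarrow> bracket L xs \<in> S"
  shows "nalgebra n K (L\<lparr>carrier := S\<rparr>)"
proof -
  let ?S = "L\<lparr>carrier := S\<rparr>"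
  have mod: "module K ?S" by (rule submodule.submodule_is_module[OF S module_axioms])
  interpret S: module K ?S by fact
  have SL: "S \<subseteq> carrier L" using S by (rule submoduleE(1))
  show ?thesis
  proof (intro nalgebraI n_pos leibniz_algebra.intro leibniz_algebra_axioms.intro mod)
    show "field K" by unfold_locales
    fix xs ys assume xs: "length xs = n" "set xs \<subseteq> carrier ?S" and ys: "length ys = n - 1" "set ys \<subseteq> carrier ?S"
    have mem: "bracket L (xs[i := bracket L (xs ! i # ys)]) \<in> S" if "i < n" for i
    proof -
      have "bracket L (xs ! i # ys) \<in> S" using xs ys n_pos that by (intro br) (auto simp: subset_iff)
      then have "set (xs[i := bracket L (xs ! i # ys)]) \<subseteq> S"
        using xs by (intro set_list_update_subset) simp_all
      then show ?thesis using xs by (intro br[of "xs[i := bracket L (xs ! i # ys)]"]) simp_all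
    qed
    then have "(\<Oplus>\<^bsub>?S\<^esub>i\<in>{..<n}. bracket L (xs[i := bracket L (xs ! i # ys)])) =
        (\<Oplus>\<^bsub>L\<^esub>i\<in>{..<n}. bracket L (xs[i := bracket L (xs ! i # ys)]))"
      using additive_finsum[OF S.abelian_monoid_axioms abelian_monoid_axioms, of "\<lambda>x. x" "{..<n}"
        "\<lambda>i. bracket L (xs[i := bracket L (xs ! i # ys)])"] SL by auto
    then show "bracket ?S (bracket ?S xs # ys) =
        (\<Oplus>\<^bsub>?S\<^esub>i\<in>{..<n}. bracket ?S (xs[i := bracket ?S (xs ! i # ys)]))"
      using leibniz_identity[of xs ys] xs ys SL by simp
  qed (use br SL in \<open>auto intro!: bracket_add bracket_smult\<close>)
qed

context nalgebra
begin

lemma minus_zero_right: "x \<in> carrier L \<Longrightarrow> x \<ominus>\<^bsub>L\<^esub> \<zero>\<^bsub>L\<^esub> = x"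
  using M.add.inv_one by (simp add: a_minus_def a_inv_def)

lemma minus_eq_zero_iff:
  assumes "x \<in> carrier L" "y \<in> carrier L"
  shows "x \<ominus>\<^bsub>L\<^esub> y = \<zero>\<^bsub>L\<^esub> \<longleftrightarrow> x = y"
proof
  assume "x \<ominus>\<^bsub>L\<^esub> y = \<zero>\<^bsub>L\<^esub>"
  then have "\<ominus>\<^bsub>L\<^esub> (\<ominus>\<^bsub>L\<^esub> y) = x" unfolding a_minus_def by (rule M.minus_equality) (use assms in auto)
  then show "x = y" using assms by simp
qed (use assms in \<open>simp add: a_minus_def M.r_neg\<close>)

lemma minus_add_cancel: "x \<in> carrier L \<Longrightarrow> y \<in> carrier L \<Longrightarrow> (x \<ominus>\<^bsub>L\<^esub> y) \<oplus>\<^bsub>L\<^esub> y = x"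
  by (simp add: a_minus_def M.add.m_assoc M.l_neg)

lemma submodule_zero: "submodule N K L \<Longrightarrow> \<zero>\<^bsub>L\<^esub> \<in> N"
  using subgroup.one_closed[OF submodule.axioms(1)] by fastforce

lemma submodule_minus: "submodule N K L \<Longrightarrow> x \<in> N \<Longrightarrow> y \<in> N \<Longrightarrow> x \<ominus>\<^bsub>L\<^esub> y \<in> N"
  by (simp add: a_minus_def submoduleE)

lemma submodule_finsum:
  assumes "submodule N K L" "finite I" "\<And>i. i \<in> I \<Longrightarrow> g i \<in> N"
  shows "finsum L g I \<in> N"
  using assms(2,3)
proof (induction I)
  case (insert i I)
  then have "finsum L g (insert i I) = g i \<oplus>\<^bsub>L\<^esub> finsum L g I"
    using submoduleE(1)[OF assms(1)] by (intro M.finsum_insert) auto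
  then show ?case using insert submoduleE(5)[OF assms(1)] by simp
qed (simp add: submodule_zero assms)

text \<open>Replacing the entries of a list one at a time reduces a difference to multilinearity.\<close>

lemma multiadditive_telescope:
  assumes closed: "\<And>xs. length xs = n \<Longrightarrow> set xs \<subseteq> carrier L \<Longrightarrow> \<phi> xs \<in> carrier L"
    and add: "\<And>xs i x y. length xs = n \<Longrightarrow> set xs \<subseteq> carrier L \<Longrightarrow> i < n \<Longrightarrow> x \<in> carrier L \<Longrightarrow> y \<in> carrier L \<Longrightarrow>
      \<phi> (xs[i := x \<oplus>\<^bsub>L\<^esub> y]) = \<phi> (xs[i := x]) \<oplus>\<^bsub>L\<^esub> \<phi> (xs[i := y])"
    and N: "submodule N K L"
    and xs: "length xs = n" "set xs \<subseteq> carrier L" and ys: "length ys = n" "set ys \<subseteq> carrier L"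
    and diff: "\<And>k. k < n \<Longrightarrow> \<phi> ((take k xs @ drop k ys)[k := xs ! k \<ominus>\<^bsub>L\<^esub> ys ! k]) \<in> N"
  shows "\<phi> xs \<ominus>\<^bsub>L\<^esub> \<phi> ys \<in> N"
proof -
  let ?z = "\<lambda>k. take k xs @ drop k ys"
  have z: "length (?z k) = n" "set (?z k) \<subseteq> carrier L" if "k \<le> n" for k
    using that xs ys by (auto dest: in_set_takeD in_set_dropD)
  have "\<phi> (?z k) \<ominus>\<^bsub>L\<^esub> \<phi> ys \<in> N" if "k \<le> n" for k
    using that
  proof (induction k)
    case 0
    then show ?case using closed[OF ys] submodule_zero[OF N] by (simp add: M.r_neg a_minus_def)
  next
    case (Suc k)
    let ?d = "xs ! k \<ominus>\<^bsub>L\<^esub> ys ! k"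
    have k: "k < n" "xs ! k \<in> carrier L" "ys ! k \<in> carrier L" using Suc xs ys by auto
    then have d: "?d \<in> carrier L" by simp
    have e1: "?z (Suc k) = (?z k)[k := xs ! k]" and e0: "?z k = (?z k)[k := ys ! k]"
      using k xs ys by (auto intro!: nth_equalityI simp: nth_append nth_list_update min_def less_Suc_eq)
    have "xs ! k = ?d \<oplus>\<^bsub>L\<^esub> ys ! k" using k by (simp add: a_minus_def M.add.m_assoc M.l_neg)
    then have "\<phi> (?z (Suc k)) = \<phi> ((?z k)[k := ?d]) \<oplus>\<^bsub>L\<^esub> \<phi> (?z k)"
      using add[of "?z k" k ?d "ys ! k"] z[of k] k d e0 e1 by simp
    moreover have "\<phi> ((?z k)[k := ?d]) \<in> carrier L" "\<phi> (?z k) \<in> carrier L" "\<phi> ys \<in> carrier L"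
      using closed[of "?z k"] closed[of "(?z k)[k := ?d]"] closed[OF ys] z[of k] k(1) d
        set_list_update_subset[of "?z k" "carrier L" ?d k] by auto
    ultimately have "\<phi> (?z (Suc k)) \<ominus>\<^bsub>L\<^esub> \<phi> ys = \<phi> ((?z k)[k := ?d]) \<oplus>\<^bsub>L\<^esub> (\<phi> (?z k) \<ominus>\<^bsub>L\<^esub> \<phi> ys)"
      by (simp add: a_minus_def M.add.m_assoc)
    then show ?case using Suc diff[OF k(1)] submoduleE(5)[OF N] by simp
  qed
  from this[of n] show ?thesis using xs ys by simp
qed

lemma ideal_submodule: "nalg_ideal n K L N \<Longrightarrow> submodule N K L"
  by (simp add: nalg_ideal_def)

lemma ideal_bracket:
  "nalg_ideal n K L N \<Longrightarrow> length xs = n \<Longrightarrow> set xs \<subseteq> carrier L \<Longrightarrow> x \<in> set xs \<Longrightarrow> x \<in> N \<Longrightarrow> bracket L xs \<in> N"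
  unfolding nalg_ideal_def by blast

lemma bracket_zero:
  assumes "length xs = n" "set xs \<subseteq> carrier L" "i < n"
  shows "bracket L (xs[i := \<zero>\<^bsub>L\<^esub>]) = \<zero>\<^bsub>L\<^esub>"
proof -
  have "bracket L (xs[i := \<zero>\<^bsub>K\<^esub> \<odot>\<^bsub>L\<^esub> \<zero>\<^bsub>L\<^esub>]) = \<zero>\<^bsub>K\<^esub> \<odot>\<^bsub>L\<^esub> bracket L (xs[i := \<zero>\<^bsub>L\<^esub>])"
    by (rule bracket_smult) (use assms in auto)
  moreover have "bracket L (xs[i := \<zero>\<^bsub>L\<^esub>]) \<in> carrier L"
    using assms by (intro bracket_closed set_list_update_subset) auto
  ultimately show ?thesis by simp
qed

lemma bracket_cong_ideal:
  assumes N: "nalg_ideal n K L N"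
    and xs: "length xs = n" "set xs \<subseteq> carrier L" and ys: "length ys = n" "set ys \<subseteq> carrier L"
    and diff: "\<And>k. k < n \<Longrightarrow> xs ! k \<ominus>\<^bsub>L\<^esub> ys ! k \<in> N"
  shows "bracket L xs \<ominus>\<^bsub>L\<^esub> bracket L ys \<in> N"
proof (rule multiadditive_telescope[OF bracket_closed bracket_add ideal_submodule[OF N] xs ys])
  fix k assume k: "k < n"
  let ?z = "(take k xs @ drop k ys)[k := xs ! k \<ominus>\<^bsub>L\<^esub> ys ! k]"
  have "xs ! k \<ominus>\<^bsub>L\<^esub> ys ! k \<in> set ?z" using k xs ys by (intro set_update_memI) auto
  moreover have "set ?z \<subseteq> carrier L"
    using xs ys k nth_mem[of k xs] nth_mem[of k ys]
    by (intro set_list_update_subset M.minus_closed) (auto dest: in_set_takeD in_set_dropD)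
  ultimately show "bracket L ?z \<in> N"
    using diff[OF k] xs ys k by (intro ideal_bracket[OF N, of ?z]) auto
qed auto

lemma coset_eq_iff:
  assumes N: "submodule N K L" and "x \<in> carrier L" "y \<in> carrier L"
  shows "N +>\<^bsub>L\<^esub> x = N +>\<^bsub>L\<^esub> y \<longleftrightarrow> x \<ominus>\<^bsub>L\<^esub> y \<in> N"
proof -
  interpret abelian_subgroup N L
    by (rule abelian_subgroupI2[OF M.a_comm_group submodule.axioms(1)[OF N]])
  have "x \<in> N +>\<^bsub>L\<^esub> y \<longleftrightarrow> x \<ominus>\<^bsub>L\<^esub> y \<in> N"
    unfolding a_minus_def by (rule a_rcos_module[OF assms(3,2)])
  moreover have "N +>\<^bsub>L\<^esub> x = N +>\<^bsub>L\<^esub> y" if "x \<in> N +>\<^bsub>L\<^esub> y"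
    by (rule a_repr_independence'[OF that assms(3), symmetric])
  moreover have "x \<in> N +>\<^bsub>L\<^esub> x" by (rule a_rcos_self[OF assms(2)])
  ultimately show ?thesis by metis
qed

lemma coset_self: "submodule N K L \<Longrightarrow> x \<in> carrier L \<Longrightarrow> x \<in> N +>\<^bsub>L\<^esub> x"
  using abelian_subgroup.a_rcos_self[OF abelian_subgroupI2[OF M.a_comm_group submodule.axioms(1)]] .

lemma in_coset_iff:
  assumes N: "submodule N K L" and "y \<in> carrier L"
  shows "x \<in> N +>\<^bsub>L\<^esub> y \<longleftrightarrow> x \<in> carrier L \<and> x \<ominus>\<^bsub>L\<^esub> y \<in> N"
proof -
  interpret abelian_subgroup N L
    by (rule abelian_subgroupI2[OF M.a_comm_group submodule.axioms(1)[OF N]])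
  have "N +>\<^bsub>L\<^esub> y \<subseteq> carrier L" using M.a_r_coset_subset_G[OF a_subset assms(2)] .
  then show ?thesis using a_rcos_module[OF assms(2), of x] unfolding a_minus_def by blast
qed

end

abbreviation coset_map :: "('k, 'a) nalg \<Rightarrow> 'a set \<Rightarrow> 'a \<Rightarrow> 'a set" where
  "coset_map L N x \<equiv> N +>\<^bsub>L\<^esub> x"

lemma
  assumes "nalgebra n K L" and N: "nalg_ideal n K L N"
  shows coset_map_hom: "coset_map L N \<in> nalg_hom n K L (quot_alg L N)"
    and coset_map_surj: "coset_map L N ` carrier L = carrier (quot_alg L N)"
    and nalgebra_quot: "nalgebra n K (quot_alg L N)"
    and coset_map_eq_zero: "\<And>x. x \<in> carrier L \<Longrightarrow> coset_map L N x = \<zero>\<^bsub>quot_alg L N\<^esub> \<longleftrightarrow> x \<in> N"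
proof -
  interpret L: nalgebra n K L by fact
  let ?Q = "quot_alg L N"
  note sub = L.ideal_submodule[OF N]
  note subE = L.submoduleE[OF sub]
  interpret N: abelian_subgroup N L
    by (rule abelian_subgroupI2[OF L.M.a_comm_group submodule.axioms(1)[OF sub]])
  note eq = L.coset_eq_iff[OF sub] and mem = L.in_coset_iff[OF sub]
  show surj: "coset_map L N ` carrier L = carrier ?Q" by (auto simp: quot_alg_def A_RCOSETS_def')
  have smult: "(\<Union>x'\<in>N +>\<^bsub>L\<^esub> x. N +>\<^bsub>L\<^esub> (a \<odot>\<^bsub>L\<^esub> x')) = N +>\<^bsub>L\<^esub> (a \<odot>\<^bsub>L\<^esub> x)"
    if "a \<in> carrier K" "x \<in> carrier L" for a x
  proof -
    have "N +>\<^bsub>L\<^esub> (a \<odot>\<^bsub>L\<^esub> x') = N +>\<^bsub>L\<^esub> (a \<odot>\<^bsub>L\<^esub> x)" if "x' \<in> N +>\<^bsub>L\<^esub> x" for x'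
    proof -
      have x': "x' \<in> carrier L" "x' \<ominus>\<^bsub>L\<^esub> x \<in> N" using that mem \<open>x \<in> carrier L\<close> by auto
      then have "a \<odot>\<^bsub>L\<^esub> (x' \<ominus>\<^bsub>L\<^esub> x) \<in> N" using subE \<open>a \<in> carrier K\<close> by auto
      moreover have "a \<odot>\<^bsub>L\<^esub> (x' \<ominus>\<^bsub>L\<^esub> x) = a \<odot>\<^bsub>L\<^esub> x' \<ominus>\<^bsub>L\<^esub> a \<odot>\<^bsub>L\<^esub> x"
        using x' \<open>a \<in> carrier K\<close> \<open>x \<in> carrier L\<close> by (simp add: a_minus_def L.smult_r_distr L.smult_r_minus)
      ultimately show ?thesis using x' \<open>a \<in> carrier K\<close> \<open>x \<in> carrier L\<close> by (subst eq) auto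
    qed
    then show ?thesis using L.coset_self[OF sub \<open>x \<in> carrier L\<close>] by blast
  qed
  have br: "bracket ?Q (map (coset_map L N) xs) = N +>\<^bsub>L\<^esub> bracket L xs"
    if xs: "length xs = n" "set xs \<subseteq> carrier L" for xs
  proof -
    have e: "N +>\<^bsub>L\<^esub> bracket L ys = N +>\<^bsub>L\<^esub> bracket L xs"
      if "list_all2 (\<in>) ys (map (coset_map L N) xs)" for ys
    proof -
      have ys: "length ys = n" "\<And>k. k < n \<Longrightarrow> ys ! k \<in> N +>\<^bsub>L\<^esub> (xs ! k)"
        using that xs by (auto simp: list_all2_conv_all_nth)
      have ys': "ys ! k \<in> carrier L" "ys ! k \<ominus>\<^bsub>L\<^esub> xs ! k \<in> N" if "k < n" for k
        using mem[of "xs ! k" "ys ! k"] ys(2)[OF that] that xs subsetD[OF xs(2) nth_mem[of k xs]] by auto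
      then have c: "set ys \<subseteq> carrier L" using ys(1) by (auto simp: set_conv_nth)
      show ?thesis using L.bracket_cong_ideal[OF N ys(1) c xs ys'(2)] ys(1) c xs
        by (subst eq) (auto intro: L.bracket_closed)
    qed
    have "xs ! i \<in> N +>\<^bsub>L\<^esub> (xs ! i)" if "i < length xs" for i
      using L.coset_self[OF sub, OF subsetD[OF xs(2) nth_mem[OF that]]] .
    then have "list_all2 (\<in>) xs (map (coset_map L N) xs)"
      by (simp add: list_all2_conv_all_nth)
    with e have "(\<Union>ys\<in>{ys. list_all2 (\<in>) ys (map (coset_map L N) xs)}. N +>\<^bsub>L\<^esub> bracket L ys) =
        N +>\<^bsub>L\<^esub> bracket L xs"
      by blast
    then show ?thesis by (simp add: quot_alg_def)
  qed
  show hom: "coset_map L N \<in> nalg_hom n K L ?Q"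
    using surj smult br N.a_rcos_sum by (intro nalg_homI) (auto simp: quot_alg_def)
  have z: "\<zero>\<^bsub>?Q\<^esub> = N" by (simp add: quot_alg_def)
  have z': "N +>\<^bsub>L\<^esub> \<zero>\<^bsub>L\<^esub> = N" using subE(1) by simp
  show "nalgebra n K ?Q"
    by (rule nalgebra_surj_image[OF assms(1) hom surj]) (simp add: z z')
  show "coset_map L N x = \<zero>\<^bsub>?Q\<^esub> \<longleftrightarrow> x \<in> N" if "x \<in> carrier L" for x
    using eq[OF that L.M.zero_closed] that by (simp add: z z' L.minus_zero_right)
qed

text \<open>
  The isomorphism of the theorem arises from an algebra that maps onto both sides with the same kernel.
\<close>

lemma isomorphism_of_common_quotients:
  assumes T: "nalgebra n K T" and A: "nalgebra n K A" and B: "nalgebra n K B"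
    and p: "p \<in> nalg_hom n K T A" "p ` carrier T = carrier A"
    and q: "q \<in> nalg_hom n K T B" "q ` carrier T = carrier B"
    and ker: "\<And>t. t \<in> carrier T \<Longrightarrow> p t = \<zero>\<^bsub>A\<^esub> \<longleftrightarrow> q t = \<zero>\<^bsub>B\<^esub>"
  shows "\<exists>h \<in> nalg_hom n K A B. bij_betw h (carrier A) (carrier B)"
proof -
  interpret T: nalgebra n K T by fact
  interpret A: nalgebra n K A by fact
  interpret B: nalgebra n K B by fact
  define r where "r = inv_into (carrier T) p"
  have r: "r x \<in> carrier T" "p (r x) = x" if "x \<in> carrier A" for x
    using that p(2) inv_into_into[of x p "carrier T"] f_inv_into_f[of x p "carrier T"] by (auto simp: r_def)
  have eq: "q s = q t \<longleftrightarrow> p s = p t" if "s \<in> carrier T" "t \<in> carrier T" for s t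
  proof -
    have "q s = q t \<longleftrightarrow> q (s \<ominus>\<^bsub>T\<^esub> t) = \<zero>\<^bsub>B\<^esub>" "p s = p t \<longleftrightarrow> p (s \<ominus>\<^bsub>T\<^esub> t) = \<zero>\<^bsub>A\<^esub>"
      using that nalg_hom_closed[OF p(1)] nalg_hom_closed[OF q(1)]
      by (simp_all add: nalg_hom_minus[OF T A p(1)] nalg_hom_minus[OF T B q(1)]
          A.minus_eq_zero_iff B.minus_eq_zero_iff)
    then show ?thesis using ker[of "s \<ominus>\<^bsub>T\<^esub> t"] that by simp
  qed
  have qr: "q (r (p t)) = q t" if "t \<in> carrier T" for t
    using that r[of "p t"] nalg_hom_closed[OF p(1)] by (subst eq) auto
  let ?h = "\<lambda>x. q (r x)"
  have hp: "?h x = q t" if "x = p t" "t \<in> carrier T" for x t using qr that by simp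
  have "?h \<in> nalg_hom n K A B"
  proof (rule nalg_homI)
    fix xs assume xs: "length xs = n" "set xs \<subseteq> carrier A"
    have rs: "set (map r xs) \<subseteq> carrier T" "map p (map r xs) = xs"
      using xs r by (auto intro!: map_idI)
    have "?h (bracket A xs) = q (bracket T (map r xs))"
      using xs rs nalg_hom_bracket[OF p(1), of "map r xs"] by (intro hp T.bracket_closed) auto
    then show "?h (bracket A xs) = bracket B (map ?h xs)"
      using nalg_hom_bracket[OF q(1), of "map r xs"] xs rs by (simp add: comp_def)
  next
    fix x y assume "x \<in> carrier A" "y \<in> carrier A"
    then show "?h (x \<oplus>\<^bsub>A\<^esub> y) = ?h x \<oplus>\<^bsub>B\<^esub> ?h y"
      using r nalg_hom_add[OF p(1)] nalg_hom_add[OF q(1)] by (subst hp[of _ "r x \<oplus>\<^bsub>T\<^esub> r y"]) auto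
  next
    fix a x assume "a \<in> carrier K" "x \<in> carrier A"
    then show "?h (a \<odot>\<^bsub>A\<^esub> x) = a \<odot>\<^bsub>B\<^esub> ?h x"
      using r nalg_hom_smult[OF p(1)] nalg_hom_smult[OF q(1)] by (subst hp[of _ "a \<odot>\<^bsub>T\<^esub> r x"]) auto
  qed (use r nalg_hom_closed[OF q(1)] in auto)
  moreover have "inj_on ?h (carrier A)" 
  proof (rule inj_onI)
    fix x y assume "x \<in> carrier A" "y \<in> carrier A" "?h x = ?h y"
    then show "x = y" using eq[of "r x" "r y"] r by simp
  qed
  moreover have "?h ` carrier A = carrier B"
  proof
    show "carrier B \<subseteq> ?h ` carrier A"
    proof
      fix b assume "b \<in> carrier B"
      then obtain t where t: "t \<in> carrier T" "b = q t" using q(2) by auto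
      then show "b \<in> ?h ` carrier A"
        using qr nalg_hom_closed[OF p(1)] by (intro image_eqI[of _ _ "p t"]) auto
    qed
  qed (use r nalg_hom_closed[OF q(1)] in auto)
  ultimately show ?thesis by (auto simp: bij_betw_def)
qed

lemma nalg_hom_kernel_ideal:
  assumes A: "nalgebra n K A" and B: "nalgebra n K B" and h: "h \<in> nalg_hom n K A B"
  shows "nalg_ideal n K A (a_kernel A B h)"
proof -
  interpret A: nalgebra n K A by fact
  interpret B: nalgebra n K B by fact
  have "h (bracket A xs) = \<zero>\<^bsub>B\<^esub>"
    if xs: "length xs = n" "set xs \<subseteq> carrier A" "x \<in> set xs" "h x = \<zero>\<^bsub>B\<^esub>" for xs x
  proof -
    obtain i where i: "i < n" "xs ! i = x" using xs by (auto simp: in_set_conv_nth)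
    have "set (map h xs) \<subseteq> carrier B" using nalg_hom_closed[OF h] that by auto
    then have "bracket B ((map h xs)[i := \<zero>\<^bsub>B\<^esub>]) = \<zero>\<^bsub>B\<^esub>"
      using B.bracket_zero[of "map h xs" i] that i by simp
    moreover have "(map h xs)[i := \<zero>\<^bsub>B\<^esub>] = map h xs"
      using i that by (metis list_update_id nth_map)
    ultimately have "bracket B (map h xs) = \<zero>\<^bsub>B\<^esub>" by simp
    then show ?thesis using nalg_hom_bracket[OF h] that by simp
  qed
  moreover have "submodule {x \<in> carrier A. h x = \<zero>\<^bsub>B\<^esub>} K A"
    by (rule A.submoduleI)
      (auto simp: nalg_hom_zero[OF A B h] nalg_hom_uminus[OF A B h] nalg_hom_add[OF h] nalg_hom_smult[OF h])
  ultimately show ?thesis unfolding nalg_ideal_def a_kernel_def' by (auto intro: A.bracket_closed)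
qed

section \<open>The commutator of a family of ideals\<close>

definition commutator :: "('k, 'a) nalg \<Rightarrow> (nat \<Rightarrow> nat) \<Rightarrow> 'a list \<Rightarrow> 'a" where
  "commutator L \<sigma> xs = bracket L xs \<ominus>\<^bsub>L\<^esub> [sign \<sigma>] \<cdot>\<^bsub>L\<^esub> bracket L (permute_list \<sigma> xs)"

text \<open>
  The empty family gives the kernel of the reflection to Lie algebras; the kernels of an
  m-fold arrow give the denominator of the Hopf formula. A linear span is easier to handle than a
  generated ideal, since it reduces inclusions to single commutators; it turns out to be an ideal anyway.
  Not prescribing the slots in which the ideals occur amounts to summing over all covers.
\<close>

inductive_set joint_commutator ::
    "nat \<Rightarrow> ('k, 'r) ring_scheme \<Rightarrow> ('k, 'a) nalg \<Rightarrow> 'a set set \<Rightarrow> 'a set"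
  for n K L \<N> where
  zero: "\<zero>\<^bsub>L\<^esub> \<in> joint_commutator n K L \<N>"
| commutator: "\<lbrakk>length xs = n; set xs \<subseteq> carrier L; \<forall>N\<in>\<N>. \<exists>x\<in>set xs. x \<in> N; \<sigma> permutes {..<n}\<rbrakk> \<Longrightarrow>
    commutator L \<sigma> xs \<in> joint_commutator n K L \<N>"
| add: "\<lbrakk>x \<in> joint_commutator n K L \<N>; y \<in> joint_commutator n K L \<N>\<rbrakk> \<Longrightarrow>
    x \<oplus>\<^bsub>L\<^esub> y \<in> joint_commutator n K L \<N>"
| smult: "\<lbrakk>a \<in> carrier K; x \<in> joint_commutator n K L \<N>\<rbrakk> \<Longrightarrow>
    a \<odot>\<^bsub>L\<^esub> x \<in> joint_commutator n K L \<N>"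

lemma permute_list_update:
  assumes "\<sigma> permutes {..<length xs}" "i < length xs"
  shows "permute_list \<sigma> (xs[\<sigma> i := x]) = (permute_list \<sigma> xs)[i := x]"
proof (rule nth_equalityI)
  fix j assume j: "j < length (permute_list \<sigma> (xs[\<sigma> i := x]))"
  then have "\<sigma> j < length xs" "\<sigma> i < length xs"
    using assms permutes_in_image[OF assms(1)] by auto
  moreover have "\<sigma> i = \<sigma> j \<longleftrightarrow> i = j" using permutes_inj[OF assms(1)] by (auto dest: injD)
  ultimately show "permute_list \<sigma> (xs[\<sigma> i := x]) ! j = (permute_list \<sigma> xs)[i := x] ! j"
    using j assms by (simp add: permute_list_nth nth_list_update)
qed simp

context nalgebra
begin

lemma signed:
  assumes "x \<in> carrier L"
  shows "[sign \<sigma>] \<cdot>\<^bsub>L\<^esub> x = (if evenperm \<sigma> then x else \<ominus>\<^bsub>L\<^esub> x)"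
proof -
  have "[(1::nat)] \<cdot>\<^bsub>L\<^esub> x = x" using assms by simp
  moreover have "[(1::int)] \<cdot>\<^bsub>L\<^esub> x = [nat 1] \<cdot>\<^bsub>L\<^esub> x" by (rule add_pow_int_ge) simp
  moreover have "[(-1::int)] \<cdot>\<^bsub>L\<^esub> x = \<ominus>\<^bsub>L\<^esub> ([nat (- (-1))] \<cdot>\<^bsub>L\<^esub> x)" by (rule add_pow_int_lt) simp
  ultimately show ?thesis by (simp add: sign_def)
qed

lemma permuted_bracket_closed:
  assumes "length xs = n" "set xs \<subseteq> carrier L" "\<sigma> permutes {..<n}"
  shows "bracket L (permute_list \<sigma> xs) \<in> carrier L"
  using assms by (intro bracket_closed) auto

lemma commutator_eq:
  assumes "length xs = n" "set xs \<subseteq> carrier L" "\<sigma> permutes {..<n}"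
  shows "commutator L \<sigma> xs = bracket L xs \<oplus>\<^bsub>L\<^esub>
    (if evenperm \<sigma> then \<ominus>\<^bsub>L\<^esub> bracket L (permute_list \<sigma> xs) else bracket L (permute_list \<sigma> xs))"
  using permuted_bracket_closed[OF assms] by (simp add: commutator_def signed a_minus_def)

lemma commutator_closed:
  assumes "length xs = n" "set xs \<subseteq> carrier L" "\<sigma> permutes {..<n}"
  shows "commutator L \<sigma> xs \<in> carrier L"
  using permuted_bracket_closed[OF assms] bracket_closed assms by (simp add: commutator_eq)

lemma permute_list_update_inv:
  assumes "length xs = n" "\<sigma> permutes {..<n}" "i < n"
  shows "permute_list \<sigma> (xs[i := x]) = (permute_list \<sigma> xs)[inv_into UNIV \<sigma> i := x]" and "inv_into UNIV \<sigma> i < n"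
proof -
  show *: "inv_into UNIV \<sigma> i < n" using permutes_in_image[OF permutes_inv[OF assms(2)], of i] assms(3) by simp
  show "permute_list \<sigma> (xs[i := x]) = (permute_list \<sigma> xs)[inv_into UNIV \<sigma> i := x]"
    using permute_list_update[of \<sigma> xs "inv_into UNIV \<sigma> i" x] assms * by (simp add: permutes_inverses)
qed

lemma commutator_add:
  assumes "length xs = n" "set xs \<subseteq> carrier L" "i < n" "x \<in> carrier L" "y \<in> carrier L" "\<sigma> permutes {..<n}"
  shows "commutator L \<sigma> (xs[i := x \<oplus>\<^bsub>L\<^esub> y]) = commutator L \<sigma> (xs[i := x]) \<oplus>\<^bsub>L\<^esub> commutator L \<sigma> (xs[i := y])"
proof -
  let ?us = "permute_list \<sigma> xs" let ?j = "inv_into UNIV \<sigma> i"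
  have us: "length ?us = n" "set ?us \<subseteq> carrier L" using assms by auto
  have cl: "bracket L (zs[j := z]) \<in> carrier L"
    if "length zs = n" "set zs \<subseteq> carrier L" "z \<in> carrier L" for zs j z
    using that by (intro bracket_closed set_list_update_subset) auto
  have upd: "set (xs[i := z]) \<subseteq> carrier L" if "z \<in> carrier L" for z
    using that assms by (intro set_list_update_subset)
  have e: "commutator L \<sigma> (xs[i := z]) = bracket L (xs[i := z]) \<oplus>\<^bsub>L\<^esub>
    (if evenperm \<sigma> then \<ominus>\<^bsub>L\<^esub> bracket L (?us[?j := z]) else bracket L (?us[?j := z]))"
    if "z \<in> carrier L" for z
    using assms upd[OF that] permute_list_update_inv[of xs \<sigma> i] by (subst commutator_eq) auto
  show ?thesis
    using assms us cl permute_list_update_inv(2)[of xs \<sigma> i]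
    by (simp add: e bracket_add M.minus_add M.add.m_ac)
qed

lemma bracket_uminus:
  assumes "length xs = n" "set xs \<subseteq> carrier L" "i < n" "x \<in> carrier L"
  shows "bracket L (xs[i := \<ominus>\<^bsub>L\<^esub> x]) = \<ominus>\<^bsub>L\<^esub> bracket L (xs[i := x])"
proof -
  have cl: "bracket L (xs[i := z]) \<in> carrier L" if "z \<in> carrier L" for z
    using assms that by (intro bracket_closed set_list_update_subset) auto
  have "bracket L (xs[i := \<ominus>\<^bsub>L\<^esub> x]) \<oplus>\<^bsub>L\<^esub> bracket L (xs[i := x]) = \<zero>\<^bsub>L\<^esub>"
    using bracket_add[of xs i "\<ominus>\<^bsub>L\<^esub> x" x] bracket_zero[of xs i] assms by (simp add: M.l_neg)
  then show ?thesis using cl assms by (intro M.minus_equality[symmetric]) auto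
qed

text \<open>The Leibniz identity says that \<open>[-, ys]\<close> is a derivation of the bracket, hence of every commutator.\<close>

lemma bracket_commutator:
  assumes xs: "length xs = n" "set xs \<subseteq> carrier L" and ys: "length ys = n - 1" "set ys \<subseteq> carrier L"
    and \<sigma>: "\<sigma> permutes {..<n}"
  shows "bracket L (commutator L \<sigma> xs # ys) =
    (\<Oplus>\<^bsub>L\<^esub>i\<in>{..<n}. commutator L \<sigma> (xs[i := bracket L (xs ! i # ys)]))"
proof -
  let ?us = "permute_list \<sigma> xs" let ?u = "\<lambda>i. xs[i := bracket L (xs ! i # ys)]"
  let ?f = "\<lambda>i. bracket L (?u i)" and ?g = "\<lambda>i. bracket L (permute_list \<sigma> (?u i))"
  have us: "length ?us = n" "set ?us \<subseteq> carrier L" using xs \<sigma> by auto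
  note cl = leibniz_summand_closed[OF xs ys]
  have u: "length (?u i) = n" "set (?u i) \<subseteq> carrier L" if "i < n" for i
    using xs cl(1)[OF that] set_list_update_subset[OF xs(2)] by auto
  have f: "?f \<in> {..<n} \<rightarrow> carrier L" using cl by auto
  have g: "?g \<in> {..<n} \<rightarrow> carrier L" using u permuted_bracket_closed \<sigma> by auto
  have b: "bracket L (bracket L ?us # ys) = finsum L ?g {..<n}"
  proof -
    have "bracket L (?us[i := bracket L (?us ! i # ys)]) = ?g (\<sigma> i)" if "i < n" for i
      using that permute_list_update[of \<sigma> xs i "bracket L (xs ! \<sigma> i # ys)"] permute_list_nth[of \<sigma> xs i] xs \<sigma>
      by simp
    then have "bracket L (bracket L ?us # ys) = (\<Oplus>\<^bsub>L\<^esub>i\<in>{..<n}. ?g (\<sigma> i))"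
      using leibniz_identity[OF us ys] g permutes_in_image[OF \<sigma>]
      by (auto intro!: M.finsum_cong')
    also have "\<dots> = finsum L ?g (\<sigma> ` {..<n})"
      using g permutes_inj_on[OF \<sigma>] permutes_image[OF \<sigma>] by (intro M.finsum_reindex[symmetric]) simp_all
    finally show ?thesis by (simp only: permutes_image[OF \<sigma>])
  qed
  have hd: "length (\<zero>\<^bsub>L\<^esub> # ys) = n" "set (\<zero>\<^bsub>L\<^esub> # ys) \<subseteq> carrier L" using ys n_pos by auto
  have badd: "bracket L ((x \<oplus>\<^bsub>L\<^esub> y) # ys) = bracket L (x # ys) \<oplus>\<^bsub>L\<^esub> bracket L (y # ys)"
    and buminus: "bracket L ((\<ominus>\<^bsub>L\<^esub> x) # ys) = \<ominus>\<^bsub>L\<^esub> bracket L (x # ys)"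
    if "x \<in> carrier L" "y \<in> carrier L" for x y
    using bracket_add[OF hd n_pos that] bracket_uminus[OF hd n_pos that(1)] by simp_all
  have neg: "(\<Oplus>\<^bsub>L\<^esub>i\<in>{..<n}. \<ominus>\<^bsub>L\<^esub> ?g i) = \<ominus>\<^bsub>L\<^esub> finsum L ?g {..<n}"
    using g by (intro additive_finsum[OF abelian_monoid_axioms abelian_monoid_axioms, symmetric])
      (auto simp: M.minus_add Pi_iff)
  have cx: "bracket L xs \<in> carrier L" "bracket L ?us \<in> carrier L" using xs us by (auto intro: bracket_closed)
  have "(\<Oplus>\<^bsub>L\<^esub>i\<in>{..<n}. commutator L \<sigma> (?u i)) =
      (\<Oplus>\<^bsub>L\<^esub>i\<in>{..<n}. ?f i \<oplus>\<^bsub>L\<^esub> (if evenperm \<sigma> then \<ominus>\<^bsub>L\<^esub> ?g i else ?g i))"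
    using f g u \<sigma> by (intro M.finsum_cong') (auto simp: commutator_eq Pi_iff)
  also have "\<dots> = finsum L ?f {..<n} \<oplus>\<^bsub>L\<^esub>
      (\<Oplus>\<^bsub>L\<^esub>i\<in>{..<n}. if evenperm \<sigma> then \<ominus>\<^bsub>L\<^esub> ?g i else ?g i)"
    using f g by (intro M.finsum_addf) (auto simp: Pi_iff)
  also have "\<dots> = bracket L (bracket L xs # ys) \<oplus>\<^bsub>L\<^esub>
      (if evenperm \<sigma> then \<ominus>\<^bsub>L\<^esub> bracket L (bracket L ?us # ys) else bracket L (bracket L ?us # ys))"
    using leibniz_identity[OF xs ys] b neg by simp
  also have "\<dots> = bracket L (commutator L \<sigma> xs # ys)"
    using cx xs \<sigma> by (simp add: commutator_eq badd buminus)
  finally show ?thesis by simp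
qed

lemma submodule_joint_commutator: "submodule (joint_commutator n K L \<N>) K L"
proof (rule submoduleI)
  show sub: "joint_commutator n K L \<N> \<subseteq> carrier L"
  proof
    fix x assume "x \<in> joint_commutator n K L \<N>"
    then show "x \<in> carrier L" by induction (auto intro: commutator_closed)
  qed
  fix x assume x: "x \<in> joint_commutator n K L \<N>"
  then have "(\<ominus>\<^bsub>K\<^esub> \<one>\<^bsub>K\<^esub>) \<odot>\<^bsub>L\<^esub> x \<in> joint_commutator n K L \<N>" by (intro joint_commutator.smult) auto
  then show "\<ominus>\<^bsub>L\<^esub> x \<in> joint_commutator n K L \<N>" using x sub by (simp add: smult_l_minus subset_iff)
qed (auto intro: joint_commutator.intros)

lemma joint_commutator_carrier: "x \<in> joint_commutator n K L \<N> \<Longrightarrow> x \<in> carrier L"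
  using submoduleE(1)[OF submodule_joint_commutator] by blast

lemma ideal_commutator:
  assumes N: "nalg_ideal n K L N"
    and "length xs = n" "set xs \<subseteq> carrier L" "\<sigma> permutes {..<n}" "x \<in> set xs" "x \<in> N"
  shows "commutator L \<sigma> xs \<in> N"
proof -
  have "bracket L xs \<in> N" "bracket L (permute_list \<sigma> xs) \<in> N"
    using assms ideal_bracket[OF N, of xs x] ideal_bracket[OF N, of "permute_list \<sigma> xs" x] by auto
  then show ?thesis
    using assms submoduleE(3,5)[OF ideal_submodule[OF N]] by (simp add: commutator_eq)
qed

lemma joint_commutator_subset:
  assumes "N \<in> \<N>" "nalg_ideal n K L N"
  shows "joint_commutator n K L \<N> \<subseteq> N"
proof
  fix x assume "x \<in> joint_commutator n K L \<N>"
  then show "x \<in> N"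
    by induction (use assms submoduleE(4,5)[OF ideal_submodule[OF assms(2)]]
      submodule_zero[OF ideal_submodule[OF assms(2)]] ideal_commutator[OF assms(2)] in auto)
qed

text \<open>
  In the first slot this is the derivation property. An argument in another slot moves to the first one
  by a transposition, at the cost of a commutator with an entry that lies in all ideals of the family.
\<close>

lemma ideal_joint_commutator:
  assumes \<N>: "\<And>N. N \<in> \<N> \<Longrightarrow> nalg_ideal n K L N"
  shows "nalg_ideal n K L (joint_commutator n K L \<N>)"
proof -
  let ?J = "joint_commutator n K L \<N>"
  note E = submoduleE[OF submodule_joint_commutator]
  have first: "bracket L (x # ys) \<in> ?J" if "x \<in> ?J" and ys: "length ys = n - 1" "set ys \<subseteq> carrier L" for x ys
    using that(1)
  proof induction
    have hd: "length (\<zero>\<^bsub>L\<^esub> # ys) = n" "set (\<zero>\<^bsub>L\<^esub> # ys) \<subseteq> carrier L" using ys n_pos by auto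
    {
      case zero
      show ?case using bracket_zero[OF hd n_pos] by (simp add: joint_commutator.zero)
    next
      case (commutator xs \<sigma>)
      have "commutator L \<sigma> (xs[i := bracket L (xs ! i # ys)]) \<in> ?J" if i: "i < n" for i
      proof (rule joint_commutator.commutator)
        let ?b = "bracket L (xs ! i # ys)"
        note cl = leibniz_summand_closed(1)[OF commutator(1,2) ys i]
        show "set (xs[i := ?b]) \<subseteq> carrier L" using commutator cl by (intro set_list_update_subset)
        show "\<forall>N\<in>\<N>. \<exists>x\<in>set (xs[i := ?b]). x \<in> N"
        proof
          fix N assume N: "N \<in> \<N>"
          then obtain j where j: "j < n" "xs ! j \<in> N" using commutator by (metis in_set_conv_nth)
          have "?b \<in> N" if "j = i"
            using j that ys commutator i n_pos by (intro ideal_bracket[OF \<N>[OF N], of _ "xs ! i"]) (auto simp: subset_iff)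
          then have "xs[i := ?b] ! j \<in> N" using j commutator by (cases "j = i") auto
          then show "\<exists>x\<in>set (xs[i := ?b]). x \<in> N" using j commutator by (metis length_list_update nth_mem)
        qed
      qed (use commutator in auto)
      then show ?case unfolding bracket_commutator[OF commutator(1,2) ys commutator(4)]
        by (intro submodule_finsum[OF submodule_joint_commutator]) auto
    next
      case (add x y)
      then show ?case using bracket_add[OF hd n_pos, of x y] joint_commutator_carrier E(5) by simp
    next
      case (smult a x)
      then show ?case using bracket_smult[OF hd n_pos, of a x] joint_commutator_carrier E(4) by simp
    }
  qed
  have "bracket L xs \<in> ?J" if xs: "length xs = n" "set xs \<subseteq> carrier L" "xs ! i \<in> ?J" "i < n" for xs i
  proof (cases "i = 0")
    case True
    then show ?thesis using first[of "hd xs" "tl xs"] xs n_pos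
      by (cases xs) auto
  next
    case False
    define \<tau> where "\<tau> = transpose 0 i"
    have \<tau>: "\<tau> permutes {..<n}" "\<not> evenperm \<tau>"
      using \<open>i < n\<close> False by (auto simp: \<tau>_def evenperm_swap intro: permutes_swap_id)
    let ?us = "permute_list \<tau> xs"
    have us: "length ?us = n" "set ?us \<subseteq> carrier L" "?us ! 0 = xs ! i"
      using xs \<tau> n_pos by (auto simp: permute_list_nth \<tau>_def)
    have "bracket L ?us \<in> ?J"
      using first[of "hd ?us" "tl ?us"] us xs(3) n_pos by (cases ?us) auto
    moreover have "commutator L \<tau> xs \<in> ?J"
      using xs \<tau> joint_commutator_subset[OF _ \<N>] by (intro joint_commutator.commutator) (auto, metis nth_mem subsetD)
    ultimately have "commutator L \<tau> xs \<ominus>\<^bsub>L\<^esub> bracket L ?us \<in> ?J"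
      by (rule submodule_minus[OF submodule_joint_commutator, rotated])
    moreover have "commutator L \<tau> xs \<ominus>\<^bsub>L\<^esub> bracket L ?us = bracket L xs"
      using xs us \<tau> bracket_closed by (simp add: commutator_eq a_minus_def M.add.m_assoc M.r_neg)
    ultimately show ?thesis by simp
  qed
  then show ?thesis unfolding nalg_ideal_def
    using submodule_joint_commutator by (auto simp: in_set_conv_nth)
qed

lemma ideal_carrier: "nalg_ideal n K L (carrier L)"
  using carrier_is_submodule bracket_closed by (auto simp: nalg_ideal_def)

lemma
  assumes "S \<subseteq> carrier L"
  shows generated_ideal_superset: "S \<subseteq> generated_ideal n K L S"
    and ideal_generated_ideal: "nalg_ideal n K L (generated_ideal n K L S)"
    and generated_ideal_least: "\<And>N. nalg_ideal n K L N \<Longrightarrow> S \<subseteq> N \<Longrightarrow> generated_ideal n K L S \<subseteq> N"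
proof -
  show "S \<subseteq> generated_ideal n K L S" by (auto simp: generated_ideal_def)
  show "generated_ideal n K L S \<subseteq> N" if "nalg_ideal n K L N" "S \<subseteq> N" for N
    using that by (auto simp: generated_ideal_def)
  have c: "generated_ideal n K L S \<subseteq> carrier L"
    using ideal_carrier assms by (auto simp: generated_ideal_def)
  have "submodule (generated_ideal n K L S) K L"
    by (rule submoduleI[OF c])
      (auto simp: generated_ideal_def submodule_zero ideal_submodule submoduleE(3-5))
  then show "nalg_ideal n K L (generated_ideal n K L S)"
    unfolding nalg_ideal_def by (auto simp: generated_ideal_def nalg_ideal_def)
qed

lemma rel_commutator_generators:
  assumes "length Ns = n" "\<And>N. N \<in> set Ns \<Longrightarrow> N \<subseteq> carrier L"
  shows "{bracket L xs \<ominus>\<^bsub>L\<^esub> [sign \<sigma>] \<cdot>\<^bsub>L\<^esub> bracket L (permute_list \<sigma> xs) | xs \<sigma>.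
        length xs = n \<and> (\<forall>i<n. xs ! i \<in> Ns ! i) \<and> \<sigma> permutes {..<n}} \<subseteq> carrier L" (is "?S \<subseteq> _")
proof
  fix y assume "y \<in> ?S"
  then obtain xs \<sigma> where y: "y = commutator L \<sigma> xs" "length xs = n" "\<forall>i<n. xs ! i \<in> Ns ! i" "\<sigma> permutes {..<n}"
    by (auto simp: commutator_def)
  moreover have "set xs \<subseteq> carrier L" using y assms by (auto simp: set_conv_nth subset_iff)
  ultimately show "y \<in> carrier L" by (auto intro: commutator_closed)
qed

lemma
  assumes "length Ns = n" "\<And>N. N \<in> set Ns \<Longrightarrow> N \<subseteq> carrier L"
  shows commutator_in_rel_commutator: "\<And>xs \<sigma>. length xs = n \<Longrightarrow> \<forall>i<n. xs ! i \<in> Ns ! i \<Longrightarrow>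
      \<sigma> permutes {..<n} \<Longrightarrow> commutator L \<sigma> xs \<in> rel_commutator n K L Ns"
    and ideal_rel_commutator: "nalg_ideal n K L (rel_commutator n K L Ns)"
    and rel_commutator_least: "\<And>N. nalg_ideal n K L N \<Longrightarrow> (\<And>xs \<sigma>. length xs = n \<Longrightarrow> set xs \<subseteq> carrier L \<Longrightarrow>
        \<forall>i<n. xs ! i \<in> Ns ! i \<Longrightarrow> \<sigma> permutes {..<n} \<Longrightarrow> commutator L \<sigma> xs \<in> N) \<Longrightarrow>
      rel_commutator n K L Ns \<subseteq> N"
proof -
  note gens = rel_commutator_generators[OF assms]
  show "nalg_ideal n K L (rel_commutator n K L Ns)"
    unfolding rel_commutator_def by (rule ideal_generated_ideal[OF gens])
  show "commutator L \<sigma> xs \<in> rel_commutator n K L Ns"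
    if "length xs = n" "\<forall>i<n. xs ! i \<in> Ns ! i" "\<sigma> permutes {..<n}" for xs \<sigma>
    unfolding rel_commutator_def commutator_def
  proof (rule subsetD[OF generated_ideal_superset[OF gens]])
    show "bracket L xs \<ominus>\<^bsub>L\<^esub> [sign \<sigma>] \<cdot>\<^bsub>L\<^esub> bracket L (permute_list \<sigma> xs) \<in>
      {bracket L xs \<ominus>\<^bsub>L\<^esub> [sign \<sigma>] \<cdot>\<^bsub>L\<^esub> bracket L (permute_list \<sigma> xs) | xs \<sigma>.
        length xs = n \<and> (\<forall>i<n. xs ! i \<in> Ns ! i) \<and> \<sigma> permutes {..<n}}"
      using that by (intro CollectI exI[of _ xs] exI[of _ \<sigma>]) simp
  qed
  show "rel_commutator n K L Ns \<subseteq> N" if N: "nalg_ideal n K L N"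
    and c: "\<And>xs \<sigma>. length xs = n \<Longrightarrow> set xs \<subseteq> carrier L \<Longrightarrow> \<forall>i<n. xs ! i \<in> Ns ! i \<Longrightarrow> \<sigma> permutes {..<n} \<Longrightarrow> commutator L \<sigma> xs \<in> N" for N
    unfolding rel_commutator_def
  proof (rule generated_ideal_least[OF gens N], safe)
    fix xs \<sigma> assume *: "n = length xs" "\<forall>i<length xs. xs ! i \<in> Ns ! i" "\<sigma> permutes {..<length xs}"
    have "set xs \<subseteq> carrier L" using * assms by (auto simp: set_conv_nth subset_iff)
    then show "bracket L xs \<ominus>\<^bsub>L\<^esub> [sign \<sigma>] \<cdot>\<^bsub>L\<^esub> bracket L (permute_list \<sigma> xs) \<in> N"
      using c[of xs \<sigma>] * by (simp add: commutator_def)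
  qed
qed

lemma rel_commutator_total: "rel_commutator n K L (replicate n (carrier L)) = joint_commutator n K L {}"
proof
  have len: "length (replicate n (carrier L)) = n" by simp
  have sub: "N \<subseteq> carrier L" if "N \<in> set (replicate n (carrier L))" for N using that by auto
  let ?R = "rel_commutator n K L (replicate n (carrier L))"
  show "?R \<subseteq> joint_commutator n K L {}"
    using ideal_joint_commutator[of "{}"]
    by (intro rel_commutator_least[OF len sub]) (auto intro: joint_commutator.commutator)
  note E = ideal_submodule[OF ideal_rel_commutator[OF len sub]]
  show "joint_commutator n K L {} \<subseteq> ?R"
  proof
    fix x assume "x \<in> joint_commutator n K L {}"
    then show "x \<in> ?R"
    proof induction
      case (commutator xs \<sigma>)
      then show ?case by (intro commutator_in_rel_commutator[OF len sub]) (auto simp: subset_iff)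
    qed (use submodule_zero[OF E] submoduleE(4,5)[OF E] in auto)
  qed
qed

text \<open>
  A list of arguments that meets all \<open>N i\<close> determines a cover of the index set: its \<open>k\<close>-th member
  collects the \<open>i\<close> with the \<open>k\<close>-th argument in \<open>N i\<close>.
\<close>

lemma ideal_sum_covers:
  assumes N: "\<And>i. i \<in> {1..m} \<Longrightarrow> nalg_ideal n K L (N i)"
  shows "ideal_sum L (covers n m) (\<lambda>Is. rel_commutator n K L (map (\<lambda>I. carrier L \<inter> (\<Inter>i\<in>I. N i)) Is)) =
    joint_commutator n K L (N ` {1..m})" (is "ideal_sum L ?C ?R = ?J")
proof
  have fin: "finite ?C"
  proof (rule finite_subset)
    show "?C \<subseteq> {Is. set Is \<subseteq> Pow {1..m} \<and> length Is = n}" by (auto simp: covers_def)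
    show "finite {Is :: nat set list. set Is \<subseteq> Pow {1..m} \<and> length Is = n}"
      by (rule finite_lists_length_eq) simp
  qed
  have R: "length (map (\<lambda>I. carrier L \<inter> (\<Inter>i\<in>I. N i)) Is) = n"
    "\<And>M. M \<in> set (map (\<lambda>I. carrier L \<inter> (\<Inter>i\<in>I. N i)) Is) \<Longrightarrow> M \<subseteq> carrier L" if "Is \<in> ?C" for Is
    using that by (auto simp: covers_def)
  have RE: "submodule (?R Is) K L" if "Is \<in> ?C" for Is
    by (rule ideal_submodule[OF ideal_rel_commutator]) (use R[OF that] in auto)
  have "?R Is \<subseteq> ?J" if Is: "Is \<in> ?C" for Is
  proof (rule rel_commutator_least[OF R[OF Is]])
    show "nalg_ideal n K L ?J" using N by (intro ideal_joint_commutator) auto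
    fix xs \<sigma> assume xs: "length xs = n" "set xs \<subseteq> carrier L" "\<sigma> permutes {..<n}"
      "\<forall>i<n. xs ! i \<in> map (\<lambda>I. carrier L \<inter> (\<Inter>i\<in>I. N i)) Is ! i"
    have "\<exists>x\<in>set xs. x \<in> N i" if "i \<in> {1..m}" for i
    proof -
      have "i \<in> \<Union>(set Is)" using Is that by (simp add: covers_def)
      then obtain k where "k < n" "i \<in> Is ! k" using Is by (auto simp: covers_def in_set_conv_nth)
      then have "xs ! k \<in> N i" using xs Is by (auto simp: covers_def)
      then show ?thesis using \<open>k < n\<close> xs by auto
    qed
    then show "commutator L \<sigma> xs \<in> ?J" using xs by (intro joint_commutator.commutator) auto
  qed
  then have "finsum L u ?C \<in> ?J" if "u \<in> (\<Pi> t\<in>?C. ?R t)" for u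
    using that by (intro submodule_finsum[OF submodule_joint_commutator fin]) blast
  then show "ideal_sum L ?C ?R \<subseteq> ?J" by (auto simp only: ideal_sum_def)
  show "?J \<subseteq> ideal_sum L ?C ?R"
  proof
    fix x assume "x \<in> ?J"
    then show "x \<in> ideal_sum L ?C ?R"
    proof induction
      case zero
      have "finsum L (\<lambda>_. \<zero>\<^bsub>L\<^esub>) ?C = \<zero>\<^bsub>L\<^esub>" by simp
      moreover have "(\<lambda>_. \<zero>\<^bsub>L\<^esub>) \<in> (\<Pi> t\<in>?C. ?R t)" using submodule_zero[OF RE] by auto
      ultimately show ?case unfolding ideal_sum_def by (intro CollectI exI[of _ "\<lambda>_. \<zero>\<^bsub>L\<^esub>"]) auto
    next
      case (commutator xs \<sigma>)
      define Is where "Is = map (\<lambda>x. {i\<in>{1..m}. x \<in> N i}) xs"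
      have Is: "Is \<in> ?C" using commutator by (fastforce simp: covers_def Is_def)
      let ?x = "\<lambda>t. if Is = t then commutator L \<sigma> xs else \<zero>\<^bsub>L\<^esub>"
      have "commutator L \<sigma> xs \<in> ?R Is"
        using commutator by (intro commutator_in_rel_commutator[OF R[OF Is]]) (auto simp: Is_def subset_iff)
      then have "?x \<in> (\<Pi> t\<in>?C. ?R t)" using submodule_zero[OF RE] by auto
      moreover have "finsum L ?x ?C = commutator L \<sigma> xs"
        using commutator by (intro M.finsum_singleton[OF Is fin, of "\<lambda>_. commutator L \<sigma> xs"]) (auto intro: commutator_closed)
      ultimately show ?case unfolding ideal_sum_def by (intro CollectI exI[of _ ?x]) auto
    next
      case (add x y)
      then obtain u v where uv: "x = finsum L u ?C" "y = finsum L v ?C" "u \<in> (\<Pi> t\<in>?C. ?R t)" "v \<in> (\<Pi> t\<in>?C. ?R t)"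
        by (auto simp: ideal_sum_def)
      then have "u \<in> ?C \<rightarrow> carrier L" "v \<in> ?C \<rightarrow> carrier L" using submoduleE(1)[OF RE] by blast+
      then have "x \<oplus>\<^bsub>L\<^esub> y = (\<Oplus>\<^bsub>L\<^esub>t\<in>?C. u t \<oplus>\<^bsub>L\<^esub> v t)" using uv by (simp add: M.finsum_addf)
      moreover have "(\<lambda>t. u t \<oplus>\<^bsub>L\<^esub> v t) \<in> (\<Pi> t\<in>?C. ?R t)"
        using uv submoduleE(5)[OF RE] by (simp add: Pi_iff)
      ultimately show ?case unfolding ideal_sum_def by blast
    next
      case (smult a x)
      then obtain u where u: "x = finsum L u ?C" "u \<in> (\<Pi> t\<in>?C. ?R t)" by (auto simp: ideal_sum_def)
      then have uc: "u \<in> ?C \<rightarrow> carrier L" using submoduleE(1)[OF RE] by blast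
      have "a \<odot>\<^bsub>L\<^esub> x = (\<Oplus>\<^bsub>L\<^esub>t\<in>?C. a \<odot>\<^bsub>L\<^esub> u t)"
        unfolding u(1) using smult(1) uc fin
        by (intro additive_finsum[OF abelian_monoid_axioms abelian_monoid_axioms]) (auto simp: smult_r_distr)
      moreover have "(\<lambda>t. a \<odot>\<^bsub>L\<^esub> u t) \<in> (\<Pi> t\<in>?C. ?R t)"
        using u(2) smult(1) submoduleE(4)[OF RE] by (simp add: Pi_iff)
      ultimately show ?case unfolding ideal_sum_def by blast
    qed
  qed
qed

end

lemma nalg_hom_commutator:
  assumes A: "nalgebra n K A" and B: "nalgebra n K B" and h: "h \<in> nalg_hom n K A B"
    and xs: "length xs = n" "set xs \<subseteq> carrier A" "\<sigma> permutes {..<n}"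
  shows "h (commutator A \<sigma> xs) = commutator B \<sigma> (map h xs)"
proof -
  interpret A: nalgebra n K A by fact
  interpret B: nalgebra n K B by fact
  have "set (map h xs) \<subseteq> carrier B" using nalg_hom_closed[OF h] xs by auto
  moreover have "h (bracket A (permute_list \<sigma> xs)) = bracket B (permute_list \<sigma> (map h xs))"
    using xs nalg_hom_bracket[OF h, of "permute_list \<sigma> xs"] by (simp add: permute_list_map)
  ultimately show ?thesis
    using xs A.permuted_bracket_closed[OF xs] A.bracket_closed nalg_hom_bracket[OF h, of xs]
    by (simp add: A.commutator_eq B.commutator_eq nalg_hom_add[OF h] nalg_hom_uminus[OF A B h])
qed

lemma nalg_hom_joint_commutator:
  assumes A: "nalgebra n K A" and B: "nalgebra n K B" and h: "h \<in> nalg_hom n K A B"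
    and \<N>: "\<And>N'. N' \<in> \<N>' \<Longrightarrow> \<exists>N\<in>\<N>. \<forall>x\<in>carrier A. x \<in> N \<longrightarrow> h x \<in> N'"
    and x: "x \<in> joint_commutator n K A \<N>"
  shows "h x \<in> joint_commutator n K B \<N>'"
proof -
  interpret A: nalgebra n K A by fact
  interpret B: nalgebra n K B by fact
  note carr = A.joint_commutator_carrier
  show ?thesis using x
  proof induction
    case zero
    then show ?case by (simp add: nalg_hom_zero[OF A B h] joint_commutator.zero)
  next
    case (commutator xs \<sigma>)
    have "\<exists>y\<in>set (map h xs). y \<in> N'" if "N' \<in> \<N>'" for N'
    proof -
      obtain N where N: "N \<in> \<N>" "\<And>x. x \<in> carrier A \<Longrightarrow> x \<in> N \<Longrightarrow> h x \<in> N'" using \<N>[OF \<open>N' \<in> \<N>'\<close>] by blast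
      then obtain z where "z \<in> set xs" "z \<in> N" using commutator by blast
      then show ?thesis using N(2)[of z] commutator by auto
    qed
    moreover have "set (map h xs) \<subseteq> carrier B" using nalg_hom_closed[OF h] commutator by auto
    ultimately show ?case using commutator
      by (simp add: nalg_hom_commutator[OF A B h] joint_commutator.commutator)
  next
    case (add x y)
    then show ?case using carr by (simp add: nalg_hom_add[OF h] joint_commutator.add)
  next
    case (smult a x)
    then show ?case using carr by (simp add: nalg_hom_smult[OF h] joint_commutator.smult)
  qed
qed

text \<open>
  Two homomorphisms that differ only within \<open>N\<^sub>0\<close>: changing one argument of a commutator at a time,
  every summand of the difference has a difference in one slot, hence meets \<open>N\<^sub>0\<close> as well.
  This is what makes both the splitting and the homotopy argument below work.
\<close>

lemma joint_commutator_difference: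
  assumes A: "nalgebra n K A" and B: "nalgebra n K B"
    and g: "g \<in> nalg_hom n K A B" and h: "h \<in> nalg_hom n K A B"
    and N0: "\<And>x. x \<in> carrier A \<Longrightarrow> g x \<ominus>\<^bsub>B\<^esub> h x \<in> N\<^sub>0"
    and \<N>: "\<And>N'. N' \<in> \<N>' \<Longrightarrow> submodule N' K B \<and>
      (\<exists>N\<in>\<N>. \<forall>x\<in>carrier A. x \<in> N \<longrightarrow> g x \<in> N' \<and> h x \<in> N')"
    and x: "x \<in> joint_commutator n K A \<N>"
  shows "g x \<ominus>\<^bsub>B\<^esub> h x \<in> joint_commutator n K B (insert N\<^sub>0 \<N>')" (is "_ \<in> ?J")
proof -
  interpret A: nalgebra n K A by fact
  interpret B: nalgebra n K B by fact
  note carr = A.joint_commutator_carrier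
  note E = B.submodule_joint_commutator[of "insert N\<^sub>0 \<N>'"]
  note gc = nalg_hom_closed[OF g] and hc = nalg_hom_closed[OF h]
  show ?thesis using x
  proof induction
    case zero
    then show ?case
      by (simp add: nalg_hom_zero[OF A B g] nalg_hom_zero[OF A B h] B.minus_zero_right joint_commutator.zero)
  next
    case (commutator xs \<sigma>)
    have gx: "length (map g xs) = n" "set (map g xs) \<subseteq> carrier B"
      and hx: "length (map h xs) = n" "set (map h xs) \<subseteq> carrier B"
      using gc hc commutator by auto
    have "commutator B \<sigma> (map g xs) \<ominus>\<^bsub>B\<^esub> commutator B \<sigma> (map h xs) \<in> ?J"
    proof (rule B.multiadditive_telescope[OF _ _ E gx hx])
      fix k assume k: "k < n"
      let ?d = "map g xs ! k \<ominus>\<^bsub>B\<^esub> map h xs ! k"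
      let ?z = "(take k (map g xs) @ drop k (map h xs))[k := ?d]"
      have xk: "xs ! k \<in> carrier A" using k commutator by auto
      then have d: "?d \<in> carrier B" "?d \<in> N\<^sub>0" using N0 gc hc k commutator by auto
      have z: "length ?z = n" "set ?z \<subseteq> carrier B"
        using gx hx set_take_subset[of k "map g xs"] set_drop_subset[of k "map h xs"]
        by (simp, intro set_list_update_subset[OF _ d(1)], unfold set_append, blast)
      have zj: "?z ! j = (if j = k then ?d else if j < k then g (xs ! j) else h (xs ! j))" if "j < n" for j
        using that k commutator by (auto simp: nth_list_update nth_append min_def)
      have "\<exists>y\<in>set ?z. y \<in> N'" if "N' \<in> insert N\<^sub>0 \<N>'" for N'
      proof (cases "N' = N\<^sub>0")
        case True
        then show ?thesis using d k z(1) zj[OF k] by (metis nth_mem)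
      next
        case False
        then have N': "N' \<in> \<N>'" using that by simp
        then obtain N where N: "N \<in> \<N>" "\<And>x. x \<in> carrier A \<Longrightarrow> x \<in> N \<Longrightarrow> g x \<in> N' \<and> h x \<in> N'" using \<N> by blast
        then obtain j where j: "j < n" "xs ! j \<in> N" using commutator by (metis in_set_conv_nth)
        moreover have "xs ! j \<in> carrier A" using j(1) commutator by auto
        ultimately have gh: "g (xs ! j) \<in> N'" "h (xs ! j) \<in> N'" using N(2)[of "xs ! j"] by auto
        then have "?z ! j \<in> N'"
          using zj[OF j(1)] B.submodule_minus[of N' "g (xs ! j)" "h (xs ! j)"] \<N>[OF N'] j commutator by auto
        then show ?thesis using j z(1) by (metis nth_mem)
      qed
      then show "commutator B \<sigma> ?z \<in> ?J" using z commutator by (intro joint_commutator.commutator) auto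
    qed (use commutator in \<open>auto intro: B.commutator_closed B.commutator_add\<close>)
    then show ?case using commutator by (simp add: nalg_hom_commutator[OF A B g] nalg_hom_commutator[OF A B h])
  next
    case (add x y)
    then have c: "g x \<in> carrier B" "g y \<in> carrier B" "h x \<in> carrier B" "h y \<in> carrier B" using carr gc hc by auto
    have "g (x \<oplus>\<^bsub>A\<^esub> y) \<ominus>\<^bsub>B\<^esub> h (x \<oplus>\<^bsub>A\<^esub> y) = (g x \<ominus>\<^bsub>B\<^esub> h x) \<oplus>\<^bsub>B\<^esub> (g y \<ominus>\<^bsub>B\<^esub> h y)"
      using c add carr by (simp add: nalg_hom_add[OF g] nalg_hom_add[OF h] a_minus_def B.M.minus_add B.M.add.m_ac)
    then show ?case using add by (simp add: joint_commutator.add)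
  next
    case (smult a x)
    then have c: "g x \<in> carrier B" "h x \<in> carrier B" using carr gc hc by auto
    have "g (a \<odot>\<^bsub>A\<^esub> x) \<ominus>\<^bsub>B\<^esub> h (a \<odot>\<^bsub>A\<^esub> x) = a \<odot>\<^bsub>B\<^esub> (g x \<ominus>\<^bsub>B\<^esub> h x)"
      using c smult carr
      by (simp add: nalg_hom_smult[OF g] nalg_hom_smult[OF h] a_minus_def B.smult_r_distr B.smult_r_minus)
    then show ?case using smult by (simp add: joint_commutator.smult)
  qed
qed

text \<open>
  Lifting the arguments of a commutator one by one is enough, provided that each of them lifts
  into all the required ideals at the same time.
\<close>

lemma joint_commutator_lift:
  assumes A: "nalgebra n K A" and B: "nalgebra n K B" and p: "p \<in> nalg_hom n K A B"
    and lift: "\<And>y. y \<in> carrier B \<Longrightarrow> \<exists>x\<in>carrier A. p x = y \<and> (\<forall>i\<in>I. y \<in> M i \<longrightarrow> x \<in> N i)"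
    and y: "y \<in> joint_commutator n K B (M ` I)"
  shows "\<exists>x\<in>joint_commutator n K A (N ` I). p x = y"
proof -
  interpret A: nalgebra n K A by fact
  interpret B: nalgebra n K B by fact
  note carr = A.joint_commutator_carrier
  obtain l where l: "\<And>y. y \<in> carrier B \<Longrightarrow> l y \<in> carrier A \<and> p (l y) = y \<and> (\<forall>i\<in>I. y \<in> M i \<longrightarrow> l y \<in> N i)"
    using lift by metis
  show ?thesis using y
  proof induction
    case zero
    show ?case using nalg_hom_zero[OF A B p] joint_commutator.zero by blast
  next
    case (commutator xs \<sigma>)
    have lx: "set (map l xs) \<subseteq> carrier A" "map p (map l xs) = xs"
      using commutator l by (auto intro!: map_idI)
    have "\<exists>x\<in>set (map l xs). x \<in> N i" if "i \<in> I" for i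
    proof -
      obtain y where "y \<in> set xs" "y \<in> M i" using commutator \<open>i \<in> I\<close> by blast
      then show ?thesis using l[of y] commutator \<open>i \<in> I\<close> by auto
    qed
    then have "commutator A \<sigma> (map l xs) \<in> joint_commutator n K A (N ` I)"
      using lx commutator by (intro joint_commutator.commutator) auto
    moreover have "p (commutator A \<sigma> (map l xs)) = commutator B \<sigma> xs"
      using lx commutator nalg_hom_commutator[OF A B p, of "map l xs" \<sigma>] by simp
    ultimately show ?case by blast
  next
    case (add x y)
    then obtain u v where "u \<in> joint_commutator n K A (N ` I)" "p u = x" "v \<in> joint_commutator n K A (N ` I)" "p v = y" by blast
    then show ?case using nalg_hom_add[OF p, of u v] carr joint_commutator.add by metis
  next
    case (smult a x)
    then obtain u where "u \<in> joint_commutator n K A (N ` I)" "p u = x" by blast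
    then show ?case using nalg_hom_smult[OF p smult(1), of u] carr joint_commutator.smult[OF smult(1)] by metis
  qed
qed

section \<open>Cubes, extensions and maps between them\<close>

text \<open>
  Directions are an arbitrary set here, since subcubes in some of the directions are needed throughout.
\<close>

locale cube_diagram =
  fixes n :: nat and K :: "('k, 'r) ring_scheme" and S :: "nat set" and f :: "('k, 'a) cube"
  assumes vertex_nalgebra: "I \<subseteq> S \<Longrightarrow> nalgebra n K (vertex f I)"
    and edge_hom: "I \<subseteq> J \<Longrightarrow> J \<subseteq> S \<Longrightarrow> edge f I J \<in> nalg_hom n K (vertex f I) (vertex f J)"
    and edge_refl: "I \<subseteq> S \<Longrightarrow> x \<in> carrier (vertex f I) \<Longrightarrow> edge f I I x = x"
    and edge_trans: "I \<subseteq> J \<Longrightarrow> J \<subseteq> M \<Longrightarrow> M \<subseteq> S \<Longrightarrow> x \<in> carrier (vertex f I) \<Longrightarrow>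
      edge f J M (edge f I J x) = edge f I M x"

locale cube_extension = cube_diagram n K S f
  for n :: nat and K :: "('k, 'r) ring_scheme" and S :: "nat set" and f :: "('k, 'a) cube" +
  assumes finite_directions: "finite S"
    and lift_family: "\<lbrakk>I \<subset> S; \<And>J. I \<subset> J \<Longrightarrow> J \<subseteq> S \<Longrightarrow> x J \<in> carrier (vertex f J);
      \<And>J M. I \<subset> J \<Longrightarrow> J \<subseteq> M \<Longrightarrow> M \<subseteq> S \<Longrightarrow> edge f J M (x J) = x M\<rbrakk> \<Longrightarrow>
      \<exists>y\<in>carrier (vertex f I). \<forall>J. I \<subset> J \<longrightarrow> J \<subseteq> S \<longrightarrow> edge f I J y = x J"

definition cube_map :: "nat \<Rightarrow> ('k, 'r) ring_scheme \<Rightarrow> nat set \<Rightarrow> nat set set \<Rightarrow>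
    ('k, 'a) cube \<Rightarrow> ('k, 'b) cube \<Rightarrow> (nat set \<Rightarrow> 'a \<Rightarrow> 'b) \<Rightarrow> bool" where
  "cube_map n K S U f F g \<longleftrightarrow>
     (\<forall>I\<in>U. g I \<in> nalg_hom n K (vertex f I) (vertex F I)) \<and>
     (\<forall>I\<in>U. \<forall>J. I \<subseteq> J \<longrightarrow> J \<subseteq> S \<longrightarrow>
       (\<forall>x\<in>carrier (vertex f I). edge F I J (g I x) = g J (edge f I J x)))"

lemma cube_map_hom:
  "cube_map n K S U f F g \<Longrightarrow> I \<in> U \<Longrightarrow> g I \<in> nalg_hom n K (vertex f I) (vertex F I)"
  by (simp add: cube_map_def)

lemma cube_map_edge:
  "cube_map n K S U f F g \<Longrightarrow> I \<in> U \<Longrightarrow> I \<subseteq> J \<Longrightarrow> J \<subseteq> S \<Longrightarrow> x \<in> carrier (vertex f I) \<Longrightarrow>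
    edge F I J (g I x) = g J (edge f I J x)"
  by (simp add: cube_map_def)

definition upward_closed :: "nat set \<Rightarrow> nat set set \<Rightarrow> bool" where
  "upward_closed S U \<longleftrightarrow> U \<subseteq> Pow S \<and> (\<forall>I\<in>U. \<forall>J. I \<subseteq> J \<longrightarrow> J \<subseteq> S \<longrightarrow> J \<in> U)"

text \<open>
  Families and maps are constructed from the terminal vertex downwards, one vertex at a time.
\<close>

lemma upward_induct [consumes 2, case_names base step]:
  assumes "finite S" "upward_closed S U" "P U"
    and step: "\<And>U I. upward_closed S U \<Longrightarrow> I \<subseteq> S \<Longrightarrow> I \<notin> U \<Longrightarrow>
      (\<And>J. I \<subset> J \<Longrightarrow> J \<subseteq> S \<Longrightarrow> J \<in> U) \<Longrightarrow> P U \<Longrightarrow> P (insert I U)"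
  shows "P (Pow S)"
  using assms(2,3)
proof (induction "card (Pow S - U)" arbitrary: U)
  case 0
  then have "U = Pow S" using \<open>finite S\<close> by (auto simp: upward_closed_def)
  then show ?case using 0 by simp
next
  case (Suc k)
  have fin: "finite (Pow S - U)" using \<open>finite S\<close> by simp
  then have "Pow S - U \<noteq> {}" using Suc(2) by (metis card.empty nat.distinct(1))
  from finite_has_maximal[OF fin this]
  obtain I where I: "I \<in> Pow S - U" "\<And>J. J \<in> Pow S - U \<Longrightarrow> I \<subseteq> J \<Longrightarrow> I = J" by metis
  have above: "J \<in> U" if "I \<subset> J" "J \<subseteq> S" for J
    using I(2)[of J] that by auto
  have up: "upward_closed S (insert I U)"
    using Suc(3) I(1) above by (auto simp: upward_closed_def)
  have "card (Pow S - insert I U) = k"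
    using Suc(2) fin I(1) by (metis Diff_insert card_Diff_singleton diff_Suc_1)
  then show ?case using Suc(1)[OF _ up] step[OF Suc(3) _ _ above Suc(4)] I(1) by auto
qed

lemma (in cube_diagram) edge_closed:
  "I \<subseteq> J \<Longrightarrow> J \<subseteq> S \<Longrightarrow> x \<in> carrier (vertex f I) \<Longrightarrow> edge f I J x \<in> carrier (vertex f J)"
  using nalg_hom_closed[OF edge_hom] .

lemma (in cube_diagram) edge_zero:
  "I \<subseteq> J \<Longrightarrow> J \<subseteq> S \<Longrightarrow> edge f I J \<zero>\<^bsub>vertex f I\<^esub> = \<zero>\<^bsub>vertex f J\<^esub>"
  by (rule nalg_hom_zero[OF vertex_nalgebra vertex_nalgebra edge_hom]) auto

text \<open>
  The defining property of an extension is the case in which \<open>U\<^sub>0\<close> consists of the vertices strictly above \<open>I\<close>.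
  In general, fill in a maximal missing vertex, and repeat.
\<close>

lemma (in cube_extension) extend_elements:
  assumes up: "upward_closed S U\<^sub>0" "S \<in> U\<^sub>0"
    and x: "\<And>J. J \<in> U\<^sub>0 \<Longrightarrow> x J \<in> carrier (vertex f J)"
      "\<And>J M. J \<in> U\<^sub>0 \<Longrightarrow> J \<subseteq> M \<Longrightarrow> M \<subseteq> S \<Longrightarrow> edge f J M (x J) = x M"
    and I: "I \<subseteq> S"
  shows "\<exists>y\<in>carrier (vertex f I). \<forall>J\<in>U\<^sub>0. I \<subseteq> J \<longrightarrow> edge f I J y = x J"
proof -
  let ?P = "\<lambda>U. U\<^sub>0 \<subseteq> U \<and> (\<exists>y. (\<forall>J\<in>U\<^sub>0. y J = x J) \<and> (\<forall>J\<in>U. y J \<in> carrier (vertex f J)) \<and>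
      (\<forall>J\<in>U. \<forall>M. J \<subseteq> M \<longrightarrow> M \<subseteq> S \<longrightarrow> edge f J M (y J) = y M))"
  have "?P (Pow S)"
    using finite_directions up(1)
  proof (induction rule: upward_induct)
    case base
    then show ?case using x by blast
  next
    case (step U I)
    from step(5) obtain y where U: "U\<^sub>0 \<subseteq> U" and y: "\<forall>J\<in>U\<^sub>0. y J = x J" "\<forall>J\<in>U. y J \<in> carrier (vertex f J)"
      "\<forall>J\<in>U. \<forall>M. J \<subseteq> M \<longrightarrow> M \<subseteq> S \<longrightarrow> edge f J M (y J) = y M" by (elim conjE exE)
    have "I \<subset> S" using step up(2) U by auto
    then have "\<exists>z\<in>carrier (vertex f I). \<forall>J. I \<subset> J \<longrightarrow> J \<subseteq> S \<longrightarrow> edge f I J z = y J"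
      using y(2,3) step(4) by (intro lift_family) auto
    then obtain z where z: "z \<in> carrier (vertex f I)" "\<And>J. I \<subset> J \<Longrightarrow> J \<subseteq> S \<Longrightarrow> edge f I J z = y J"
      by blast
    let ?y = "y(I := z)"
    have y1: "\<forall>J\<in>U\<^sub>0. ?y J = x J" using y(1) U step(3) by auto
    have y2: "\<forall>J\<in>insert I U. ?y J \<in> carrier (vertex f J)" using y(2) z(1) by auto
    have y3: "edge f J M (?y J) = ?y M" if "J \<in> insert I U" "J \<subseteq> M" "M \<subseteq> S" for J M
    proof (cases "J = I")
      case True
      then show ?thesis using z that edge_refl by (cases "M = I") auto
    next
      case False
      then have "J \<in> U" "M \<in> U" using that step(1) by (auto simp: upward_closed_def)
      then show ?thesis using y(3) that step(3) by auto
    qed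
    show ?case
    proof (intro conjI exI[of _ ?y])
      show "U\<^sub>0 \<subseteq> insert I U" using U by auto
      show "\<forall>J\<in>insert I U. \<forall>M. J \<subseteq> M \<longrightarrow> M \<subseteq> S \<longrightarrow> edge f J M (?y J) = ?y M"
        using y3 by (intro ballI allI impI)
    qed (rule y1 y2)+
  qed
  then obtain y where y: "\<forall>J\<in>U\<^sub>0. y J = x J" "\<forall>J\<in>Pow S. y J \<in> carrier (vertex f J)"
    "\<forall>J\<in>Pow S. \<forall>M. J \<subseteq> M \<longrightarrow> M \<subseteq> S \<longrightarrow> edge f J M (y J) = y M" by (elim conjE exE)
  then show ?thesis using I up(1) by (intro bexI[of _ "y I"]) (auto simp: upward_closed_def)
qed

lemma (in cube_extension) subcube:
  assumes S': "S' \<subseteq> S"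
  shows "cube_extension n K S' f"
proof (intro cube_extension.intro cube_diagram.intro cube_extension_axioms.intro)
  show "finite S'" using S' finite_directions by (rule finite_subset)
  show "nalgebra n K (vertex f I)" if "I \<subseteq> S'" for I
    using that S' by (intro vertex_nalgebra) auto
  show "edge f I J \<in> nalg_hom n K (vertex f I) (vertex f J)" if "I \<subseteq> J" "J \<subseteq> S'" for I J
    using that S' by (intro edge_hom) auto
  show "edge f I I x = x" if "I \<subseteq> S'" "x \<in> carrier (vertex f I)" for I x
    using that S' by (intro edge_refl) auto
  show "edge f J M (edge f I J x) = edge f I M x"
    if "I \<subseteq> J" "J \<subseteq> M" "M \<subseteq> S'" "x \<in> carrier (vertex f I)" for I J M x
    using that S' by (intro edge_trans) auto
  fix I x
  assume I: "I \<subset> S'" and x: "\<And>J. I \<subset> J \<Longrightarrow> J \<subseteq> S' \<Longrightarrow> x J \<in> carrier (vertex f J)"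
    and comp: "\<And>J M. I \<subset> J \<Longrightarrow> J \<subseteq> M \<Longrightarrow> M \<subseteq> S' \<Longrightarrow> edge f J M (x J) = x M"
  \<comment> \<open>Push the family forward to all vertices of the big cube that lie above its members.\<close>
  define U where "U = {M. M \<subseteq> S \<and> I \<subset> M \<inter> S'}"
  define x' where "x' M = edge f (M \<inter> S') M (x (M \<inter> S'))" for M
  have "\<exists>y\<in>carrier (vertex f I). \<forall>J\<in>U. I \<subseteq> J \<longrightarrow> edge f I J y = x' J"
  proof (rule extend_elements)
    show "upward_closed S U" by (auto simp: upward_closed_def U_def)
    show "S \<in> U" using I S' by (auto simp: U_def Int_absorb1)
    show "I \<subseteq> S" using I S' by auto
    fix J assume J: "J \<in> U"
    then have xc: "x (J \<inter> S') \<in> carrier (vertex f (J \<inter> S'))" by (intro x) (auto simp: U_def)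
    then show "x' J \<in> carrier (vertex f J)" using J by (auto simp: x'_def U_def intro: edge_closed)
    fix M assume M: "J \<subseteq> M" "M \<subseteq> S"
    have "edge f J M (x' J) = edge f (M \<inter> S') M (edge f (J \<inter> S') (M \<inter> S') (x (J \<inter> S')))"
      using xc M edge_trans[of "J \<inter> S'" J M "x (J \<inter> S')"] edge_trans[of "J \<inter> S'" "M \<inter> S'" M "x (J \<inter> S')"]
        le_infI1[OF M(1), of S'] unfolding x'_def by (simp add: Int_mono)
    also have "edge f (J \<inter> S') (M \<inter> S') (x (J \<inter> S')) = x (M \<inter> S')"
      using J M by (intro comp) (auto simp: U_def)
    finally show "edge f J M (x' J) = x' M" by (simp add: x'_def)
  qed
  moreover have "J \<in> U" "x' J = x J" if "I \<subset> J" "J \<subseteq> S'" for J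
  proof -
    have "J \<inter> S' = J" using that by auto
    then show "J \<in> U" "x' J = x J" using that S' x[of J] edge_refl[of J "x J"] by (auto simp: U_def x'_def)
  qed
  ultimately show "\<exists>y\<in>carrier (vertex f I). \<forall>J. I \<subset> J \<longrightarrow> J \<subseteq> S' \<longrightarrow> edge f I J y = x J"
    by (metis psubset_imp_subset)
qed

text \<open>
  The limit of the vertices above \<open>I\<close> appears as the quotient of \<open>F\<^sub>I\<close> by the
  common kernel of its edges, which is isomorphic to it because \<open>F\<close> is an extension.
\<close>

lemma lift_at_vertex:
  fixes f :: "('k, 'a) cube" and F :: "('k, 'b) cube"
  assumes f: "cube_diagram n K S f" and F: "cube_extension n K S F" and I: "I \<subset> S"
    and proj: "projective_alg n K (vertex f I)"
    and g: "\<And>J. I \<subset> J \<Longrightarrow> J \<subseteq> S \<Longrightarrow> g J \<in> nalg_hom n K (vertex f J) (vertex F J)"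
    and nat: "\<And>J M x. I \<subset> J \<Longrightarrow> J \<subseteq> M \<Longrightarrow> M \<subseteq> S \<Longrightarrow> x \<in> carrier (vertex f J) \<Longrightarrow>
      edge F J M (g J x) = g M (edge f J M x)"
  shows "\<exists>h\<in>nalg_hom n K (vertex f I) (vertex F I). \<forall>J. I \<subset> J \<longrightarrow> J \<subseteq> S \<longrightarrow>
    (\<forall>x\<in>carrier (vertex f I). edge F I J (h x) = g J (edge f I J x))"
proof -
  interpret f: cube_diagram n K S f by fact
  interpret F: cube_extension n K S F by fact
  let ?P = "vertex f I" and ?B = "vertex F I"
  interpret P: nalgebra n K ?P using I by (intro f.vertex_nalgebra) auto
  interpret B: nalgebra n K ?B using I by (intro F.vertex_nalgebra) auto
  define N where "N = {y\<in>carrier ?B. \<forall>J. I \<subset> J \<longrightarrow> J \<subseteq> S \<longrightarrow> edge F I J y = \<zero>\<^bsub>vertex F J\<^esub>}"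
  have Be: "nalgebra n K (vertex F J)" "edge F I J \<in> nalg_hom n K ?B (vertex F J)"
    if "I \<subset> J" "J \<subseteq> S" for J
    using that F.vertex_nalgebra F.edge_hom by auto
  have ker: "nalg_ideal n K ?B {y\<in>carrier ?B. edge F I J y = \<zero>\<^bsub>vertex F J\<^esub>}" if "I \<subset> J" "J \<subseteq> S" for J
    using nalg_hom_kernel_ideal[OF B.nalgebra_axioms Be[OF that]] by (simp add: a_kernel_def')
  have N: "nalg_ideal n K ?B N"
  proof -
    have N_iff: "y \<in> N \<longleftrightarrow> y \<in> carrier ?B \<and> (\<forall>J. I \<subset> J \<longrightarrow> J \<subseteq> S \<longrightarrow>
        y \<in> {y\<in>carrier ?B. edge F I J y = \<zero>\<^bsub>vertex F J\<^esub>})" for y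
      by (auto simp: N_def)
    note E = B.submoduleE[OF B.ideal_submodule[OF ker]]
    have "submodule N K ?B"
    proof (rule B.submoduleI)
      show "N \<subseteq> carrier ?B" by (auto simp: N_def)
      show "\<zero>\<^bsub>?B\<^esub> \<in> N" using F.edge_zero by (auto simp: N_def)
      show "\<ominus>\<^bsub>?B\<^esub> y \<in> N" if "y \<in> N" for y using that E(3) unfolding N_iff by simp
      show "y \<oplus>\<^bsub>?B\<^esub> z \<in> N" if "y \<in> N" "z \<in> N" for y z using that E(5) unfolding N_iff by simp
      show "a \<odot>\<^bsub>?B\<^esub> y \<in> N" if "a \<in> carrier K" "y \<in> N" for a y using that E(4) unfolding N_iff by simp
    qed
    moreover have "bracket ?B xs \<in> N" if "length xs = n" "set xs \<subseteq> carrier ?B" "x \<in> set xs" "x \<in> N" for xs x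
    proof -
      have "edge F I J (bracket ?B xs) = \<zero>\<^bsub>vertex F J\<^esub>" if J: "I \<subset> J" "J \<subseteq> S" for J
        using B.ideal_bracket[OF ker[OF J] \<open>length xs = n\<close> \<open>set xs \<subseteq> carrier ?B\<close> \<open>x \<in> set xs\<close>] \<open>x \<in> N\<close> J
        by (auto simp: N_def)
      then show ?thesis using that B.bracket_closed by (auto simp: N_def)
    qed
    ultimately show ?thesis by (auto simp: nalg_ideal_def)
  qed
  let ?C = "quot_alg ?B N"
  note q = coset_map_hom[OF B.nalgebra_axioms N] and qs = coset_map_surj[OF B.nalgebra_axioms N]
  have q_eq: "coset_map ?B N y = coset_map ?B N z \<longleftrightarrow> (\<forall>J. I \<subset> J \<longrightarrow> J \<subseteq> S \<longrightarrow> edge F I J y = edge F I J z)"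
    if "y \<in> carrier ?B" "z \<in> carrier ?B" for y z
  proof -
    have "edge F I J (y \<ominus>\<^bsub>?B\<^esub> z) = \<zero>\<^bsub>vertex F J\<^esub> \<longleftrightarrow> edge F I J y = edge F I J z" if J: "I \<subset> J" "J \<subseteq> S" for J
      using nalgebra.minus_eq_zero_iff[OF Be(1)[OF J]] nalg_hom_closed[OF Be(2)[OF J]]
        \<open>y \<in> carrier ?B\<close> \<open>z \<in> carrier ?B\<close> by (simp add: nalg_hom_minus[OF B.nalgebra_axioms Be[OF J]])
    then show ?thesis using that by (simp add: B.coset_eq_iff[OF B.ideal_submodule[OF N]]) (auto simp: N_def)
  qed
  have "\<exists>y\<in>carrier ?B. \<forall>J. I \<subset> J \<longrightarrow> J \<subseteq> S \<longrightarrow> edge F I J y = g J (edge f I J x)" if x: "x \<in> carrier ?P" for x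
  proof (rule F.lift_family[OF I])
    have ex: "edge f I J x \<in> carrier (vertex f J)" if "I \<subset> J" "J \<subseteq> S" for J
      using x that by (intro f.edge_closed) auto
    then show "g J (edge f I J x) \<in> carrier (vertex F J)" if "I \<subset> J" "J \<subseteq> S" for J
      using nalg_hom_closed[OF g[OF that]] that by simp
    show "edge F J M (g J (edge f I J x)) = g M (edge f I M x)" if J: "I \<subset> J" "J \<subseteq> M" "M \<subseteq> S" for J M
      using nat[OF J ex] f.edge_trans[of I J M x] x J by auto
  qed
  then obtain l where l: "\<And>x. x \<in> carrier ?P \<Longrightarrow> l x \<in> carrier ?B"
    and le: "\<And>x J. x \<in> carrier ?P \<Longrightarrow> I \<subset> J \<Longrightarrow> J \<subseteq> S \<Longrightarrow> edge F I J (l x) = g J (edge f I J x)" by metis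
  have lq: "coset_map ?B N (l x) = coset_map ?B N y"
    if "x \<in> carrier ?P" "y \<in> carrier ?B" "\<And>J. I \<subset> J \<Longrightarrow> J \<subseteq> S \<Longrightarrow> edge F I J y = g J (edge f I J x)" for x y
    using that l le by (subst q_eq) auto
  note fe = f.edge_hom[OF psubset_imp_subset]
  have hom: "(\<lambda>x. coset_map ?B N (l x)) \<in> nalg_hom n K ?P ?C"
  proof (rule nalg_homI)
    fix x assume "x \<in> carrier ?P"
    then show "coset_map ?B N (l x) \<in> carrier ?C" using nalg_hom_closed[OF q] l by auto
  next
    fix x y assume xy: "x \<in> carrier ?P" "y \<in> carrier ?P"
    have "coset_map ?B N (l (x \<oplus>\<^bsub>?P\<^esub> y)) = coset_map ?B N (l x \<oplus>\<^bsub>?B\<^esub> l y)"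
      using xy l le nalg_hom_closed[OF fe]
      by (intro lq) (auto simp: nalg_hom_add[OF Be(2)] nalg_hom_add[OF g] nalg_hom_add[OF fe])
    then show "coset_map ?B N (l (x \<oplus>\<^bsub>?P\<^esub> y)) = coset_map ?B N (l x) \<oplus>\<^bsub>?C\<^esub> coset_map ?B N (l y)"
      using nalg_hom_add[OF q] l xy by simp
  next
    fix a x assume ax: "a \<in> carrier K" "x \<in> carrier ?P"
    have "coset_map ?B N (l (a \<odot>\<^bsub>?P\<^esub> x)) = coset_map ?B N (a \<odot>\<^bsub>?B\<^esub> l x)"
      using ax l le nalg_hom_closed[OF fe]
      by (intro lq) (auto simp: nalg_hom_smult[OF Be(2)] nalg_hom_smult[OF g] nalg_hom_smult[OF fe])
    then show "coset_map ?B N (l (a \<odot>\<^bsub>?P\<^esub> x)) = a \<odot>\<^bsub>?C\<^esub> coset_map ?B N (l x)"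
      using nalg_hom_smult[OF q] l ax by simp
  next
    fix xs assume xs: "length xs = n" "set xs \<subseteq> carrier ?P"
    have lxs: "set (map l xs) \<subseteq> carrier ?B" using xs l by auto
    have "coset_map ?B N (l (bracket ?P xs)) = coset_map ?B N (bracket ?B (map l xs))"
    proof (rule lq)
      fix J assume J: "I \<subset> J" "J \<subseteq> S"
      have "set (map (edge f I J) xs) \<subseteq> carrier (vertex f J)" using xs nalg_hom_closed[OF fe[OF J]] by auto
      then have "g J (edge f I J (bracket ?P xs)) = bracket (vertex F J) (map (\<lambda>x. g J (edge f I J x)) xs)"
        using xs nalg_hom_bracket[OF fe[OF J], of xs] nalg_hom_bracket[OF g[OF J], of "map (edge f I J) xs"]
        by (simp add: comp_def)
      moreover have "map (\<lambda>x. g J (edge f I J x)) xs = map (edge F I J) (map l xs)"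
        using xs(2) le[OF _ J] by (auto simp: subset_iff)
      ultimately show "edge F I J (bracket ?B (map l xs)) = g J (edge f I J (bracket ?P xs))"
        using nalg_hom_bracket[OF Be(2)[OF J], of "map l xs"] xs lxs by simp
    qed (use xs lxs P.bracket_closed B.bracket_closed[of "map l xs"] in auto)
    then show "coset_map ?B N (l (bracket ?P xs)) = bracket ?C (map (\<lambda>x. coset_map ?B N (l x)) xs)"
      using nalg_hom_bracket[OF q, of "map l xs"] xs lxs by (simp add: comp_def)
  qed
  obtain h where h: "h \<in> nalg_hom n K ?P ?B" "\<forall>x\<in>carrier ?P. coset_map ?B N (h x) = coset_map ?B N (l x)"
    using projective_lift[OF P.leibniz_algebra_axioms proj P.n_pos B.leibniz_algebra_axioms
      nalgebra.axioms(1)[OF nalgebra_quot[OF B.nalgebra_axioms N]] q qs hom] by blast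
  have "edge F I J (h x) = g J (edge f I J x)" if "I \<subset> J" "J \<subseteq> S" "x \<in> carrier ?P" for J x
  proof -
    have "\<forall>J. I \<subset> J \<longrightarrow> J \<subseteq> S \<longrightarrow> edge F I J (h x) = edge F I J (l x)"
      using h(2) that(3) l nalg_hom_closed[OF h(1)] by (subst q_eq[symmetric]) auto
    then show ?thesis using le that by simp
  qed
  then show ?thesis using h(1) by blast
qed

lemma extend_cube_map:
  assumes f: "cube_diagram n K S f" and F: "cube_extension n K S F"
    and up: "upward_closed S U\<^sub>0" "S \<in> U\<^sub>0"
    and proj: "\<And>I. I \<subseteq> S \<Longrightarrow> I \<notin> U\<^sub>0 \<Longrightarrow> projective_alg n K (vertex f I)"
    and g: "cube_map n K S U\<^sub>0 f F g"
  shows "\<exists>h. (\<forall>I\<in>U\<^sub>0. h I = g I) \<and> cube_map n K S (Pow S) f F h"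
proof -
  interpret f: cube_diagram n K S f by fact
  interpret F: cube_extension n K S F by fact
  have "U\<^sub>0 \<subseteq> Pow S \<and> (\<exists>h. (\<forall>I\<in>U\<^sub>0. h I = g I) \<and> cube_map n K S (Pow S) f F h)"
    using F.finite_directions up(1)
  proof (induction rule: upward_induct)
    case base
    then show ?case using g by auto
  next
    case (step U I)
    from step(5) obtain h where U: "U\<^sub>0 \<subseteq> U" and hg: "\<forall>I\<in>U\<^sub>0. h I = g I" and h: "cube_map n K S U f F h"
      by (elim conjE exE)
    have "I \<subset> S" using step up(2) U by auto
    moreover have "projective_alg n K (vertex f I)" using step U by (intro proj) auto
    ultimately have "\<exists>k\<in>nalg_hom n K (vertex f I) (vertex F I). \<forall>J. I \<subset> J \<longrightarrow> J \<subseteq> S \<longrightarrow>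
        (\<forall>x\<in>carrier (vertex f I). edge F I J (k x) = h J (edge f I J x))"
    proof (intro lift_at_vertex[OF f F])
      show "h J \<in> nalg_hom n K (vertex f J) (vertex F J)" if "I \<subset> J" "J \<subseteq> S" for J
        by (rule cube_map_hom[OF h step(4)[OF that]])
      show "edge F J M (h J x) = h M (edge f J M x)"
        if "I \<subset> J" "J \<subseteq> M" "M \<subseteq> S" "x \<in> carrier (vertex f J)" for J M x
        using that by (intro cube_map_edge[OF h step(4)]) auto
    qed
    then obtain k where k: "k \<in> nalg_hom n K (vertex f I) (vertex F I)"
      "\<forall>J. I \<subset> J \<longrightarrow> J \<subseteq> S \<longrightarrow> (\<forall>x\<in>carrier (vertex f I). edge F I J (k x) = h J (edge f I J x))"
      by (rule bexE)
    let ?h = "h(I := k)"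
    have "edge F J M (?h J x) = ?h M (edge f J M x)"
      if "J \<in> insert I U" "J \<subseteq> M" "M \<subseteq> S" "x \<in> carrier (vertex f J)" for J M x
    proof (cases "J = I")
      case True
      then show ?thesis
        using k that f.edge_refl F.edge_refl nalg_hom_closed[OF k(1)] step(2) by (cases "M = I") auto
    next
      case False
      then have "J \<in> U" "M \<in> U" using that step(1) by (auto simp: upward_closed_def)
      then show ?thesis using cube_map_edge[OF h, of J M x] that step(3) by auto
    qed
    then have "cube_map n K S (insert I U) f F ?h"
      using cube_map_hom[OF h] k(1) unfolding cube_map_def by simp
    moreover have "\<forall>I\<in>U\<^sub>0. ?h I = g I" using hg U step(3) by auto
    ultimately show ?case using U by (intro conjI exI[of _ ?h]) (blast | assumption)+
  qed
  then show ?thesis by (rule conjunct2)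
qed

section \<open>Cubes of projective algebras split\<close>

abbreviation edge_kernel :: "('k, 'a) cube \<Rightarrow> nat \<Rightarrow> 'a set" where
  "edge_kernel f i \<equiv> a_kernel (vertex f {}) (vertex f {i}) (edge f {} {i})"

lemma in_a_kernel_iff: "x \<in> a_kernel A B h \<longleftrightarrow> x \<in> carrier A \<and> h x = \<zero>\<^bsub>B\<^esub>"
  by (simp add: a_kernel_def')

lemma (in cube_diagram) edge_kernel_ideal: "i \<in> S \<Longrightarrow> nalg_ideal n K (vertex f {}) (edge_kernel f i)"
  by (rule nalg_hom_kernel_ideal[OF vertex_nalgebra vertex_nalgebra edge_hom]) auto

text \<open>
  If all vertices, the terminal one included, are projective, then the cube, seen as a map between its
  two faces in direction \<open>j\<close>, has a section: extend the identity of the upper face along the cube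
  that is constant in direction \<open>j\<close>. The composite with the section is an
  endomorphism that projects away the kernel in direction \<open>j\<close> and preserves all other kernels.
\<close>

lemma (in cube_extension) coordinate_retraction:
  assumes proj: "\<And>I. I \<subseteq> S \<Longrightarrow> projective_alg n K (vertex f I)" and j: "j \<in> S"
  obtains e where "e \<in> nalg_hom n K (vertex f {}) (vertex f {})"
    and "\<And>x. x \<in> carrier (vertex f {}) \<Longrightarrow> edge f {} {j} (e x) = edge f {} {j} x"
    and "\<And>x. x \<in> edge_kernel f j \<Longrightarrow> e x = \<zero>\<^bsub>vertex f {}\<^esub>"
    and "\<And>i x. i \<in> S \<Longrightarrow> x \<in> edge_kernel f i \<Longrightarrow> e x \<in> edge_kernel f i"
    and "\<And>x. x \<in> carrier (vertex f {}) \<Longrightarrow> edge f {} {j} x \<in> joint_commutator n K (vertex f {j}) {} \<Longrightarrow>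
      e x \<in> joint_commutator n K (vertex f {}) {}"
proof -
  define B where "B = \<lparr>vertex = (\<lambda>I. vertex f (insert j I)), edge = (\<lambda>I J. edge f (insert j I) (insert j J))\<rparr>"
  have B: "vertex B I = vertex f (insert j I)" "edge B I J = edge f (insert j I) (insert j J)" for I J
    by (simp_all add: B_def)
  have diag: "cube_diagram n K S B"
    using j by (intro cube_diagram.intro) (auto simp: B intro!: vertex_nalgebra edge_hom edge_refl edge_trans)
  define U where "U = {I. I \<subseteq> S \<and> j \<in> I}"
  have up: "upward_closed S U" "S \<in> U" using j by (auto simp: U_def upward_closed_def)
  have "cube_map n K S U B f (\<lambda>I x. x)"
    using j by (auto simp: cube_map_def B U_def insert_absorb nalg_hom_id subsetD)
  moreover have "projective_alg n K (vertex B I)" if "I \<subseteq> S" for I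
    using that j by (simp add: B proj)
  ultimately obtain s where s: "\<And>I. I \<in> U \<Longrightarrow> s I = (\<lambda>x. x)" and sm: "cube_map n K S (Pow S) B f s"
    using extend_cube_map[OF diag cube_extension_axioms up] by metis
  have sh: "s I \<in> nalg_hom n K (vertex f (insert j I)) (vertex f I)" if "I \<subseteq> S" for I
    using sm that by (auto simp: cube_map_def B)
  have sn: "edge f I J (s I x) = s J (edge f (insert j I) (insert j J) x)"
    if "I \<subseteq> J" "J \<subseteq> S" "x \<in> carrier (vertex f (insert j I))" for I J x
    using sm that by (auto simp: cube_map_def B)
  let ?P = "vertex f {}"
  define e where "e = (\<lambda>x. s {} (edge f {} {j} x))"
  have ej: "edge f {} {j} \<in> nalg_hom n K ?P (vertex f {j})" using j by (intro edge_hom) auto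
  note A = vertex_nalgebra[of "{}"] vertex_nalgebra[of "{j}"]
  show thesis
  proof (rule that[of e])
    show "e \<in> nalg_hom n K ?P ?P" unfolding e_def using nalg_hom_comp[OF ej] sh[of "{}"] by simp
    show "edge f {} {j} (e x) = edge f {} {j} x" if "x \<in> carrier ?P" for x
      using sn[of "{}" "{j}" "edge f {} {j} x"] s[of "{j}"] j that edge_closed[of "{}" "{j}" x]
        edge_refl[of "{j}" "edge f {} {j} x"] by (simp add: e_def U_def)
    have s0: "s I \<zero>\<^bsub>vertex f (insert j I)\<^esub> = \<zero>\<^bsub>vertex f I\<^esub>" if "I \<subseteq> S" for I
      using nalg_hom_zero[OF vertex_nalgebra vertex_nalgebra sh] that j by auto
    show "e x = \<zero>\<^bsub>?P\<^esub>" if "x \<in> edge_kernel f j" for x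
      using that s0[of "{}"] by (simp add: e_def in_a_kernel_iff)
    show "e x \<in> edge_kernel f i" if i: "i \<in> S" and x: "x \<in> edge_kernel f i" for i x
    proof -
      have xc: "x \<in> carrier ?P" "edge f {} {i} x = \<zero>\<^bsub>vertex f {i}\<^esub>" using x by (auto simp: in_a_kernel_iff)
      have "edge f {} {i} (e x) = s {i} (edge f {j} (insert j {i}) (edge f {} {j} x))"
        using sn[of "{}" "{i}" "edge f {} {j} x"] edge_closed[of "{}" "{j}" x] xc i j by (simp add: e_def)
      also have "edge f {j} (insert j {i}) (edge f {} {j} x) = edge f {i} (insert j {i}) (edge f {} {i} x)"
        using edge_trans[of "{}" "{j}" "insert j {i}" x] edge_trans[of "{}" "{i}" "insert j {i}" x] xc i j by simp
      also have "\<dots> = \<zero>\<^bsub>vertex f (insert j {i})\<^esub>" using xc edge_zero[of "{i}" "insert j {i}"] i j by simp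
      finally have "edge f {} {i} (e x) = \<zero>\<^bsub>vertex f {i}\<^esub>" using s0[of "{i}"] i by simp
      moreover have "e x \<in> carrier ?P"
        using nalg_hom_closed[OF sh[of "{}"]] nalg_hom_closed[OF ej] xc by (simp add: e_def)
      ultimately show ?thesis by (simp add: in_a_kernel_iff)
    qed
    show "e x \<in> joint_commutator n K ?P {}"
      if "edge f {} {j} x \<in> joint_commutator n K (vertex f {j}) {}" for x
      unfolding e_def using j that A
      by (intro nalg_hom_joint_commutator[OF _ _ sh[of "{}"], of "{}" "{}"]) auto
  qed
qed

text \<open>
  For \<open>x\<close> in the kernel in direction \<open>j\<close>, the retraction \<open>e\<close> gives \<open>x = x - e x\<close>. As \<open>e\<close> agrees with the identity
  modulo that kernel, this adds the direction \<open>j\<close> to those already covered by the joint commutator.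
\<close>

theorem (in cube_extension) projective_cube_commutators:
  assumes proj: "\<And>I. I \<subseteq> S \<Longrightarrow> projective_alg n K (vertex f I)"
    and x: "x \<in> joint_commutator n K (vertex f {}) {}" "\<And>i. i \<in> S \<Longrightarrow> x \<in> edge_kernel f i"
  shows "x \<in> joint_commutator n K (vertex f {}) (edge_kernel f ` S)"
proof -
  let ?P = "vertex f {}"
  interpret P: nalgebra n K ?P by (rule vertex_nalgebra) simp
  have "x \<in> joint_commutator n K ?P (edge_kernel f ` R)" if "finite R" "R \<subseteq> S" for R
    using that
  proof (induction R)
    case (insert j R)
    then have j: "j \<in> S" and IH: "x \<in> joint_commutator n K ?P (edge_kernel f ` R)" by auto
    interpret Q: nalgebra n K "vertex f {j}" using j by (intro vertex_nalgebra) auto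
    have ej: "edge f {} {j} \<in> nalg_hom n K ?P (vertex f {j})" using j by (intro edge_hom) auto
    obtain e where e: "e \<in> nalg_hom n K ?P ?P"
      "\<And>x. x \<in> carrier ?P \<Longrightarrow> edge f {} {j} (e x) = edge f {} {j} x"
      "\<And>x. x \<in> edge_kernel f j \<Longrightarrow> e x = \<zero>\<^bsub>?P\<^esub>"
      "\<And>i x. i \<in> S \<Longrightarrow> x \<in> edge_kernel f i \<Longrightarrow> e x \<in> edge_kernel f i"
      using coordinate_retraction[OF proj j] by metis
    note ec = nalg_hom_closed[OF e(1)]
    have "x \<ominus>\<^bsub>?P\<^esub> e x \<in> joint_commutator n K ?P (insert (edge_kernel f j) (edge_kernel f ` R))"
    proof (rule joint_commutator_difference[OF P.nalgebra_axioms P.nalgebra_axioms nalg_hom_id e(1) _ _ IH])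
      show "y \<ominus>\<^bsub>?P\<^esub> e y \<in> edge_kernel f j" if "y \<in> carrier ?P" for y
        using that e(2) ec nalg_hom_closed[OF ej]
        by (simp add: in_a_kernel_iff nalg_hom_minus[OF P.nalgebra_axioms Q.nalgebra_axioms ej] Q.minus_eq_zero_iff)
      show "submodule N' K ?P \<and> (\<exists>N\<in>edge_kernel f ` R. \<forall>x\<in>carrier ?P. x \<in> N \<longrightarrow> x \<in> N' \<and> e x \<in> N')"
        if "N' \<in> edge_kernel f ` R" for N'
        using that e(4) P.ideal_submodule[OF edge_kernel_ideal] insert(4) by blast
    qed
    moreover have "x \<in> carrier ?P" "e x = \<zero>\<^bsub>?P\<^esub>" using x(2)[OF j] e(3) by (auto simp: in_a_kernel_iff)
    ultimately show ?case by (simp add: P.minus_zero_right)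
  qed (use x in simp)
  from this[OF finite_directions order_refl] show ?thesis .
qed

text \<open>
  The correction \<open>v\<close> is built direction by direction: adding \<open>e (z - v)\<close> settles the direction \<open>j\<close>, and it
  keeps the settled ones because \<open>e\<close> preserves their kernels.
\<close>

theorem (in cube_extension) projective_cube_lift_commutators:
  assumes proj: "\<And>I. I \<subseteq> S \<Longrightarrow> projective_alg n K (vertex f I)"
    and z: "z \<in> carrier (vertex f {})"
      "\<And>i. i \<in> S \<Longrightarrow> edge f {} {i} z \<in> joint_commutator n K (vertex f {i}) {}"
  shows "\<exists>v\<in>joint_commutator n K (vertex f {}) {}. \<forall>i\<in>S. edge f {} {i} v = edge f {} {i} z"
proof -
  let ?P = "vertex f {}" let ?V = "joint_commutator n K ?P {}"
  interpret P: nalgebra n K ?P by (rule vertex_nalgebra) simp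
  have "\<exists>v\<in>?V. \<forall>i\<in>R. z \<ominus>\<^bsub>?P\<^esub> v \<in> edge_kernel f i" if "finite R" "R \<subseteq> S" for R
    using that
  proof (induction R)
    case empty
    then show ?case using joint_commutator.zero by blast
  next
    case (insert j R)
    then obtain v where v: "v \<in> ?V" "\<And>i. i \<in> R \<Longrightarrow> z \<ominus>\<^bsub>?P\<^esub> v \<in> edge_kernel f i" by auto
    have j: "j \<in> S" using insert by simp
    interpret Q: nalgebra n K "vertex f {j}" using j by (intro vertex_nalgebra) auto
    have ej: "edge f {} {j} \<in> nalg_hom n K ?P (vertex f {j})" using j by (intro edge_hom) auto
    obtain e where e: "e \<in> nalg_hom n K ?P ?P"
      "\<And>x. x \<in> carrier ?P \<Longrightarrow> edge f {} {j} (e x) = edge f {} {j} x"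
      "\<And>i x. i \<in> S \<Longrightarrow> x \<in> edge_kernel f i \<Longrightarrow> e x \<in> edge_kernel f i"
      "\<And>x. x \<in> carrier ?P \<Longrightarrow> edge f {} {j} x \<in> joint_commutator n K (vertex f {j}) {} \<Longrightarrow> e x \<in> ?V"
      using coordinate_retraction[OF proj j] by metis
    have vc: "v \<in> carrier ?P" using v P.joint_commutator_carrier by blast
    let ?w = "z \<ominus>\<^bsub>?P\<^esub> v"
    have w: "?w \<in> carrier ?P" using vc z(1) by simp
    have ew: "e ?w \<in> carrier ?P" using nalg_hom_closed[OF e(1) w] .
    have "edge f {} {j} v \<in> joint_commutator n K (vertex f {j}) {}"
      by (rule nalg_hom_joint_commutator[OF P.nalgebra_axioms Q.nalgebra_axioms ej _ v(1)]) simp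
    then have "edge f {} {j} ?w \<in> joint_commutator n K (vertex f {j}) {}"
      using z j vc Q.submodule_minus[OF Q.submodule_joint_commutator]
      by (simp add: nalg_hom_minus[OF P.nalgebra_axioms Q.nalgebra_axioms ej])
    then have "e ?w \<in> ?V" using e(4) w by simp
    then have v': "v \<oplus>\<^bsub>?P\<^esub> e ?w \<in> ?V" using v by (intro joint_commutator.add)
    have eq: "z \<ominus>\<^bsub>?P\<^esub> (v \<oplus>\<^bsub>?P\<^esub> e ?w) = ?w \<ominus>\<^bsub>?P\<^esub> e ?w"
      using vc z(1) ew by (simp add: a_minus_def P.M.minus_add P.M.add.m_ac)
    have "?w \<ominus>\<^bsub>?P\<^esub> e ?w \<in> edge_kernel f i" if "i \<in> insert j R" for i
    proof (cases "i = j")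
      case True
      then show ?thesis using e(2)[OF w] w ew nalg_hom_closed[OF ej]
        by (simp add: in_a_kernel_iff nalg_hom_minus[OF P.nalgebra_axioms Q.nalgebra_axioms ej] Q.minus_eq_zero_iff)
    next
      case False
      then have "i \<in> S" "?w \<in> edge_kernel f i" using that insert v(2) by auto
      then show ?thesis
        using e(3) P.submodule_minus[OF P.ideal_submodule[OF edge_kernel_ideal]] by blast
    qed
    then have "\<forall>i\<in>insert j R. z \<ominus>\<^bsub>?P\<^esub> (v \<oplus>\<^bsub>?P\<^esub> e ?w) \<in> edge_kernel f i" by (simp add: eq)
    then show ?case using v' by (intro bexI[of _ "v \<oplus>\<^bsub>?P\<^esub> e ?w"])
  qed
  from this[OF finite_directions order_refl]
  obtain v where v: "v \<in> ?V" "\<And>i. i \<in> S \<Longrightarrow> z \<ominus>\<^bsub>?P\<^esub> v \<in> edge_kernel f i" by blast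
  have "edge f {} {i} v = edge f {} {i} z" if i: "i \<in> S" for i
  proof -
    interpret Q: nalgebra n K "vertex f {i}" using i by (intro vertex_nalgebra) auto
    have ei: "edge f {} {i} \<in> nalg_hom n K ?P (vertex f {i})" using i by (intro edge_hom) auto
    have "v \<in> carrier ?P" using v P.joint_commutator_carrier by blast
    then show ?thesis using v(2)[OF i] z(1) nalg_hom_closed[OF ei]
      by (simp add: in_a_kernel_iff nalg_hom_minus[OF P.nalgebra_axioms Q.nalgebra_axioms ei] Q.minus_eq_zero_iff)
  qed
  then show ?thesis using v(1) by blast
qed

section \<open>Independence of the presentation\<close>

text \<open>
  Two maps that agree on the upper face in direction \<open>k\<close> differ at the initial vertex only within the kernel
  in that direction. The commutators that vanish in all other directions are joint commutators
  of those kernels because the lower face consists of projective algebras.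
\<close>

lemma cube_maps_agree_in_direction:
  assumes f: "cube_extension n K S f" and F: "cube_extension n K S F"
    and proj: "\<And>I. I \<subset> S \<Longrightarrow> projective_alg n K (vertex f I)"
    and g: "cube_map n K S (Pow S) f F g" and h: "cube_map n K S (Pow S) f F h"
    and k: "k \<in> S" "\<And>x. x \<in> carrier (vertex f {k}) \<Longrightarrow> g {k} x = h {k} x"
    and x: "x \<in> joint_commutator n K (vertex f {}) {}" "\<And>i. i \<in> S \<Longrightarrow> x \<in> edge_kernel f i"
  shows "g {} x \<ominus>\<^bsub>vertex F {}\<^esub> h {} x \<in> joint_commutator n K (vertex F {}) (edge_kernel F ` S)"
proof -
  interpret f: cube_extension n K S f by fact
  interpret F: cube_extension n K S F by fact
  interpret low: cube_extension n K "S - {k}" f by (rule f.subcube) auto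
  interpret B: nalgebra n K "vertex F {}" by (rule F.vertex_nalgebra) simp
  interpret C: nalgebra n K "vertex F {k}" using k by (intro F.vertex_nalgebra) auto
  have A: "nalgebra n K (vertex f {})" by (rule f.vertex_nalgebra) simp
  have gh: "\<And>I. I \<subseteq> S \<Longrightarrow> g I \<in> nalg_hom n K (vertex f I) (vertex F I)"
    and hh: "\<And>I. I \<subseteq> S \<Longrightarrow> h I \<in> nalg_hom n K (vertex f I) (vertex F I)"
    and gn: "\<And>I x. I \<subseteq> S \<Longrightarrow> x \<in> carrier (vertex f {}) \<Longrightarrow> edge F {} I (g {} x) = g I (edge f {} I x)"
    and hn: "\<And>I x. I \<subseteq> S \<Longrightarrow> x \<in> carrier (vertex f {}) \<Longrightarrow> edge F {} I (h {} x) = h I (edge f {} I x)"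
    using g h by (auto simp: cube_map_def)
  have gc: "g {} x \<in> carrier (vertex F {})" and hc: "h {} x \<in> carrier (vertex F {})"
    if "x \<in> carrier (vertex f {})" for x
    using nalg_hom_closed[OF gh] nalg_hom_closed[OF hh] that by auto
  have x': "x \<in> joint_commutator n K (vertex f {}) (edge_kernel f ` (S - {k}))"
    using k by (intro low.projective_cube_commutators proj x) auto
  have "g {} x \<ominus>\<^bsub>vertex F {}\<^esub> h {} x \<in>
    joint_commutator n K (vertex F {}) (insert (edge_kernel F k) (edge_kernel F ` (S - {k})))"
  proof (rule joint_commutator_difference[OF A B.nalgebra_axioms gh hh _ _ x'])
    have ek: "edge F {} {k} \<in> nalg_hom n K (vertex F {}) (vertex F {k})"
      using k by (intro F.edge_hom) auto
    show "g {} y \<ominus>\<^bsub>vertex F {}\<^esub> h {} y \<in> edge_kernel F k" if "y \<in> carrier (vertex f {})" for y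
      using that k gc hc gn[of "{k}" y] hn[of "{k}" y] f.edge_closed[of "{}" "{k}" y]
        nalg_hom_closed[OF gh[of "{k}"]] nalg_hom_closed[OF hh[of "{k}"]]
      by (simp add: in_a_kernel_iff nalg_hom_minus[OF B.nalgebra_axioms C.nalgebra_axioms ek] C.minus_eq_zero_iff)
    fix N' assume "N' \<in> edge_kernel F ` (S - {k})"
    then obtain i where i: "i \<in> S" "i \<noteq> k" "N' = edge_kernel F i" by auto
    have z: "g {i} \<zero>\<^bsub>vertex f {i}\<^esub> = \<zero>\<^bsub>vertex F {i}\<^esub>" "h {i} \<zero>\<^bsub>vertex f {i}\<^esub> = \<zero>\<^bsub>vertex F {i}\<^esub>"
      using i by (auto intro!: nalg_hom_zero[OF f.vertex_nalgebra F.vertex_nalgebra] gh hh)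
    have "\<forall>x\<in>carrier (vertex f {}). x \<in> edge_kernel f i \<longrightarrow> g {} x \<in> N' \<and> h {} x \<in> N'"
      using i z gc hc gn[of "{i}"] hn[of "{i}"] by (auto simp: in_a_kernel_iff)
    then show "submodule N' K (vertex F {}) \<and>
        (\<exists>N\<in>edge_kernel f ` (S - {k}). \<forall>x\<in>carrier (vertex f {}). x \<in> N \<longrightarrow> g {} x \<in> N' \<and> h {} x \<in> N')"
      using i B.ideal_submodule[OF F.edge_kernel_ideal] by blast
  qed auto
  moreover have "insert (edge_kernel F k) (edge_kernel F ` (S - {k})) = edge_kernel F ` S"
    using k(1) by auto
  ultimately show ?thesis by simp
qed

text \<open>
  In general \<open>g\<close> turns into \<open>h\<close> through maps that differ in one direction at a time: if \<open>g\<close> and \<open>h\<close>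
  agree above \<open>insert k R\<close>, extend \<open>g\<close> on the upper face in direction \<open>k\<close> and \<open>h\<close> above \<open>R\<close> to a common map.
\<close>

theorem cube_maps_agree_modulo_commutators:
  assumes f: "cube_extension n K S f" and F: "cube_extension n K S F"
    and proj: "\<And>I. I \<subset> S \<Longrightarrow> projective_alg n K (vertex f I)"
    and g: "cube_map n K S (Pow S) f F g" and h: "cube_map n K S (Pow S) f F h"
    and agree: "\<And>x. x \<in> carrier (vertex f S) \<Longrightarrow> g S x = h S x"
    and x: "x \<in> joint_commutator n K (vertex f {}) {}" "\<And>i. i \<in> S \<Longrightarrow> x \<in> edge_kernel f i"
  shows "g {} x \<ominus>\<^bsub>vertex F {}\<^esub> h {} x \<in> joint_commutator n K (vertex F {}) (edge_kernel F ` S)"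
proof -
  interpret f: cube_extension n K S f by fact
  interpret F: cube_extension n K S F by fact
  let ?B = "vertex F {}" let ?J = "joint_commutator n K ?B (edge_kernel F ` S)"
  interpret A: nalgebra n K "vertex f {}" by (rule f.vertex_nalgebra) simp
  interpret B: nalgebra n K ?B by (rule F.vertex_nalgebra) simp
  have xc: "x \<in> carrier (vertex f {})" using x(1) A.joint_commutator_carrier by blast
  have mc: "g {} x \<in> carrier ?B" if "cube_map n K S (Pow S) f F g" for g
    using that xc nalg_hom_closed[of "g {}" n K "vertex f {}" ?B x] by (auto simp: cube_map_def)
  have "g {} x \<ominus>\<^bsub>?B\<^esub> h {} x \<in> ?J"
    if "finite R" "R \<subseteq> S" "cube_map n K S (Pow S) f F g"
      "\<And>I x. R \<subseteq> I \<Longrightarrow> I \<subseteq> S \<Longrightarrow> x \<in> carrier (vertex f I) \<Longrightarrow> g I x = h I x" for R g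
    using that
  proof (induction R arbitrary: g)
    case empty
    then have "g {} x = h {} x" using xc by simp
    then have "g {} x \<ominus>\<^bsub>?B\<^esub> h {} x = \<zero>\<^bsub>?B\<^esub>" using mc[OF h] by (simp add: B.minus_eq_zero_iff)
    then show ?case by (simp add: joint_commutator.zero)
  next
    case (insert k R)
    note g = insert(5) and agree = insert(6)
    have k: "k \<in> S" "R \<subseteq> S" using insert by auto
    define U where "U = {I. I \<subseteq> S \<and> (k \<in> I \<or> R \<subseteq> I)}"
    have up: "upward_closed S U" "S \<in> U" using k by (auto simp: U_def upward_closed_def)
    define g0 where "g0 I = (if k \<in> I then g I else h I)" for I
    have "cube_map n K S U f F g0"
      unfolding cube_map_def
    proof (intro conjI ballI allI impI)
      fix I assume I: "I \<in> U"
      then show "g0 I \<in> nalg_hom n K (vertex f I) (vertex F I)"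
        using g h by (auto simp: g0_def U_def cube_map_def)
      fix J y assume J: "I \<subseteq> J" "J \<subseteq> S" and y: "y \<in> carrier (vertex f I)"
      have gn: "edge F I J (g I y) = g J (edge f I J y)" and hn: "edge F I J (h I y) = h J (edge f I J y)"
        using g h I J y by (auto simp: cube_map_def U_def)
      have "g J (edge f I J y) = h J (edge f I J y)" if "k \<notin> I" "k \<in> J"
        using that I J y f.edge_closed[of I J y] by (intro agree) (auto simp: U_def)
      then show "edge F I J (g0 I y) = g0 J (edge f I J y)"
        using gn hn J by (auto simp: g0_def)
    qed
    moreover have "projective_alg n K (vertex f I)" if "I \<subseteq> S" "I \<notin> U" for I
      using that up(2) by (intro proj) auto
    ultimately obtain g' where g': "\<And>I. I \<in> U \<Longrightarrow> g' I = g0 I" "cube_map n K S (Pow S) f F g'"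
      using extend_cube_map[OF f.cube_diagram_axioms F up] by metis
    have "g {} x \<ominus>\<^bsub>?B\<^esub> g' {} x \<in> ?J"
      using k g'(1)[of "{k}"] by (intro cube_maps_agree_in_direction[OF f F proj g g'(2) k(1) _ x]) (auto simp: U_def g0_def)
    moreover have "g' {} x \<ominus>\<^bsub>?B\<^esub> h {} x \<in> ?J"
    proof (rule insert(3)[OF k(2) g'(2)])
      fix I y assume "R \<subseteq> I" "I \<subseteq> S" "y \<in> carrier (vertex f I)"
      then show "g' I y = h I y" using g'(1)[of I] agree[of I y] by (auto simp: U_def g0_def)
    qed
    ultimately have "(g {} x \<ominus>\<^bsub>?B\<^esub> g' {} x) \<oplus>\<^bsub>?B\<^esub> (g' {} x \<ominus>\<^bsub>?B\<^esub> h {} x) \<in> ?J"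
      by (rule joint_commutator.add)
    moreover have "(g {} x \<ominus>\<^bsub>?B\<^esub> g' {} x) \<oplus>\<^bsub>?B\<^esub> (g' {} x \<ominus>\<^bsub>?B\<^esub> h {} x) = g {} x \<ominus>\<^bsub>?B\<^esub> h {} x"
      using mc[OF g] mc[OF g'(2)] mc[OF h]
      by (simp add: a_minus_def B.M.add.m_assoc) (simp add: B.M.l_neg flip: B.M.add.m_assoc)
    ultimately show ?case by simp
  qed
  from this[OF F.finite_directions order_refl g] agree show ?thesis by (metis subset_antisym)
qed

section \<open>Maps of cubes as cubes\<close>

definition arrow_cube ::
    "nat \<Rightarrow> (nat set \<Rightarrow> 'a \<Rightarrow> 'a) \<Rightarrow> ('k, 'a) cube \<Rightarrow> ('k, 'a) cube \<Rightarrow> ('k, 'a) cube" where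
  "arrow_cube d p A B = \<lparr>
     vertex = (\<lambda>I. if d \<in> I then vertex B (I - {d}) else vertex A I),
     edge = (\<lambda>I J. if d \<in> I then edge B (I - {d}) (J - {d})
                  else if d \<in> J then (\<lambda>x. edge B I (J - {d}) (p I x)) else edge A I J)\<rparr>"

lemma arrow_cube_simps:
  "d \<in> I \<Longrightarrow> vertex (arrow_cube d p A B) I = vertex B (I - {d})"
  "d \<notin> I \<Longrightarrow> vertex (arrow_cube d p A B) I = vertex A I"
  "d \<in> I \<Longrightarrow> edge (arrow_cube d p A B) I J = edge B (I - {d}) (J - {d})"
  "d \<notin> I \<Longrightarrow> d \<in> J \<Longrightarrow> edge (arrow_cube d p A B) I J = (\<lambda>x. edge B I (J - {d}) (p I x))"
  "d \<notin> J \<Longrightarrow> d \<notin> I \<Longrightarrow> edge (arrow_cube d p A B) I J = edge A I J"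
  by (simp_all add: arrow_cube_def)

lemma arrow_cube_diagram:
  assumes A: "cube_diagram n K S A" and B: "cube_diagram n K S B" and d: "d \<notin> S"
    and p: "\<And>I. I \<subseteq> S \<Longrightarrow> p I \<in> nalg_hom n K (vertex A I) (vertex B I)"
    and nat: "\<And>I J x. I \<subseteq> J \<Longrightarrow> J \<subseteq> S \<Longrightarrow> x \<in> carrier (vertex A I) \<Longrightarrow>
      edge B I J (p I x) = p J (edge A I J x)"
  shows "cube_diagram n K (insert d S) (arrow_cube d p A B)"
proof (rule cube_diagram.intro)
  interpret A: cube_diagram n K S A by fact
  interpret B: cube_diagram n K S B by fact
  let ?C = "arrow_cube d p A B"
  note [simp] = arrow_cube_simps
  have low: "I \<subseteq> S" if "I \<subseteq> insert d S" "d \<notin> I" for I using that by auto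
  have up: "I - {d} \<subseteq> S" if "I \<subseteq> insert d S" for I using that by auto
  show "nalgebra n K (vertex ?C I)" if "I \<subseteq> insert d S" for I
    using A.vertex_nalgebra[OF low] B.vertex_nalgebra[OF up] that by (cases "d \<in> I") auto
  show "edge ?C I J \<in> nalg_hom n K (vertex ?C I) (vertex ?C J)" if "I \<subseteq> J" "J \<subseteq> insert d S" for I J
  proof -
    consider "d \<in> I" "d \<in> J" | "d \<notin> I" "d \<in> J" | "d \<notin> I" "d \<notin> J" using \<open>I \<subseteq> J\<close> by auto
    then show ?thesis
    proof cases
      case 1
      then show ?thesis using that B.edge_hom[of "I - {d}" "J - {d}"] up[of J] by (simp add: Diff_mono)
    next
      case 2
      then have "p I \<in> nalg_hom n K (vertex A I) (vertex B I)"
        "edge B I (J - {d}) \<in> nalg_hom n K (vertex B I) (vertex B (J - {d}))"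
        using that by (intro p B.edge_hom; auto)+
      then show ?thesis using 2 nalg_hom_comp by simp
    next
      case 3
      then show ?thesis using that A.edge_hom[of I J] low[of J] by simp
    qed
  qed
  show "edge ?C I I x = x" if "I \<subseteq> insert d S" "x \<in> carrier (vertex ?C I)" for I x
    using that A.edge_refl[OF low] B.edge_refl[OF up] by (cases "d \<in> I") auto
  show "edge ?C J M (edge ?C I J x) = edge ?C I M x"
    if IJ: "I \<subseteq> J" "J \<subseteq> M" "M \<subseteq> insert d S" and x: "x \<in> carrier (vertex ?C I)" for I J M x
  proof -
    consider "d \<in> I" "d \<in> J" "d \<in> M" | "d \<notin> I" "d \<in> J" "d \<in> M" | "d \<notin> I" "d \<notin> J" "d \<in> M"
      | "d \<notin> I" "d \<notin> J" "d \<notin> M" using IJ by auto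
    then show ?thesis
    proof cases
      case 1
      then show ?thesis using IJ x B.edge_trans[of "I - {d}" "J - {d}" "M - {d}" x] up[of M]
        by (simp add: Diff_mono)
    next
      case 2
      then have I: "I \<subseteq> J - {d}" "J - {d} \<subseteq> M - {d}" "M - {d} \<subseteq> S" "I \<subseteq> S" using IJ by auto
      then show ?thesis using 2 x B.edge_trans[OF I(1-3), of "p I x"] nalg_hom_closed[OF p[OF I(4)]] by simp
    next
      case 3
      then have I: "I \<subseteq> J" "J \<subseteq> M - {d}" "M - {d} \<subseteq> S" "J \<subseteq> S" "I \<subseteq> S" using IJ by auto
      then show ?thesis using 3 x B.edge_trans[OF I(1-3), of "p I x"] nalg_hom_closed[OF p[OF I(5)]]
          nat[OF I(1,4)] by simp
    next
      case 4
      then show ?thesis using IJ x A.edge_trans[of I J M x] low[of M] by simp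
    qed
  qed
qed

text \<open>
  A family over the vertices above \<open>I\<close> is lifted in \<open>A\<close> first; the remaining error in \<open>B\<^sub>I\<close> dies along
  all edges, and so does the correction by its image under the section. The section is natural but need
  not be additive, which is why its value at zero is subtracted.
\<close>

lemma arrow_cube_extension:
  assumes A: "cube_extension n K S A" and B: "cube_extension n K S B" and d: "d \<notin> S"
    and p: "\<And>I. I \<subseteq> S \<Longrightarrow> p I \<in> nalg_hom n K (vertex A I) (vertex B I)"
    and nat: "\<And>I J x. I \<subseteq> J \<Longrightarrow> J \<subseteq> S \<Longrightarrow> x \<in> carrier (vertex A I) \<Longrightarrow>
      edge B I J (p I x) = p J (edge A I J x)"
    and s: "\<And>I x. I \<subseteq> S \<Longrightarrow> x \<in> carrier (vertex B I) \<Longrightarrow> s I x \<in> carrier (vertex A I) \<and> p I (s I x) = x"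
    and snat: "\<And>I J x. I \<subseteq> J \<Longrightarrow> J \<subseteq> S \<Longrightarrow> x \<in> carrier (vertex B I) \<Longrightarrow>
      edge A I J (s I x) = s J (edge B I J x)"
  shows "cube_extension n K (insert d S) (arrow_cube d p A B)"
proof (intro cube_extension.intro cube_extension_axioms.intro)
  interpret A: cube_extension n K S A by fact
  interpret B: cube_extension n K S B by fact
  let ?C = "arrow_cube d p A B"
  note [simp] = arrow_cube_simps
  show "cube_diagram n K (insert d S) ?C"
    by (rule arrow_cube_diagram[OF A.cube_diagram_axioms B.cube_diagram_axioms d p nat])
  show "finite (insert d S)" using A.finite_directions by simp
  fix I x
  assume I: "I \<subset> insert d S" and x: "\<And>J. I \<subset> J \<Longrightarrow> J \<subseteq> insert d S \<Longrightarrow> x J \<in> carrier (vertex ?C J)"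
    and comp: "\<And>J M. I \<subset> J \<Longrightarrow> J \<subseteq> M \<Longrightarrow> M \<subseteq> insert d S \<Longrightarrow> edge ?C J M (x J) = x M"
  show "\<exists>y\<in>carrier (vertex ?C I). \<forall>J. I \<subset> J \<longrightarrow> J \<subseteq> insert d S \<longrightarrow> edge ?C I J y = x J"
  proof (cases "d \<in> I")
    case True
    have "\<exists>y\<in>carrier (vertex B (I - {d})). \<forall>J. I - {d} \<subset> J \<longrightarrow> J \<subseteq> S \<longrightarrow> edge B (I - {d}) J y = x (insert d J)"
    proof (rule B.lift_family)
      show "I - {d} \<subset> S" using I True d by auto
      show "x (insert d J) \<in> carrier (vertex B J)" if "I - {d} \<subset> J" "J \<subseteq> S" for J
      proof -
        have "d \<notin> J" "I \<subset> insert d J" "insert d J \<subseteq> insert d S" using that True d by auto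
        then show ?thesis using x[of "insert d J"] by simp
      qed
      show "edge B J M (x (insert d J)) = x (insert d M)" if "I - {d} \<subset> J" "J \<subseteq> M" "M \<subseteq> S" for J M
      proof -
        have "d \<notin> J" "d \<notin> M" "I \<subset> insert d J" using that d True by auto
        then show ?thesis using comp[of "insert d J" "insert d M"] that by auto
      qed
    qed
    then obtain y where y: "y \<in> carrier (vertex B (I - {d}))"
      "\<And>J. I - {d} \<subset> J \<Longrightarrow> J \<subseteq> S \<Longrightarrow> edge B (I - {d}) J y = x (insert d J)" by blast
    have "edge ?C I J y = x J" if "I \<subset> J" "J \<subseteq> insert d S" for J
    proof -
      have "I - {d} \<subset> J - {d}" "J - {d} \<subseteq> S" "insert d (J - {d}) = J" using that True by auto
      then show ?thesis using y(2)[of "J - {d}"] True by simp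
    qed
    then show ?thesis using y(1) True by auto
  next
    case False
    then have IS: "I \<subseteq> S" using I by auto
    interpret AI: nalgebra n K "vertex A I" by (rule A.vertex_nalgebra[OF IS])
    interpret BI: nalgebra n K "vertex B I" by (rule B.vertex_nalgebra[OF IS])
    note AIc = AI.nalgebra_axioms and BIc = BI.nalgebra_axioms
    have xA: "x J \<in> carrier (vertex A J)" if "I \<subset> J" "J \<subseteq> S" for J
    proof -
      have "d \<notin> J" "J \<subseteq> insert d S" using that d by auto
      then show ?thesis using x[OF that(1)] by simp
    qed
    have compA: "edge A J M (x J) = x M" if "I \<subset> J" "J \<subseteq> M" "M \<subseteq> S" for J M
    proof -
      have "d \<notin> J" "d \<notin> M" "M \<subseteq> insert d S" using that d by auto
      then show ?thesis using comp[OF that(1,2)] by simp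
    qed
    have "\<exists>a\<in>carrier (vertex A I). \<forall>J. I \<subset> J \<longrightarrow> J \<subseteq> S \<longrightarrow> edge A I J a = x J"
    proof (cases "I = S")
      case True
      then show ?thesis by (intro bexI[of _ "\<zero>\<^bsub>vertex A I\<^esub>"] AI.M.zero_closed) auto
    next
      case False
      then show ?thesis using IS xA compA by (intro A.lift_family) auto
    qed
    then obtain a where a: "a \<in> carrier (vertex A I)"
      and aJ: "\<And>J. I \<subset> J \<Longrightarrow> J \<subseteq> S \<Longrightarrow> edge A I J a = x J" by blast
    have dI: "I \<subset> insert d I" "insert d I \<subseteq> insert d S" "insert d I - {d} = I" using False IS by auto
    define b where "b = x (insert d I)"
    have b: "b \<in> carrier (vertex B I)" using x[OF dI(1,2)] dI(3) by (simp add: b_def)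
    have bJ: "edge B I J b = x (insert d J)" if "I \<subseteq> J" "J \<subseteq> S" for J
    proof -
      have "d \<notin> J" using that d by auto
      then show ?thesis using comp[OF dI(1), of "insert d J"] that dI(3) by (auto simp: b_def)
    qed
    have pa: "p I a \<in> carrier (vertex B I)" using nalg_hom_closed[OF p[OF IS] a] .
    define z where "z = b \<ominus>\<^bsub>vertex B I\<^esub> p I a"
    have z: "z \<in> carrier (vertex B I)" using b pa by (simp add: z_def)
    have zJ: "edge B I J z = \<zero>\<^bsub>vertex B J\<^esub>" if J: "I \<subset> J" "J \<subseteq> S" for J
    proof -
      interpret BJ: nalgebra n K "vertex B J" by (rule B.vertex_nalgebra[OF J(2)])
      have dJ: "d \<notin> J" "insert d J - {d} = J" using J d by auto
      have eB: "edge B I J \<in> nalg_hom n K (vertex B I) (vertex B J)" using J by (intro B.edge_hom) auto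
      have "edge B I J (p I a) = p J (x J)" using nat[of I J a] aJ[OF J] J a by auto
      also have "\<dots> = x (insert d J)"
      proof -
        have "edge B J J (p J (x J)) = p J (x J)"
          using B.edge_refl[OF J(2)] nalg_hom_closed[OF p[OF J(2)] xA[OF J]] by simp
        then show ?thesis using comp[of J "insert d J"] J dJ by auto
      qed
      finally have "edge B I J b = edge B I J (p I a)" using bJ[of J] J by simp
      then show ?thesis using b pa nalg_hom_closed[OF eB pa]
        by (simp add: z_def nalg_hom_minus[OF BIc BJ.nalgebra_axioms eB] BJ.minus_eq_zero_iff)
    qed
    let ?c = "s I z \<ominus>\<^bsub>vertex A I\<^esub> s I \<zero>\<^bsub>vertex B I\<^esub>"
    define y where "y = a \<oplus>\<^bsub>vertex A I\<^esub> ?c"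
    have c: "?c \<in> carrier (vertex A I)" "s I z \<in> carrier (vertex A I)" "s I \<zero>\<^bsub>vertex B I\<^esub> \<in> carrier (vertex A I)"
      using s[OF IS z] s[OF IS BI.M.zero_closed] by auto
    have yc: "y \<in> carrier (vertex A I)" using a c by (simp add: y_def)
    have "p I ?c = z"
      using c s[OF IS z] s[OF IS BI.M.zero_closed] z
      by (simp add: nalg_hom_minus[OF AIc BIc p[OF IS]] BI.minus_zero_right)
    then have "p I y = p I a \<oplus>\<^bsub>vertex B I\<^esub> z" using a c by (simp add: y_def nalg_hom_add[OF p[OF IS]])
    also have "\<dots> = b" using b pa z by (simp add: BI.M.add.m_comm[of _ z]) (simp add: z_def BI.minus_add_cancel)
    finally have py: "p I y = b" .
    have yJ: "edge A I J y = x J" if J: "I \<subset> J" "J \<subseteq> S" for J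
    proof -
      interpret AJ: nalgebra n K "vertex A J" by (rule A.vertex_nalgebra[OF J(2)])
      have eA: "edge A I J \<in> nalg_hom n K (vertex A I) (vertex A J)" using J by (intro A.edge_hom) auto
      have "edge A I J (s I z) = edge A I J (s I \<zero>\<^bsub>vertex B I\<^esub>)"
        using snat[of I J] J z zJ[OF J] B.edge_zero[of I J] by auto
      moreover have "edge A I J (s I \<zero>\<^bsub>vertex B I\<^esub>) \<in> carrier (vertex A J)" using nalg_hom_closed[OF eA c(3)] .
      ultimately have "edge A I J ?c = \<zero>\<^bsub>vertex A J\<^esub>"
        using c by (simp add: nalg_hom_minus[OF AIc AJ.nalgebra_axioms eA] AJ.minus_eq_zero_iff)
      then show ?thesis using aJ[OF J] a c xA[OF J] by (simp add: y_def nalg_hom_add[OF eA])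
    qed
    have "edge ?C I J y = x J" if J: "I \<subset> J" "J \<subseteq> insert d S" for J
    proof (cases "d \<in> J")
      case True
      then have "I \<subseteq> J - {d}" "J - {d} \<subseteq> S" "insert d (J - {d}) = J" using J False by auto
      then show ?thesis using True False py bJ[of "J - {d}"] by simp
    next
      case dJ: False
      then show ?thesis using yJ[of J] J False by auto
    qed
    then show ?thesis using yc False by auto
  qed
qed

section \<open>The free functor and its cubes\<close>

text \<open>
  \<open>G\<close> extends to arbitrary maps of underlying sets. This gives sections of all the maps
  \<open>G\<^sup>i \<epsilon>\<close>, obtained from the insertion of generators, that are natural although not homomorphisms for \<open>i = 0\<close>.
\<close>

context
  fixes n :: nat and K :: "('k, 'r) ring_scheme"
  assumes K: "field K" and n: "n > 0"
begin

lemma nalgebra_G_obj: "nalgebra n K (G_obj n K A)"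
  unfolding G_obj_def by (intro nalgebraI leibniz_algebra_free_alg K n)

lemma gen_closed: "x \<in> carrier A \<Longrightarrow> gen n K (carrier A) x \<in> carrier (G_obj n K A)"
  by (auto simp: G_obj_def gen_def free_alg_simps intro: terms_over.Var)

lemma G_map_hom:
  "h \<in> carrier A \<rightarrow> carrier B \<Longrightarrow> G_map n K B h \<in> nalg_hom n K (G_obj n K A) (G_obj n K B)"
  unfolding G_map_def G_obj_def[of n K A]
  using nalgebra_G_obj gen_closed by (intro free_lift_hom n nalgebra.axioms(1)) auto

lemma G_map_gen:
  assumes "h \<in> carrier A \<rightarrow> carrier B" "x \<in> carrier A"
  shows "G_map n K B h (gen n K (carrier A) x) = gen n K (carrier B) (h x)"
  unfolding G_map_def
  using nalgebra_G_obj gen_closed assms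
  by (intro free_lift_hom(2)[where n = n and K = K and X = "carrier A"] n nalgebra.axioms(1)) auto

lemma G_hom_unique:
  assumes "nalgebra n K B" "h \<in> nalg_hom n K (G_obj n K A) B" "h' \<in> nalg_hom n K (G_obj n K A) B"
    and "\<And>x. x \<in> carrier A \<Longrightarrow> h (gen n K (carrier A) x) = h' (gen n K (carrier A) x)"
    and "y \<in> carrier (G_obj n K A)"
  shows "h y = h' y"
  using free_alg_hom_unique[OF nalgebra.axioms(1)[OF assms(1)] n, of h "carrier A" h' y] assms
  by (simp add: G_obj_def)

lemma G_map_comp:
  assumes "h \<in> carrier A \<rightarrow> carrier B" "h' \<in> carrier B \<rightarrow> carrier C" "y \<in> carrier (G_obj n K A)"
  shows "G_map n K C h' (G_map n K B h y) = G_map n K C (\<lambda>x. h' (h x)) y"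
proof (rule G_hom_unique[OF nalgebra_G_obj _ _ _ assms(3)])
  show "(\<lambda>y. G_map n K C h' (G_map n K B h y)) \<in> nalg_hom n K (G_obj n K A) (G_obj n K C)"
    using assms by (intro nalg_hom_comp[OF G_map_hom G_map_hom])
  have hh: "(\<lambda>x. h' (h x)) \<in> carrier A \<rightarrow> carrier C" using assms by auto
  then show "G_map n K C (\<lambda>x. h' (h x)) \<in> nalg_hom n K (G_obj n K A) (G_obj n K C)" by (rule G_map_hom)
  fix x assume x: "x \<in> carrier A"
  then have "h x \<in> carrier B" using assms(1) by auto
  then show "G_map n K C h' (G_map n K B h (gen n K (carrier A) x)) =
      G_map n K C (\<lambda>x. h' (h x)) (gen n K (carrier A) x)"
    using x hh by (simp add: G_map_gen[OF assms(1)] G_map_gen[OF assms(2)] G_map_gen[OF hh])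
qed

lemma G_map_cong:
  assumes "h \<in> carrier A \<rightarrow> carrier B" "\<And>x. x \<in> carrier A \<Longrightarrow> h x = h' x" "y \<in> carrier (G_obj n K A)"
  shows "G_map n K B h y = G_map n K B h' y"
proof -
  have h': "h' \<in> carrier A \<rightarrow> carrier B" using assms(1,2) by (auto simp: Pi_iff)
  show ?thesis
    by (rule G_hom_unique[OF nalgebra_G_obj G_map_hom[OF assms(1)] G_map_hom[OF h'] _ assms(3)])
      (simp add: G_map_gen[OF assms(1)] G_map_gen[OF h'] assms(2))
qed

lemma G_map_id: "y \<in> carrier (G_obj n K A) \<Longrightarrow> G_map n K A (\<lambda>x. x) y = y"
  by (rule G_hom_unique[OF nalgebra_G_obj G_map_hom nalg_hom_id]) (auto simp: G_map_gen)

lemma G_counit_hom: "nalgebra n K A \<Longrightarrow> G_counit A \<in> nalg_hom n K (G_obj n K A) A"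
  unfolding G_counit_def G_obj_def by (intro free_lift_hom n nalgebra.axioms(1)) auto

lemma G_counit_gen: "nalgebra n K A \<Longrightarrow> x \<in> carrier A \<Longrightarrow> G_counit A (gen n K (carrier A) x) = x"
  unfolding G_counit_def
  by (intro free_lift_hom(2)[where n = n and K = K and X = "carrier A"] n nalgebra.axioms(1)) auto

lemma G_counit_natural:
  assumes A: "nalgebra n K A" and B: "nalgebra n K B" and h: "h \<in> nalg_hom n K A B"
    and y: "y \<in> carrier (G_obj n K A)"
  shows "h (G_counit A y) = G_counit B (G_map n K B h y)"
proof (rule G_hom_unique[OF B _ _ _ y])
  have hf: "h \<in> carrier A \<rightarrow> carrier B" using nalg_hom_closed[OF h] by auto
  show "(\<lambda>y. h (G_counit A y)) \<in> nalg_hom n K (G_obj n K A) B" by (rule nalg_hom_comp[OF G_counit_hom[OF A] h])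
  show "(\<lambda>y. G_counit B (G_map n K B h y)) \<in> nalg_hom n K (G_obj n K A) B"
    by (rule nalg_hom_comp[OF G_map_hom[OF hf] G_counit_hom[OF B]])
  show "h (G_counit A (gen n K (carrier A) x)) = G_counit B (G_map n K B h (gen n K (carrier A) x))"
    if "x \<in> carrier A" for x
    using that nalg_hom_closed[OF h that] by (simp add: G_counit_gen A B G_map_gen[OF hf])
qed

lemma projective_G_obj: "projective_alg n K (G_obj n K A)"
  unfolding projective_alg_def
proof (intro allI impI, elim conjE)
  fix B C :: "('k, ('k, ('k, 'b) lterm) lterm) nalg" and p g
  assume B: "leibniz_algebra n K B" and C: "leibniz_algebra n K C" and p: "p \<in> nalg_hom n K B C"
    and surj: "p ` carrier B = carrier C" and g: "g \<in> nalg_hom n K (G_obj n K A) C"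
  have "\<forall>x\<in>carrier A. \<exists>b\<in>carrier B. p b = g (gen n K (carrier A) x)"
  proof
    fix x assume "x \<in> carrier A"
    then have "g (gen n K (carrier A) x) \<in> p ` carrier B"
      using nalg_hom_closed[OF g gen_closed] surj by simp
    then show "\<exists>b\<in>carrier B. p b = g (gen n K (carrier A) x)" by auto
  qed
  then obtain b where b: "\<And>x. x \<in> carrier A \<Longrightarrow> b x \<in> carrier B"
    "\<And>x. x \<in> carrier A \<Longrightarrow> p (b x) = g (gen n K (carrier A) x)" by metis
  have bf: "b \<in> carrier A \<rightarrow> carrier B" using b by auto
  note l = free_lift_hom[OF B n bf, folded G_obj_def]
  have "p (free_lift B b y) = g y" if "y \<in> carrier (G_obj n K A)" for y
    by (rule G_hom_unique[OF nalgebraI[OF C n] nalg_hom_comp[OF l(1) p] g _ that]) (simp add: l(2) b(2))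
  then show "\<exists>h\<in>nalg_hom n K (G_obj n K A) B. \<forall>x\<in>carrier (G_obj n K A). p (h x) = g x"
    using l(1) by blast
qed

end

lemma G_pow_simps [simp]:
  "G_pow n K 0 A = A"
  "G_pow n K (Suc i) A = G_obj n K (G_pow n K i A)"
  by (simp_all add: G_pow_def)

lemma G_pow_add: "G_pow n K k (G_pow n K r A) = G_pow n K (k + r) A"
  by (simp add: G_pow_def funpow_add)

text \<open>\<open>G\<^sup>k \<epsilon>\<close> at \<open>G\<^sup>r A\<close>, which is the face \<open>\<partial>\<^sub>k\<close> of the resolution in degree \<open>k + r\<close>.\<close>

definition counit_at ::
    "nat \<Rightarrow> ('k, 'r) ring_scheme \<Rightarrow> ('k, ('k, 'a) lterm) nalg \<Rightarrow> nat \<Rightarrow> nat \<Rightarrow> ('k, 'a) lterm \<Rightarrow> ('k, 'a) lterm" where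
  "counit_at n K A k r = G_pow_map n K k (G_pow n K r A) (G_counit (G_pow n K r A))"

lemma counit_at_simps:
  "counit_at n K A 0 r = G_counit (G_pow n K r A)"
  "counit_at n K A (Suc k) r = G_map n K (G_pow n K (k + r) A) (counit_at n K A k r)"
  by (simp_all add: counit_at_def G_pow_add)

primrec section_at ::
    "nat \<Rightarrow> ('k, 'r) ring_scheme \<Rightarrow> ('k, ('k, 'a) lterm) nalg \<Rightarrow> nat \<Rightarrow> nat \<Rightarrow> ('k, 'a) lterm \<Rightarrow> ('k, 'a) lterm" where
  "section_at n K A 0 r = gen n K (carrier (G_pow n K r A))"
| "section_at n K A (Suc k) r = G_map n K (G_pow n K (Suc (k + r)) A) (section_at n K A k r)"

text \<open>
  The cube \<open>G\<^sup>k F\<close>, where \<open>F\<close> has \<open>G\<^bsup>m - |I|\<^esup> A\<close> at the vertex \<open>I\<close> and faces of the resolution as edges.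
  The new direction \<open>Suc m\<close> is the counit \<open>G F \<rightarrow> F\<close>, that is, the face \<open>\<partial>\<^sub>0\<close>, so that the directions
  count the faces backwards. The induction needs all \<open>G\<^sup>k F\<close> at once, as \<open>G F\<close> is one half of the next cube.
\<close>

primrec resolution_cube ::
    "nat \<Rightarrow> ('k, 'r) ring_scheme \<Rightarrow> ('k, ('k, 'a) lterm) nalg \<Rightarrow> nat \<Rightarrow> nat \<Rightarrow> ('k, ('k, 'a) lterm) cube" where
  "resolution_cube n K A 0 = (\<lambda>k. \<lparr>vertex = (\<lambda>_. G_pow n K k A), edge = (\<lambda>_ _ x. x)\<rparr>)"
| "resolution_cube n K A (Suc m) = (\<lambda>k. arrow_cube (Suc m) (\<lambda>I. counit_at n K A k (m - card I))
     (resolution_cube n K A m (Suc k)) (resolution_cube n K A m k))"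

lemma vertex_resolution_cube:
  "I \<subseteq> {1..m} \<Longrightarrow> vertex (resolution_cube n K A m k) I = G_pow n K (k + (m - card I)) A"
proof (induction m arbitrary: k I)
  case (Suc m)
  have fin: "finite I" using Suc(2) finite_subset by blast
  show ?case
  proof (cases "Suc m \<in> I")
    case True
    have I: "I - {Suc m} \<subseteq> {1..m}" using Suc(2) by auto
    have "card (I - {Suc m}) = card I - 1" "card I > 0" using True fin by (auto simp: card_gt_0_iff)
    then have "m - card (I - {Suc m}) = Suc m - card I" by simp
    then show ?thesis using Suc(1)[OF I] True by (simp add: arrow_cube_simps)
  next
    case False
    have I: "I \<subseteq> {1..m}" using Suc(2) False by (auto simp: le_Suc_eq)
    then have "card I \<le> m" using card_mono[OF _ I] by simp
    then have "k + (Suc m - card I) = Suc k + (m - card I)" by simp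
    then show ?thesis using Suc(1)[OF I, of "Suc k"] False by (simp add: arrow_cube_simps)
  qed
qed simp

context
  fixes n :: nat and K :: "('k, 'r) ring_scheme" and A :: "('k, ('k, 'a) lterm) nalg"
  assumes A: "nalgebra n K A"
begin

lemma field_K: "field K" and n_gt_0: "n > 0"
proof -
  interpret nalgebra n K A by (rule A)
  show "field K" by unfold_locales
  show "n > 0" by (rule n_pos)
qed

lemma nalgebra_G_pow: "nalgebra n K (G_pow n K i A)"
  by (cases i) (simp_all add: A nalgebra_G_obj field_K n_gt_0)

lemma counit_at_hom:
  "counit_at n K A k r \<in> nalg_hom n K (G_pow n K (Suc (k + r)) A) (G_pow n K (k + r) A)"
proof (induction k)
  case 0
  then show ?case by (simp add: counit_at_simps G_counit_hom[OF field_K n_gt_0 nalgebra_G_pow])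
next
  case (Suc k)
  then have "counit_at n K A k r \<in> carrier (G_pow n K (Suc (k + r)) A) \<rightarrow> carrier (G_pow n K (k + r) A)"
    using nalg_hom_closed[OF Suc] by (intro Pi_I)
  from G_map_hom[OF field_K n_gt_0 this] show ?case by (simp add: counit_at_simps)
qed

lemma counit_at_fun:
  "counit_at n K A k r \<in> carrier (G_pow n K (Suc (k + r)) A) \<rightarrow> carrier (G_pow n K (k + r) A)"
  using nalg_hom_closed[OF counit_at_hom] by blast

lemma section_at_fun:
  "section_at n K A k r \<in> carrier (G_pow n K (k + r) A) \<rightarrow> carrier (G_pow n K (Suc (k + r)) A)"
proof (induction k)
  case 0
  then show ?case using gen_closed[OF field_K n_gt_0] by auto
next
  case (Suc k)
  show ?case using nalg_hom_closed[OF G_map_hom[OF field_K n_gt_0 Suc]] by auto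
qed

lemma counit_section:
  "x \<in> carrier (G_pow n K (k + r) A) \<Longrightarrow> counit_at n K A k r (section_at n K A k r x) = x"
proof (induction k arbitrary: x)
  case 0
  then show ?case by (simp add: counit_at_simps G_counit_gen[OF field_K n_gt_0 nalgebra_G_pow])
next
  case (Suc k)
  have "counit_at n K A (Suc k) r (section_at n K A (Suc k) r x) =
      G_map n K (G_pow n K (k + r) A) (\<lambda>x. counit_at n K A k r (section_at n K A k r x)) x"
    using Suc(2) G_map_comp[OF field_K n_gt_0 section_at_fun counit_at_fun, of x k r]
    by (simp add: counit_at_simps)
  also have "\<dots> = G_map n K (G_pow n K (k + r) A) (\<lambda>x. x) x"
    using Suc counit_at_fun section_at_fun
    by (intro G_map_cong[OF field_K n_gt_0]) (auto simp: Pi_iff)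
  finally show ?case using Suc(2) G_map_id[OF field_K n_gt_0] by simp
qed

lemma
  assumes e: "\<And>k. e k \<in> nalg_hom n K (G_pow n K (k + a) A) (G_pow n K (k + b) A)"
    and G: "\<And>k x. x \<in> carrier (G_pow n K (Suc (k + a)) A) \<Longrightarrow>
      e (Suc k) x = G_map n K (G_pow n K (k + b) A) (e k) x"
  shows counit_at_natural: "\<And>x. x \<in> carrier (G_pow n K (Suc (k + a)) A) \<Longrightarrow>
      e k (counit_at n K A k a x) = counit_at n K A k b (e (Suc k) x)"
    and section_at_natural: "\<And>x. x \<in> carrier (G_pow n K (k + a) A) \<Longrightarrow>
      e (Suc k) (section_at n K A k a x) = section_at n K A k b (e k x)"
proof -
  have ef: "e k \<in> carrier (G_pow n K (k + a) A) \<rightarrow> carrier (G_pow n K (k + b) A)" for k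
    using nalg_hom_closed[OF e] by auto
  have ef': "e (Suc k) \<in> carrier (G_pow n K (Suc (k + a)) A) \<rightarrow> carrier (G_pow n K (Suc (k + b)) A)" for k
    using ef[of "Suc k"] by (simp only: add_Suc)
  note comp = G_map_comp[OF field_K n_gt_0] and cong = G_map_cong[OF field_K n_gt_0]
  show "e k (counit_at n K A k a x) = counit_at n K A k b (e (Suc k) x)"
    if "x \<in> carrier (G_pow n K (Suc (k + a)) A)" for x
    using that
  proof (induction k arbitrary: x)
    case 0
    then show ?case
      using G_counit_natural[OF field_K n_gt_0 nalgebra_G_pow nalgebra_G_pow e[of 0], of x] G[of x 0]
      by (simp add: counit_at_simps)
  next
    case (Suc k)
    have x: "x \<in> carrier (G_obj n K (G_pow n K (Suc (k + a)) A))" using Suc(2) by simp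
    have c: "counit_at n K A (Suc k) a x \<in> carrier (G_pow n K (Suc (k + a)) A)"
      using counit_at_fun[of "Suc k" a] Suc(2) by (auto simp: Pi_iff)
    have "e (Suc k) (counit_at n K A (Suc k) a x) =
        G_map n K (G_pow n K (k + b) A) (e k) (G_map n K (G_pow n K (k + a) A) (counit_at n K A k a) x)"
      using G[OF c] by (simp add: counit_at_simps)
    also have "\<dots> = G_map n K (G_pow n K (k + b) A) (\<lambda>x. e k (counit_at n K A k a x)) x"
      by (rule comp[OF counit_at_fun ef x])
    also have "\<dots> = G_map n K (G_pow n K (k + b) A) (\<lambda>x. counit_at n K A k b (e (Suc k) x)) x"
      using counit_at_fun[of k a] ef[of k] by (intro cong[OF _ _ x] Suc(1)) auto
    also have "\<dots> = G_map n K (G_pow n K (k + b) A) (counit_at n K A k b)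
        (G_map n K (G_pow n K (Suc (k + b)) A) (e (Suc k)) x)"
      by (rule comp[OF ef' counit_at_fun x, symmetric])
    also have "\<dots> = counit_at n K A (Suc k) b (e (Suc (Suc k)) x)"
      using G[of x "Suc k"] Suc(2) by (simp add: counit_at_simps)
    finally show ?case .
  qed
  show "e (Suc k) (section_at n K A k a x) = section_at n K A k b (e k x)"
    if "x \<in> carrier (G_pow n K (k + a) A)" for x
    using that
  proof (induction k arbitrary: x)
    case 0
    then show ?case
      using G[of "gen n K (carrier (G_pow n K a A)) x" 0] gen_closed[OF field_K n_gt_0, of x "G_pow n K a A"]
        G_map_gen[OF field_K n_gt_0 ef[of 0], of x] by simp
  next
    case (Suc k)
    have x: "x \<in> carrier (G_obj n K (G_pow n K (k + a) A))" using Suc(2) by simp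
    have c: "section_at n K A (Suc k) a x \<in> carrier (G_pow n K (Suc (Suc k + a)) A)"
      using section_at_fun[of "Suc k" a] Suc(2) by (auto simp: Pi_iff)
    have "e (Suc (Suc k)) (section_at n K A (Suc k) a x) =
        G_map n K (G_pow n K (Suc (k + b)) A) (e (Suc k)) (G_map n K (G_pow n K (Suc (k + a)) A) (section_at n K A k a) x)"
      using G[OF c] by simp
    also have "\<dots> = G_map n K (G_pow n K (Suc (k + b)) A) (\<lambda>x. e (Suc k) (section_at n K A k a x)) x"
      by (rule comp[OF section_at_fun ef' x])
    also have "\<dots> = G_map n K (G_pow n K (Suc (k + b)) A) (\<lambda>x. section_at n K A k b (e k x)) x"
      using section_at_fun[of k a] ef'[of k] by (intro cong[OF _ _ x] Suc(1)) auto
    also have "\<dots> = G_map n K (G_pow n K (Suc (k + b)) A) (section_at n K A k b)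
        (G_map n K (G_pow n K (k + b) A) (e k) x)"
      by (rule comp[OF ef section_at_fun x, symmetric])
    also have "\<dots> = section_at n K A (Suc k) b (e (Suc k) x)"
      using G[of x k] Suc(2) by simp
    finally show ?case .
  qed
qed

text \<open>
  The second half says that \<open>G\<close> takes the k-th cube to the next one. It makes counits and sections natural,
  which the first half needs to add a direction; so both are proved together.
\<close>

lemma resolution_cube_extension_aux:
  "(\<forall>k. cube_extension n K {1..m} (resolution_cube n K A m k)) \<and>
   (\<forall>k I J x. I \<subseteq> J \<longrightarrow> J \<subseteq> {1..m} \<longrightarrow> x \<in> carrier (vertex (resolution_cube n K A m (Suc k)) I) \<longrightarrow>
     edge (resolution_cube n K A m (Suc k)) I J x =
       G_map n K (vertex (resolution_cube n K A m k) J) (edge (resolution_cube n K A m k) I J) x)"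
proof (induction m)
  case 0
  have "cube_extension n K {1..0} (resolution_cube n K A 0 k)" for k
    by (intro cube_extension.intro cube_diagram.intro cube_extension_axioms.intro)
      (auto simp: nalgebra_G_pow nalg_hom_id)
  then show ?case by (simp add: G_map_id[OF field_K n_gt_0])
next
  case (Suc m)
  let ?R = "resolution_cube n K A m"
  let ?p = "\<lambda>k I. counit_at n K A k (m - card I)" and ?s = "\<lambda>k I. section_at n K A k (m - card I)"
  have ext: "cube_extension n K {1..m} (?R k)" for k using Suc by blast
  have G: "edge (?R (Suc k)) I J x = G_map n K (vertex (?R k) J) (edge (?R k) I J) x"
    if "I \<subseteq> J" "J \<subseteq> {1..m}" "x \<in> carrier (vertex (?R (Suc k)) I)" for k I J x
    using Suc that by blast
  note diag = cube_extension.axioms(1)[OF ext]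
  note V = vertex_resolution_cube[of _ m n K A]
  have eh: "edge (?R k) I J \<in> nalg_hom n K (G_pow n K (k + (m - card I)) A) (G_pow n K (k + (m - card J)) A)"
    if "I \<subseteq> J" "J \<subseteq> {1..m}" for k I J
    using cube_diagram.edge_hom[OF diag that, of k] that by (simp add: V)
  have eG: "edge (?R (Suc k)) I J x = G_map n K (G_pow n K (k + (m - card J)) A) (edge (?R k) I J) x"
    if "I \<subseteq> J" "J \<subseteq> {1..m}" "x \<in> carrier (G_pow n K (Suc (k + (m - card I))) A)" for k I J x
    using G[of I J x k] that by (simp add: V)
  have p: "?p k I \<in> nalg_hom n K (vertex (?R (Suc k)) I) (vertex (?R k) I)" if "I \<subseteq> {1..m}" for k I
    using counit_at_hom[of k "m - card I"] that by (simp add: V)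
  have pnat: "edge (?R k) I J (?p k I x) = ?p k J (edge (?R (Suc k)) I J x)"
    if "I \<subseteq> J" "J \<subseteq> {1..m}" "x \<in> carrier (vertex (?R (Suc k)) I)" for k I J x
    using that by (intro counit_at_natural[where e = "\<lambda>k. edge (?R k) I J"] eh eG) (auto simp: V)
  have ext': "cube_extension n K {1..Suc m} (resolution_cube n K A (Suc m) k)" for k
  proof -
    have "cube_extension n K (insert (Suc m) {1..m}) (arrow_cube (Suc m) (?p k) (?R (Suc k)) (?R k))"
    proof (rule arrow_cube_extension[OF ext ext, where s = "?s k"])
      show "?s k I x \<in> carrier (vertex (?R (Suc k)) I) \<and> ?p k I (?s k I x) = x"
        if "I \<subseteq> {1..m}" "x \<in> carrier (vertex (?R k) I)" for I x
        using that section_at_fun[of k "m - card I"] counit_section[of x k "m - card I"] by (auto simp: V Pi_iff)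
      show "edge (?R (Suc k)) I J (?s k I x) = ?s k J (edge (?R k) I J x)"
        if "I \<subseteq> J" "J \<subseteq> {1..m}" "x \<in> carrier (vertex (?R k) I)" for I J x
        using that by (intro section_at_natural[where e = "\<lambda>k. edge (?R k) I J"] eh eG) (auto simp: V)
    qed (use p pnat in auto)
    moreover have "insert (Suc m) {1..m} = {1..Suc m}" by auto
    ultimately show ?thesis by simp
  qed
  have "edge (resolution_cube n K A (Suc m) (Suc k)) I J x =
       G_map n K (vertex (resolution_cube n K A (Suc m) k) J) (edge (resolution_cube n K A (Suc m) k) I J) x"
    if IJ: "I \<subseteq> J" "J \<subseteq> {1..Suc m}" and x: "x \<in> carrier (vertex (resolution_cube n K A (Suc m) (Suc k)) I)"
    for k I J x
  proof -
    consider "Suc m \<in> I" "Suc m \<in> J" | "Suc m \<notin> I" "Suc m \<in> J" | "Suc m \<notin> I" "Suc m \<notin> J" using IJ by auto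
    then show ?thesis
    proof cases
      case 1
      have "I - {Suc m} \<subseteq> J - {Suc m}" "J - {Suc m} \<subseteq> {1..m}" using IJ by auto
      then show ?thesis using 1 x G[of "I - {Suc m}" "J - {Suc m}" x k] by (simp add: arrow_cube_simps)
    next
      case 2
      then have I: "I \<subseteq> J - {Suc m}" "J - {Suc m} \<subseteq> {1..m}" using IJ by auto
      then have I3: "I \<subseteq> {1..m}" by (rule order_trans)
      note I = I I3
      have xc: "x \<in> carrier (G_pow n K (Suc (Suc k + (m - card I))) A)" using x 2 I(3) by (simp add: arrow_cube_simps V)
      have pf: "?p k I \<in> carrier (G_pow n K (Suc (k + (m - card I))) A) \<rightarrow> carrier (vertex (?R k) I)"
        using counit_at_fun I(3) by (simp add: V)
      have ef: "edge (?R k) I (J - {Suc m}) \<in> carrier (vertex (?R k) I) \<rightarrow> carrier (vertex (?R k) (J - {Suc m}))"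
        using nalg_hom_closed[OF cube_diagram.edge_hom[OF diag I(1,2)]] by blast
      have px: "?p (Suc k) I x \<in> carrier (vertex (?R (Suc k)) I)"
        using counit_at_fun[of "Suc k" "m - card I"] xc I(3) by (auto simp: V Pi_iff)
      have "edge (resolution_cube n K A (Suc m) (Suc k)) I J x = edge (?R (Suc k)) I (J - {Suc m}) (?p (Suc k) I x)"
        using 2 by (simp add: arrow_cube_simps)
      also have "\<dots> = G_map n K (vertex (?R k) (J - {Suc m})) (edge (?R k) I (J - {Suc m}))
          (G_map n K (vertex (?R k) I) (?p k I) x)"
        using G[OF I(1,2) px] I(3) by (simp add: counit_at_simps V)
      also have "\<dots> = G_map n K (vertex (?R k) (J - {Suc m})) (\<lambda>x. edge (?R k) I (J - {Suc m}) (?p k I x)) x"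
        using xc by (intro G_map_comp[OF field_K n_gt_0 pf ef]) simp
      also have "\<dots> = G_map n K (vertex (resolution_cube n K A (Suc m) k) J) (edge (resolution_cube n K A (Suc m) k) I J) x"
        using 2 by (simp add: arrow_cube_simps)
      finally show ?thesis .
    next
      case 3
      then have I: "I \<subseteq> J" "J \<subseteq> {1..m}" using IJ by (auto simp: le_Suc_eq)
      then show ?thesis using 3 x G[of I J x "Suc k"] by (simp add: arrow_cube_simps)
    qed
  qed
  then show ?case using ext' by blast
qed

theorem resolution_cube_extension: "cube_extension n K {1..m} (resolution_cube n K A m k)"
  using resolution_cube_extension_aux by blast

text \<open>
  Each direction other than \<open>j\<close> outside \<open>I\<close> contributes one \<open>G\<close>: the later ones are applied to the counit, the earlier
  ones to its argument.
\<close>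

lemma edge_resolution_cube:
  "\<lbrakk>I \<subseteq> {1..m}; j \<in> {1..m}; j \<notin> I; x \<in> carrier (vertex (resolution_cube n K A m k) I)\<rbrakk> \<Longrightarrow>
    edge (resolution_cube n K A m k) I (insert j I) x =
      counit_at n K A (k + card ({j<..m} - I)) (card ({1..<j} - I)) x"
proof (induction m arbitrary: k I)
  case (Suc m)
  let ?R = "resolution_cube n K A m"
  consider "j = Suc m" | "j \<in> {1..m}" "Suc m \<in> I" | "j \<in> {1..m}" "Suc m \<notin> I"
    using Suc(3) by force
  then show ?case
  proof cases
    case 1
    then have I: "I \<subseteq> {1..m}" "Suc m \<notin> I" using Suc(2,4) by (auto simp: le_Suc_eq)
    have fin: "finite I" using I finite_subset by blast
    have x: "x \<in> carrier (G_pow n K (Suc (k + (m - card I))) A)"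
      using Suc(5) I vertex_resolution_cube[OF I(1), of n K A "Suc k"] by (simp add: arrow_cube_simps)
    have "counit_at n K A k (m - card I) x \<in> carrier (vertex (?R k) I)"
      using counit_at_fun[of k "m - card I"] x vertex_resolution_cube[OF I(1), of n K A k] by (auto simp: Pi_iff)
    then have "edge (?R k) I I (counit_at n K A k (m - card I) x) = counit_at n K A k (m - card I) x"
      using cube_diagram.edge_refl[OF cube_extension.axioms(1)[OF resolution_cube_extension] I(1)] by simp
    moreover have "card ({1..<Suc m} - I) = m - card I"
      using card_Diff_subset[OF fin I(1)] by (simp add: atLeastLessThanSuc_atLeastAtMost)
    moreover have "insert (Suc m) I - {Suc m} = I" using I by auto
    ultimately show ?thesis using 1 I by (simp add: arrow_cube_simps)
  next
    case 2
    then have "I - {Suc m} \<subseteq> {1..m}" "j \<notin> I - {Suc m}" using Suc(2,4) by auto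
    moreover have "x \<in> carrier (vertex (?R k) (I - {Suc m}))" using Suc(5) 2 by (simp add: arrow_cube_simps)
    moreover have "insert j I - {Suc m} = insert j (I - {Suc m})" using 2 by auto
    moreover have "{j<..m} - (I - {Suc m}) = {j<..Suc m} - I" "{1..<j} - (I - {Suc m}) = {1..<j} - I"
      using 2 by (auto simp: le_Suc_eq)
    ultimately show ?thesis using Suc(1)[of "I - {Suc m}" k] 2 by (simp add: arrow_cube_simps)
  next
    case 3
    then have "I \<subseteq> {1..m}" "Suc m \<notin> insert j I" using Suc(2) by (auto simp: le_Suc_eq)
    moreover have "x \<in> carrier (vertex (?R (Suc k)) I)" using Suc(5) 3 by (simp add: arrow_cube_simps)
    moreover have "card ({j<..Suc m} - I) = Suc (card ({j<..m} - I))"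
    proof -
      have "{j<..Suc m} - I = insert (Suc m) ({j<..m} - I)" using 3 by auto
      then show ?thesis by simp
    qed
    ultimately show ?thesis using Suc(1)[of I "Suc k"] 3 Suc(4) by (simp add: arrow_cube_simps)
  qed
qed simp

end

section \<open>Homology of the resolution\<close>

declare resolution_cube.simps(2) [simp del] G_pow_simps(2) [simp del]

abbreviation resolution_face ::
    "nat \<Rightarrow> ('k, 'r) ring_scheme \<Rightarrow> ('k, ('k, 'a) lterm) nalg \<Rightarrow> nat \<Rightarrow> nat \<Rightarrow> ('k, 'a) lterm \<Rightarrow> ('k, 'a) lterm" where
  "resolution_face n K A k i \<equiv> counit_at n K A i (k - i)"

abbreviation face_kernel ::
    "nat \<Rightarrow> ('k, 'r) ring_scheme \<Rightarrow> ('k, ('k, 'a) lterm) nalg \<Rightarrow> nat \<Rightarrow> nat \<Rightarrow> ('k, 'a) lterm set" where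
  "face_kernel n K A k i \<equiv> a_kernel (G_pow n K (Suc k) A) (G_pow n K k A) (resolution_face n K A k i)"

lemma joint_commutator_mono:
  assumes "nalgebra n K A" "\<N>' \<subseteq> \<N>" "x \<in> joint_commutator n K A \<N>"
  shows "x \<in> joint_commutator n K A \<N>'"
  using nalg_hom_joint_commutator[OF assms(1,1) nalg_hom_id _ assms(3), of \<N>'] assms(2) by blast

context
  fixes n :: nat and K :: "('k, 'r) ring_scheme" and A :: "('k, ('k, 'a) lterm) nalg"
  assumes A: "nalgebra n K A"
begin

lemma resolution_face_hom:
  "i \<le> k \<Longrightarrow> resolution_face n K A k i \<in> nalg_hom n K (G_pow n K (Suc k) A) (G_pow n K k A)"
  using counit_at_hom[OF A, of i "k - i"] by simp

lemma
  shows edge_from_initial: "\<lbrakk>j \<in> {1..Suc k}; x \<in> carrier (G_pow n K (Suc k) A)\<rbrakk> \<Longrightarrow>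
      edge (resolution_cube n K A (Suc k) 0) {} {j} x = resolution_face n K A k (Suc k - j) x"
    and edge_from_first: "\<lbrakk>j \<in> {2..Suc (Suc q)}; x \<in> carrier (G_pow n K (Suc q) A)\<rbrakk> \<Longrightarrow>
      edge (resolution_cube n K A (Suc (Suc q)) 0) {1} {1, j} x = resolution_face n K A q (Suc (Suc q) - j) x"
    and edge_to_first: "\<lbrakk>j \<in> {2..Suc (Suc q)}; x \<in> carrier (G_pow n K (Suc q) A)\<rbrakk> \<Longrightarrow>
      edge (resolution_cube n K A (Suc (Suc q)) 0) {j} {1, j} x = resolution_face n K A q q x"
proof -
  show "edge (resolution_cube n K A (Suc k) 0) {} {j} x = resolution_face n K A k (Suc k - j) x"
    if "j \<in> {1..Suc k}" "x \<in> carrier (G_pow n K (Suc k) A)"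
  proof -
    have "x \<in> carrier (vertex (resolution_cube n K A (Suc k) 0) {})"
      using that(2) vertex_resolution_cube[of "{}" "Suc k" n K A 0] by simp
    then have "edge (resolution_cube n K A (Suc k) 0) {} {j} x =
        counit_at n K A (card {j<..Suc k}) (card {1..<j}) x"
      using edge_resolution_cube[OF A, of "{}" "Suc k" j x 0] that(1) by simp
    moreover have "card {j<..Suc k} = Suc k - j" "card {1..<j} = k - (Suc k - j)" using that(1) by auto
    ultimately show ?thesis by (simp only:)
  qed
  let ?W = "resolution_cube n K A (Suc (Suc q)) 0"
  assume j: "j \<in> {2..Suc (Suc q)}" and x: "x \<in> carrier (G_pow n K (Suc q) A)"
  have v: "x \<in> carrier (vertex ?W {i})" if "i \<in> {1..Suc (Suc q)}" for i
    using x that vertex_resolution_cube[of "{i}" "Suc (Suc q)" n K A 0] by simp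
  have "edge ?W {1} (insert j {1}) x =
      counit_at n K A (card ({j<..Suc (Suc q)} - {1})) (card ({1..<j} - {1})) x"
    using edge_resolution_cube[OF A, of "{1}" "Suc (Suc q)" j x 0] j v[of 1] by simp
  moreover have "card ({j<..Suc (Suc q)} - {1}) = Suc (Suc q) - j" "card ({1..<j} - {1}) = q - (Suc (Suc q) - j)"
    using j by auto
  ultimately show "edge ?W {1} {1, j} x = resolution_face n K A q (Suc (Suc q) - j) x"
    by (simp only: insert_commute)
  have "edge ?W {j} (insert 1 {j}) x =
      counit_at n K A (card ({1<..Suc (Suc q)} - {j})) (card ({1..<1} - {j})) x"
    using edge_resolution_cube[OF A, of "{j}" "Suc (Suc q)" 1 x 0] j v[of j] by simp
  moreover have "card ({1<..Suc (Suc q)} - {j}) = q" using j by simp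
  ultimately show "edge ?W {j} {1, j} x = resolution_face n K A q q x" by simp
qed

lemma edge_kernel_resolution_cube:
  "j \<in> {1..Suc k} \<Longrightarrow> edge_kernel (resolution_cube n K A (Suc k) 0) j = face_kernel n K A k (Suc k - j)"
  using edge_from_initial[of j k] vertex_resolution_cube[of "{}" "Suc k" n K A 0]
    vertex_resolution_cube[of "{j}" "Suc k" n K A 0]
  by (auto simp: in_a_kernel_iff)

lemma resolution_vertices_projective:
  assumes "I \<subset> {1..m}"
  shows "projective_alg n K (vertex (resolution_cube n K A m 0) I)"
proof -
  have "card I < m" using psubset_card_mono[OF _ assms] by simp
  then obtain r where "m - card I = Suc r" by (metis Suc_diff_Suc)
  moreover have "vertex (resolution_cube n K A m 0) I = G_pow n K (m - card I) A"
    using vertex_resolution_cube[of I m n K A 0] assms by auto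
  ultimately show ?thesis using projective_G_obj[OF field_K[OF A] n_gt_0[OF A]] by (simp add: G_pow_simps)
qed

text \<open>A simplicial identity, which here is the commutativity of a square of the cube.\<close>

lemma resolution_face_face:
  assumes "i \<le> q" "x \<in> carrier (G_pow n K (Suc (Suc q)) A)"
  shows "resolution_face n K A q i (resolution_face n K A (Suc q) (Suc q) x) =
    resolution_face n K A q q (resolution_face n K A (Suc q) i x)"
proof -
  let ?W = "resolution_cube n K A (Suc (Suc q)) 0"
  interpret W: cube_extension n K "{1..Suc (Suc q)}" ?W by (rule resolution_cube_extension[OF A])
  define j where "j = Suc (Suc q) - i"
  have j: "j \<in> {2..Suc (Suc q)}" "Suc (Suc q) - j = i" using assms(1) by (auto simp: j_def)
  have x: "x \<in> carrier (vertex ?W {})"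
    using assms(2) vertex_resolution_cube[of "{}" "Suc (Suc q)" n K A 0] by simp
  note c = nalg_hom_closed[OF resolution_face_hom assms(2)]
  have "edge ?W {1} {1, j} (edge ?W {} {1} x) = edge ?W {j} {1, j} (edge ?W {} {j} x)"
    using j x W.edge_trans[of "{}" "{1}" "{1, j}" x] W.edge_trans[of "{}" "{j}" "{1, j}" x] by simp
  then show ?thesis
    using edge_from_initial[of 1 "Suc q" x] edge_from_initial[of j "Suc q" x] assms j
      edge_from_first[OF j(1) c[of "Suc q"]] edge_to_first[OF j(1) c[of i]] by simp
qed

text \<open>
  Exactness of the augmented resolution. Prescribe \<open>y\<close> at the vertex of the last face and zero at those of
  the faces in \<open>R\<close>; where the two requirements meet, they agree because the faces in \<open>R\<close> kill \<open>y\<close>.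
\<close>

lemma resolution_lift:
  assumes y: "y \<in> carrier (G_pow n K (Suc q) A)" and R: "R \<subseteq> {..q}" "\<And>i. i \<in> R \<Longrightarrow> y \<in> face_kernel n K A q i"
  shows "\<exists>x\<in>carrier (G_pow n K (Suc (Suc q)) A). resolution_face n K A (Suc q) (Suc q) x = y \<and>
    (\<forall>i\<in>R. x \<in> face_kernel n K A (Suc q) i)"
proof -
  let ?W = "resolution_cube n K A (Suc (Suc q)) 0" let ?S = "{1..Suc (Suc q)}"
  interpret W: cube_extension n K ?S ?W by (rule resolution_cube_extension[OF A])
  define T where "T = (\<lambda>i. Suc (Suc q) - i) ` R"
  have T: "T \<subseteq> {2..Suc (Suc q)}" using R(1) by (auto simp: T_def)
  have y1: "y \<in> carrier (vertex ?W {1})" using y vertex_resolution_cube[of "{1}" "Suc (Suc q)" n K A 0] by simp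
  have yT: "edge ?W {1} {1, j} y = \<zero>\<^bsub>vertex ?W {1, j}\<^esub>" if "j \<in> T" for j
  proof -
    obtain i where i: "i \<in> R" "j = Suc (Suc q) - i" using \<open>j \<in> T\<close> by (auto simp: T_def)
    then have "resolution_face n K A q (Suc (Suc q) - j) y = \<zero>\<^bsub>G_pow n K q A\<^esub>"
      using R(2)[of i] R(1) by (auto simp: in_a_kernel_iff)
    moreover have "card {1, j} = 2" "j \<in> {2..Suc (Suc q)}" using T that by auto
    ultimately show ?thesis
      using edge_from_first[of j q y] y vertex_resolution_cube[of "{1, j}" "Suc (Suc q)" n K A 0] by simp
  qed
  define U where "U = {J. J \<subseteq> ?S \<and> (1 \<in> J \<or> J \<inter> T \<noteq> {})}"
  define x where "x J = (if 1 \<in> J then edge ?W {1} J y else \<zero>\<^bsub>vertex ?W J\<^esub>)" for J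
  have "\<exists>z\<in>carrier (vertex ?W {}). \<forall>J\<in>U. {} \<subseteq> J \<longrightarrow> edge ?W {} J z = x J"
  proof (rule W.extend_elements)
    show "upward_closed ?S U" by (auto simp: U_def upward_closed_def)
    show "?S \<in> U" by (auto simp: U_def)
    fix J assume J: "J \<in> U"
    then have JS: "J \<subseteq> ?S" by (auto simp: U_def)
    interpret J: nalgebra n K "vertex ?W J" by (rule W.vertex_nalgebra[OF JS])
    show "x J \<in> carrier (vertex ?W J)"
      using W.edge_closed[of "{1}" J y] y1 JS by (auto simp: x_def)
    fix M assume M: "J \<subseteq> M" "M \<subseteq> ?S"
    show "edge ?W J M (x J) = x M"
    proof (cases "1 \<in> J")
      case True
      then show ?thesis using W.edge_trans[of "{1}" J M y] y1 M by (auto simp: x_def)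
    next
      case False
      then obtain j where j: "j \<in> J" "j \<in> T" using J by (auto simp: U_def)
      have "edge ?W {1} M y = \<zero>\<^bsub>vertex ?W M\<^esub>" if "1 \<in> M"
      proof -
        have "{1, j} \<subseteq> M" using that j M by auto
        then show ?thesis
          using W.edge_trans[of "{1}" "{1, j}" M y] W.edge_zero[of "{1, j}" M] yT[OF j(2)] y1 M by simp
      qed
      then show ?thesis using False W.edge_zero[OF M] by (simp add: x_def)
    qed
  qed simp
  then obtain z where z: "z \<in> carrier (vertex ?W {})" "\<And>J. J \<in> U \<Longrightarrow> edge ?W {} J z = x J" by auto
  have zc: "z \<in> carrier (G_pow n K (Suc (Suc q)) A)"
    using z(1) vertex_resolution_cube[of "{}" "Suc (Suc q)" n K A 0] by simp
  have "resolution_face n K A (Suc q) (Suc q) z = y"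
    using z(2)[of "{1}"] edge_from_initial[of 1 "Suc q" z] zc W.edge_refl[OF _ y1] by (simp add: U_def x_def)
  moreover have "z \<in> face_kernel n K A (Suc q) i" if i: "i \<in> R" for i
  proof -
    define j where "j = Suc (Suc q) - i"
    have j: "j \<in> T" "j \<in> {2..Suc (Suc q)}" "Suc (Suc q) - j = i" using i T R(1) by (auto simp: j_def T_def)
    then have "{j} \<in> U" "x {j} = \<zero>\<^bsub>vertex ?W {j}\<^esub>" by (auto simp: U_def x_def)
    then have "z \<in> edge_kernel ?W j" using z by (simp add: in_a_kernel_iff)
    then show ?thesis using edge_kernel_resolution_cube[of j "Suc q"] j by simp
  qed
  ultimately show ?thesis using zc by blast
qed

text \<open>
  The faces other than the last one form a cube with terminal vertex \<open>G A\<close>, all of whose vertices are free.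
\<close>

lemma
  fixes q :: nat
  defines "X \<equiv> G_pow n K (Suc (Suc q)) A"
  shows resolution_commutators: "\<And>x. x \<in> joint_commutator n K X {} \<Longrightarrow>
      (\<And>i. i \<le> q \<Longrightarrow> x \<in> face_kernel n K A (Suc q) i) \<Longrightarrow>
      x \<in> joint_commutator n K X (face_kernel n K A (Suc q) ` {..q})"
    and resolution_lift_commutators: "\<And>z. z \<in> carrier X \<Longrightarrow>
      (\<And>i. i \<le> q \<Longrightarrow> resolution_face n K A (Suc q) i z \<in> joint_commutator n K (G_pow n K (Suc q) A) {}) \<Longrightarrow>
      \<exists>v\<in>joint_commutator n K X {}. \<forall>i\<le>q. resolution_face n K A (Suc q) i v = resolution_face n K A (Suc q) i z"
proof -
  let ?W = "resolution_cube n K A (Suc (Suc q)) 0" let ?S = "{2..Suc (Suc q)}"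
  interpret W: cube_extension n K ?S ?W
    by (rule cube_extension.subcube[OF resolution_cube_extension[OF A]]) auto
  have proj: "projective_alg n K (vertex ?W I)" if "I \<subseteq> ?S" for I
  proof (rule resolution_vertices_projective)
    have "1 \<notin> I" "I \<subseteq> {1..Suc (Suc q)}" using that by auto
    then show "I \<subset> {1..Suc (Suc q)}" by auto
  qed
  have X: "vertex ?W {} = X" using vertex_resolution_cube[of "{}" "Suc (Suc q)" n K A 0] by (simp add: X_def)
  have Xi: "vertex ?W {j} = G_pow n K (Suc q) A" if "j \<in> ?S" for j
    using vertex_resolution_cube[of "{j}" "Suc (Suc q)" n K A 0] that by simp
  have ker: "edge_kernel ?W j = face_kernel n K A (Suc q) (Suc (Suc q) - j)" if "j \<in> ?S" for j
    using edge_kernel_resolution_cube[of j "Suc q"] that by auto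
  have "(\<lambda>j. Suc (Suc q) - j) ` ?S = {..q}"
  proof
    show "{..q} \<subseteq> (\<lambda>j. Suc (Suc q) - j) ` ?S"
      by (rule subsetI, rule_tac x = "Suc (Suc q) - x" in image_eqI) auto
  qed auto
  then have kers: "edge_kernel ?W ` ?S = face_kernel n K A (Suc q) ` {..q}"
    using ker by (metis (no_types, lifting) image_cong image_image)
  show "x \<in> joint_commutator n K X (face_kernel n K A (Suc q) ` {..q})"
    if "x \<in> joint_commutator n K X {}" "\<And>i. i \<le> q \<Longrightarrow> x \<in> face_kernel n K A (Suc q) i" for x
  proof -
    have "x \<in> edge_kernel ?W j" if "j \<in> ?S" for j
    proof -
      have "Suc (Suc q) - j \<le> q" using that by auto
      then show ?thesis using \<open>\<And>i. i \<le> q \<Longrightarrow> x \<in> face_kernel n K A (Suc q) i\<close> unfolding ker[OF that] by blast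
    qed
    moreover have "x \<in> joint_commutator n K (vertex ?W {}) {}" using that(1) by (simp only: X)
    ultimately have "x \<in> joint_commutator n K (vertex ?W {}) (edge_kernel ?W ` ?S)"
      by (intro W.projective_cube_commutators[OF proj])
    then show ?thesis using kers by (simp only: X)
  qed
  show "\<exists>v\<in>joint_commutator n K X {}. \<forall>i\<le>q. resolution_face n K A (Suc q) i v = resolution_face n K A (Suc q) i z"
    if z: "z \<in> carrier X" "\<And>i. i \<le> q \<Longrightarrow> resolution_face n K A (Suc q) i z \<in> joint_commutator n K (G_pow n K (Suc q) A) {}"
    for z
  proof -
    interpret X: nalgebra n K X unfolding X_def by (rule nalgebra_G_pow[OF A])
    have e: "edge ?W {} {j} x = resolution_face n K A (Suc q) (Suc (Suc q) - j) x" if "j \<in> ?S" "x \<in> carrier X" for j x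
      using edge_from_initial[of j "Suc q" x] that by (simp add: X_def)
    have "\<exists>v\<in>joint_commutator n K X {}. \<forall>j\<in>?S. edge ?W {} {j} v = edge ?W {} {j} z"
    proof -
      have "edge ?W {} {j} z \<in> joint_commutator n K (vertex ?W {j}) {}" if "j \<in> ?S" for j
      proof -
        have "Suc (Suc q) - j \<le> q" using that by auto
        then show ?thesis using z(2) e[OF that z(1)] Xi[OF that] by simp
      qed
      then show ?thesis using W.projective_cube_lift_commutators[OF proj, of z] z(1) by (simp add: X)
    qed
    then obtain v where v: "v \<in> joint_commutator n K X {}" "\<And>j. j \<in> ?S \<Longrightarrow> edge ?W {} {j} v = edge ?W {} {j} z" by blast
    have "resolution_face n K A (Suc q) i v = resolution_face n K A (Suc q) i z" if "i \<le> q" for i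
    proof -
      have j: "Suc (Suc q) - i \<in> ?S" "Suc (Suc q) - (Suc (Suc q) - i) = i" using that by auto
      then show ?thesis using v(2)[OF j(1)] e[OF j(1)] z(1) X.joint_commutator_carrier[OF v(1)] by simp
    qed
    then show ?thesis using v(1) by blast
  qed
qed

end

lemma nlie_map_coset:
  assumes A: "nalgebra n K A" and B: "nalgebra n K B" and h: "h \<in> nalg_hom n K A B" and x: "x \<in> carrier A"
  shows "nlie_map n K A B h (coset_map A (joint_commutator n K A {}) x) =
    coset_map B (joint_commutator n K B {}) (h x)"
proof -
  interpret A: nalgebra n K A by fact
  interpret B: nalgebra n K B by fact
  let ?V = "joint_commutator n K A {}" and ?W = "joint_commutator n K B {}"
  note subA = A.submodule_joint_commutator[of "{}"] and subB = B.submodule_joint_commutator[of "{}"]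
  have "coset_map B ?W (h y) = coset_map B ?W (h x)" if "y \<in> coset_map A ?V x" for y
  proof -
    have y: "y \<in> carrier A" "y \<ominus>\<^bsub>A\<^esub> x \<in> ?V" using that A.in_coset_iff[OF subA x] by auto
    have "h (y \<ominus>\<^bsub>A\<^esub> x) \<in> ?W" by (rule nalg_hom_joint_commutator[OF A B h _ y(2)]) simp
    then show ?thesis
      using y x nalg_hom_closed[OF h] by (subst B.coset_eq_iff[OF subB]) (auto simp: nalg_hom_minus[OF A B h])
  qed
  then show ?thesis
    using A.coset_self[OF subA x] unfolding nlie_map_def B.rel_commutator_total by blast
qed

lemma
  assumes "nalgebra n K X"
  shows nlie_coset_hom: "coset_map X (joint_commutator n K X {}) \<in> nalg_hom n K X (nlie n K X)"
    and nlie_coset_surj: "coset_map X (joint_commutator n K X {}) ` carrier X = carrier (nlie n K X)"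
    and nalgebra_nlie: "nalgebra n K (nlie n K X)"
    and nlie_coset_eq_zero: "\<And>x. x \<in> carrier X \<Longrightarrow>
      coset_map X (joint_commutator n K X {}) x = \<zero>\<^bsub>nlie n K X\<^esub> \<longleftrightarrow> x \<in> joint_commutator n K X {}"
proof -
  interpret X: nalgebra n K X by fact
  have V: "nalg_ideal n K X (joint_commutator n K X {})" by (rule X.ideal_joint_commutator) simp
  show "coset_map X (joint_commutator n K X {}) \<in> nalg_hom n K X (nlie n K X)"
    "coset_map X (joint_commutator n K X {}) ` carrier X = carrier (nlie n K X)"
    "nalgebra n K (nlie n K X)"
    unfolding nlie_def X.rel_commutator_total
    by (rule coset_map_hom[OF assms V] coset_map_surj[OF assms V] nalgebra_quot[OF assms V])+
  show "coset_map X (joint_commutator n K X {}) x = \<zero>\<^bsub>nlie n K X\<^esub> \<longleftrightarrow> x \<in> joint_commutator n K X {}"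
    if "x \<in> carrier X" for x
    unfolding nlie_def X.rel_commutator_total by (rule coset_map_eq_zero[OF assms V that])
qed

text \<open>
  Connects the homology of \<open>nlie X\<close> in degree \<open>Suc q\<close> with that of the commutators in degree \<open>q\<close>, as the long exact sequence of
  \<open>V X \<rightarrow> X \<rightarrow> nlie X\<close> would: every cycle of \<open>nlie X\<close> lifts to an element of \<open>X\<close> of which only the last face,
  which is a commutator, can be nonzero.
\<close>

definition lifted_cycles ::
    "nat \<Rightarrow> ('k, 'r) ring_scheme \<Rightarrow> ('k, ('k, 'a) lterm) nalg \<Rightarrow> nat \<Rightarrow> ('k, 'a) lterm set" where
  "lifted_cycles n K A q = {t \<in> carrier (G_pow n K (Suc (Suc q)) A).
     (\<forall>i\<le>q. t \<in> face_kernel n K A (Suc q) i) \<and>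
     resolution_face n K A (Suc q) (Suc q) t \<in> joint_commutator n K (G_pow n K (Suc q) A) {}}"

lemma
  fixes L :: "('k, 'a) nalg" and q :: nat
  assumes L: "nalgebra n K L"
  defines "A \<equiv> obj_copy L"
  defines "S \<equiv> map_simplicial (nlie n K) (nlie_map n K) (G_resolution n K L)"
  defines "X \<equiv> G_pow n K (Suc (Suc q)) A" and "Y \<equiv> G_pow n K (Suc q) A"
  defines "D \<equiv> joint_commutator n K Y (face_kernel n K A q ` {..q})"
  defines "\<alpha> \<equiv> coset_map X (joint_commutator n K X {})" and "\<beta> \<equiv> resolution_face n K A (Suc q) (Suc q)"
  shows lifted_cycles_image: "\<alpha> ` lifted_cycles n K A q = moore_cycles S (Suc q)"
    and lifted_boundaries_image: "moore_boundaries S (Suc q) = \<alpha> ` {t \<in> lifted_cycles n K A q. \<beta> t \<in> D}"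
    and lifted_boundaries: "\<And>t. t \<in> lifted_cycles n K A q \<Longrightarrow> \<alpha> t \<in> moore_boundaries S (Suc q) \<Longrightarrow> \<beta> t \<in> D"
    and last_face_image: "\<beta> ` lifted_cycles n K A q =
      {y \<in> joint_commutator n K Y {}. \<forall>i\<le>q. y \<in> face_kernel n K A q i}"
proof -
  have A: "nalgebra n K A"
    using leibniz_algebra_obj_copy nalgebra.axioms(1)[OF L] nalgebra.n_pos[OF L]
    by (auto simp: A_def intro: nalgebraI)
  note P = nalgebra_G_pow[OF A]
  interpret X: nalgebra n K X unfolding X_def by (rule P)
  interpret Y: nalgebra n K Y unfolding Y_def by (rule P)
  let ?T = "lifted_cycles n K A q"
  let ?X = "\<lambda>k. G_pow n K (Suc k) A" let ?V = "\<lambda>k. joint_commutator n K (?X k) {}"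
  let ?q = "\<lambda>k. coset_map (?X k) (?V k)"
  let ?d = "resolution_face n K A"
  have d: "i \<le> Suc k \<Longrightarrow> ?d (Suc k) i \<in> nalg_hom n K (?X (Suc k)) (?X k)" for i k
    by (rule resolution_face_hom[OF A])
  note dc = nalg_hom_closed[OF d] and dminus = nalg_hom_minus[OF P P d] and dadd = nalg_hom_add[OF d]
  have dV: "?d (Suc k) i v \<in> ?V k" if "i \<le> Suc k" "v \<in> ?V (Suc k)" for i k v
    by (rule nalg_hom_joint_commutator[OF P P d[OF that(1)] _ that(2)]) simp
  have obj: "obj S k = nlie n K (?X k)" for k
    by (simp add: S_def map_simplicial_def G_resolution_def A_def)
  have face: "face S (Suc k) i (?q (Suc k) x) = ?q k (?d (Suc k) i x)"
    if "i \<le> Suc k" "x \<in> carrier (?X (Suc k))" for k i x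
    using nlie_map_coset[OF P P d[OF that(1)] that(2)]
    by (simp add: S_def map_simplicial_def G_resolution_def A_def counit_at_def)
  have face0: "face S (Suc k) i (?q (Suc k) x) = \<zero>\<^bsub>obj S k\<^esub> \<longleftrightarrow> ?d (Suc k) i x \<in> ?V k"
    if "i \<le> Suc k" "x \<in> carrier (?X (Suc k))" for k i x
    using nlie_coset_eq_zero[OF P dc[OF that]] face[OF that] by (simp only: obj)
  have carr: "carrier (obj S k) = ?q k ` carrier (?X k)" for k
    unfolding obj by (rule nlie_coset_surj[OF P, symmetric])
  have q_eq: "?q k x = ?q k y \<longleftrightarrow> x \<ominus>\<^bsub>?X k\<^esub> y \<in> ?V k" if "x \<in> carrier (?X k)" "y \<in> carrier (?X k)" for k x y
    by (rule nalgebra.coset_eq_iff[OF P nalgebra.submodule_joint_commutator[OF P] that])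
  have Vc: "v \<in> ?V k \<Longrightarrow> v \<in> carrier (?X k)" for v k
    by (rule nalgebra.joint_commutator_carrier[OF P])
  have V0: "\<zero>\<^bsub>?X k\<^esub> \<in> ?V k" for k by (rule joint_commutator.zero)
  have q_minus: "?q k (x \<ominus>\<^bsub>?X k\<^esub> v) = ?q k x" if "x \<in> carrier (?X k)" "v \<in> ?V k" for k x v
  proof -
    interpret Xk: nalgebra n K "?X k" by (rule P)
    have v: "v \<in> carrier (?X k)" using that Vc by blast
    then have "(x \<ominus>\<^bsub>?X k\<^esub> v) \<ominus>\<^bsub>?X k\<^esub> x = \<ominus>\<^bsub>?X k\<^esub> v"
      using that(1) by (simp add: a_minus_def Xk.M.add.m_assoc Xk.M.add.m_lcomm[of x] Xk.M.r_neg)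
    then show ?thesis
      using that v Xk.submoduleE(3)[OF Xk.submodule_joint_commutator] by (subst q_eq) auto
  qed
  have zeroV: "?d (Suc k) i x \<in> ?V k" if "x \<in> face_kernel n K A (Suc k) i" for k i x
    using that V0 by (simp add: in_a_kernel_iff)
  \<comment> \<open>Elements of \<open>nlie X\<close> with vanishing faces before the last one lift to such elements of \<open>X\<close>.\<close>
  have correct: "\<exists>t\<in>carrier (?X (Suc k)). ?q (Suc k) t = ?q (Suc k) z \<and> (\<forall>i\<le>k. t \<in> face_kernel n K A (Suc k) i) \<and>
      (?d (Suc k) (Suc k) z \<in> ?V k \<longrightarrow> ?d (Suc k) (Suc k) t \<in> ?V k)"
    if z: "z \<in> carrier (?X (Suc k))" "\<And>i. i \<le> k \<Longrightarrow> ?d (Suc k) i z \<in> ?V k" for k z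
  proof -
    interpret Z: nalgebra n K "?X (Suc k)" by (rule P)
    interpret Z': nalgebra n K "?X k" by (rule P)
    obtain v where v: "v \<in> ?V (Suc k)" "\<And>i. i \<le> k \<Longrightarrow> ?d (Suc k) i v = ?d (Suc k) i z"
      using resolution_lift_commutators[OF A z] by auto
    have vc: "v \<in> carrier (?X (Suc k))" using v(1) by (rule Vc)
    let ?t = "z \<ominus>\<^bsub>?X (Suc k)\<^esub> v"
    have tc: "?t \<in> carrier (?X (Suc k))" using z(1) vc by (rule Z.M.minus_closed)
    have "?t \<in> face_kernel n K A (Suc k) i" if "i \<le> k" for i
      using that v(2)[OF that] dc[of i k z] z(1) vc tc dminus[of i k z v]
      by (simp only: in_a_kernel_iff Z'.minus_eq_zero_iff le_SucI simp_thms)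
    moreover have "?d (Suc k) (Suc k) ?t \<in> ?V k" if "?d (Suc k) (Suc k) z \<in> ?V k"
      using that dminus[of "Suc k" k z v] z(1) vc dV[of "Suc k" k v] v(1)
        Z'.submodule_minus[OF Z'.submodule_joint_commutator] by (simp only: order_refl)
    ultimately show ?thesis using tc q_minus[OF z(1) v(1)] by blast
  qed
  have T: "t \<in> ?T \<longleftrightarrow> t \<in> carrier (?X (Suc q)) \<and> (\<forall>i\<le>q. t \<in> face_kernel n K A (Suc q) i) \<and> ?d (Suc q) (Suc q) t \<in> ?V q" for t
    by (simp add: lifted_cycles_def)
  have XY: "X = ?X (Suc q)" "Y = ?X q" "\<alpha> = ?q (Suc q)" by (simp_all add: X_def Y_def \<alpha>_def)
  have cycles: "x \<in> moore_cycles S (Suc q) \<longleftrightarrow> x \<in> carrier (obj S (Suc q)) \<and> (\<forall>i\<le>Suc q. face S (Suc q) i x = \<zero>\<^bsub>obj S q\<^esub>)" for x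
    by (auto simp: moore_cycles_def moore_def le_Suc_eq less_Suc_eq_le)
  show "\<alpha> ` ?T = moore_cycles S (Suc q)"
  proof (intro equalityI subsetI)
    fix x assume "x \<in> \<alpha> ` ?T"
    then obtain t where t: "t \<in> ?T" "x = ?q (Suc q) t" by (auto simp: XY)
    then have "?d (Suc q) i t \<in> ?V q" if "i \<le> Suc q" for i
      using that zeroV[of t q i] unfolding T by (auto simp: le_Suc_eq)
    then show "x \<in> moore_cycles S (Suc q)"
      using t face0[of _ q t] unfolding cycles T carr by auto
  next
    fix x assume x: "x \<in> moore_cycles S (Suc q)"
    then obtain z where z: "z \<in> carrier (?X (Suc q))" "x = ?q (Suc q) z" unfolding cycles carr by auto
    then have dz: "?d (Suc q) i z \<in> ?V q" if "i \<le> Suc q" for i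
      using x that face0[OF that z(1)] unfolding cycles by simp
    then obtain t where "t \<in> carrier (?X (Suc q))" "?q (Suc q) t = x" "\<forall>i\<le>q. t \<in> face_kernel n K A (Suc q) i"
      "?d (Suc q) (Suc q) t \<in> ?V q"
      using correct[OF z(1)] z(2) by (metis le_SucI order_refl)
    then show "x \<in> \<alpha> ` ?T" unfolding XY T[symmetric] by (intro image_eqI[of _ _ t]) (auto simp: T)
  qed
  \<comment> \<open>The last face maps the joint commutator of the other face kernels onto \<open>D\<close>.\<close>
  let ?DX = "joint_commutator n K X (face_kernel n K A (Suc q) ` {..q})"
  have face_face: "?d (Suc q) (Suc q) x \<in> face_kernel n K A q i"
    if "i \<le> q" "x \<in> face_kernel n K A (Suc q) i" for i x
  proof -
    have x: "x \<in> carrier (?X (Suc q))" "?d (Suc q) i x = \<zero>\<^bsub>?X q\<^esub>" using that(2) by (auto simp: in_a_kernel_iff)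
    have "?d q q \<zero>\<^bsub>?X q\<^esub> = \<zero>\<^bsub>G_pow n K q A\<^esub>"
      by (rule nalg_hom_zero[OF P P resolution_face_hom[OF A order_refl]])
    then show ?thesis using resolution_face_face[OF A that(1) x(1)] x dc[of "Suc q" q x] by (simp add: in_a_kernel_iff)
  qed
  have \<beta>: "\<beta> \<in> nalg_hom n K X Y" unfolding XY \<beta>_def by (rule d) simp
  have DXD: "\<beta> x \<in> D" if "x \<in> ?DX" for x
    unfolding D_def
  proof (rule nalg_hom_joint_commutator[OF X.nalgebra_axioms Y.nalgebra_axioms \<beta> _ that])
    fix N' assume "N' \<in> face_kernel n K A q ` {..q}"
    then obtain i where "i \<le> q" "N' = face_kernel n K A q i" by auto
    then show "\<exists>N\<in>face_kernel n K A (Suc q) ` {..q}. \<forall>x\<in>carrier X. x \<in> N \<longrightarrow> \<beta> x \<in> N'"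
      using face_face unfolding \<beta>_def by blast
  qed
  have DX_lift: "\<exists>x\<in>?DX. \<beta> x = y" if "y \<in> D" for y
  proof (rule joint_commutator_lift[OF X.nalgebra_axioms Y.nalgebra_axioms \<beta> _ that[unfolded D_def]])
    fix y assume y: "y \<in> carrier Y"
    let ?R = "{i\<in>{..q}. y \<in> face_kernel n K A q i}"
    have "\<exists>x\<in>carrier X. \<beta> x = y \<and> (\<forall>i\<in>?R. x \<in> face_kernel n K A (Suc q) i)"
      unfolding X_def \<beta>_def by (rule resolution_lift[OF A y[unfolded Y_def]]) auto
    then show "\<exists>x\<in>carrier X. \<beta> x = y \<and> (\<forall>i\<in>{..q}. y \<in> face_kernel n K A q i \<longrightarrow> x \<in> face_kernel n K A (Suc q) i)"
      by (elim bexE, intro bexI) simp_all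
  qed
  have kernel: "nalg_ideal n K X (face_kernel n K A (Suc q) i)" if "i \<le> q" for i
    unfolding XY using that by (intro nalg_hom_kernel_ideal[OF P P d]) simp
  have DXV: "x \<in> ?V (Suc q)" "i \<le> q \<Longrightarrow> x \<in> face_kernel n K A (Suc q) i" if "x \<in> ?DX" for x i
  proof -
    show "x \<in> ?V (Suc q)" using joint_commutator_mono[OF X.nalgebra_axioms _ that, of "{}"] by (simp add: XY)
    show "x \<in> face_kernel n K A (Suc q) i" if i: "i \<le> q"
      by (rule subsetD[OF X.joint_commutator_subset[OF _ kernel[OF i]] \<open>x \<in> ?DX\<close>]) (use i in auto)
  qed
  have kernel_minus: "x \<ominus>\<^bsub>X\<^esub> y \<in> face_kernel n K A (Suc q) i"
    if "i \<le> q" "x \<in> face_kernel n K A (Suc q) i" "y \<in> face_kernel n K A (Suc q) i" for x y i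
    using X.submodule_minus[OF X.ideal_submodule[OF kernel[OF that(1)]] that(2,3)] .
  have \<beta>_minus: "\<beta> (x \<ominus>\<^bsub>X\<^esub> y) = \<beta> x \<ominus>\<^bsub>Y\<^esub> \<beta> y" if "x \<in> carrier X" "y \<in> carrier X" for x y
    by (rule nalg_hom_minus[OF X.nalgebra_axioms Y.nalgebra_axioms \<beta> that])
  note \<beta>c = nalg_hom_closed[OF \<beta>]
  \<comment> \<open>Boundaries are the classes of elements with all faces zero; up to \<open>?DX\<close> these are the \<open>t\<close> with \<open>\<beta> t \<in> D\<close>.\<close>
  show boundaries: "moore_boundaries S (Suc q) = \<alpha> ` {t \<in> ?T. \<beta> t \<in> D}"
  proof (intro equalityI subsetI)
    fix b assume "b \<in> moore_boundaries S (Suc q)"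
    then obtain x where x: "b = face S (Suc (Suc q)) (Suc (Suc q)) x" "x \<in> carrier (obj S (Suc (Suc q)))"
      "\<And>i. i \<le> Suc q \<Longrightarrow> face S (Suc (Suc q)) i x = \<zero>\<^bsub>obj S (Suc q)\<^esub>"
      by (auto simp: moore_boundaries_def moore_def less_Suc_eq_le)
    from x(2) obtain z where z: "z \<in> carrier (?X (Suc (Suc q)))" "x = ?q (Suc (Suc q)) z"
      unfolding carr by (rule imageE) (rule that)
    have dz: "?d (Suc (Suc q)) i z \<in> ?V (Suc q)" if "i \<le> Suc q" for i
      using x(3)[OF that] face0[of i "Suc q" z] that z by simp
    obtain c where c: "c \<in> carrier (?X (Suc (Suc q)))" "?q (Suc (Suc q)) c = x"
      and ck: "\<forall>i\<le>Suc q. c \<in> face_kernel n K A (Suc (Suc q)) i"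
      using bexE[OF correct[OF z(1) dz]] unfolding z(2) by (metis (no_types, lifting))
    let ?t = "?d (Suc (Suc q)) (Suc (Suc q)) c"
    have t: "?t \<in> carrier (?X (Suc q))" using dc[OF order_refl c(1)] .
    have tk: "?t \<in> face_kernel n K A (Suc q) i" if "i \<le> Suc q" for i
    proof -
      have ci: "?d (Suc (Suc q)) i c = \<zero>\<^bsub>?X (Suc q)\<^esub>" using ck that by (simp add: in_a_kernel_iff)
      have "?d (Suc q) (Suc q) \<zero>\<^bsub>?X (Suc q)\<^esub> = \<zero>\<^bsub>?X q\<^esub>"
        by (rule nalg_hom_zero[OF P P d[OF order_refl]])
      then show ?thesis using resolution_face_face[OF A that c(1)] ci t by (simp add: in_a_kernel_iff)
    qed
    have "\<beta> ?t = \<zero>\<^bsub>Y\<^esub>" using tk[of "Suc q"] unfolding XY \<beta>_def by (simp add: in_a_kernel_iff)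
    then have "?t \<in> {t \<in> ?T. \<beta> t \<in> D}"
      using t tk V0[of q] unfolding T XY \<beta>_def D_def by (auto intro: joint_commutator.zero)
    moreover have "b = \<alpha> ?t" using face[OF order_refl c(1)] c(2) x(1) unfolding XY by simp
    ultimately show "b \<in> \<alpha> ` {t \<in> ?T. \<beta> t \<in> D}" by blast
  next
    fix b assume "b \<in> \<alpha> ` {t \<in> ?T. \<beta> t \<in> D}"
    then obtain t where t: "t \<in> ?T" "\<beta> t \<in> D" "b = ?q (Suc q) t" unfolding XY by auto
    obtain v where v: "v \<in> ?DX" "\<beta> v = \<beta> t" using DX_lift[OF t(2)] by auto
    have tc: "t \<in> carrier X" "v \<in> carrier X" using t(1) v(1) X.joint_commutator_carrier unfolding T XY by auto
    let ?t = "t \<ominus>\<^bsub>X\<^esub> v"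
    have "?t \<in> face_kernel n K A (Suc q) i" if "i \<le> Suc q" for i
    proof (cases "i \<le> q")
      case True
      then show ?thesis using kernel_minus DXV(2)[OF v(1)] t(1) unfolding T by blast
    next
      case False
      then have "i = Suc q" using that by simp
      moreover have "\<beta> ?t = \<zero>\<^bsub>Y\<^esub>" using \<beta>_minus[OF tc] v(2) \<beta>c[OF tc(1)] by (simp add: Y.minus_eq_zero_iff)
      ultimately show ?thesis using X.M.minus_closed[OF tc] by (simp add: in_a_kernel_iff \<beta>_def X_def Y_def)
    qed
    moreover have "?t \<in> carrier (?X (Suc q))" using X.M.minus_closed[OF tc] by (simp only: XY)
    ultimately obtain c where c: "c \<in> carrier (?X (Suc (Suc q)))" "?d (Suc (Suc q)) (Suc (Suc q)) c = ?t"
      "\<And>i. i \<le> Suc q \<Longrightarrow> c \<in> face_kernel n K A (Suc (Suc q)) i"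
      using resolution_lift[OF A, of ?t "Suc q" "{..Suc q}"] by auto
    have "?q (Suc q) ?t = b" using q_minus[of t "Suc q" v] tc(1) DXV(1)[OF v(1)] t(3) unfolding XY by simp
    then have "b = face S (Suc (Suc q)) (Suc (Suc q)) (?q (Suc (Suc q)) c)"
      using face[OF order_refl c(1)] c(2) by simp
    moreover have "?q (Suc (Suc q)) c \<in> moore S (Suc (Suc q))"
      using c(1) face0[of _ "Suc q" c] zeroV[OF c(3)] by (auto simp: moore_def carr less_Suc_eq_le)
    ultimately show "b \<in> moore_boundaries S (Suc q)" by (auto simp: moore_boundaries_def)
  qed
  show "\<beta> t \<in> D" if t: "t \<in> ?T" "\<alpha> t \<in> moore_boundaries S (Suc q)" for t
  proof -
    obtain s where s: "s \<in> ?T" "\<beta> s \<in> D" "?q (Suc q) t = ?q (Suc q) s"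
      using t(2) unfolding boundaries XY by auto
    have c: "t \<in> carrier X" "s \<in> carrier X" using t(1) s(1) unfolding T XY by auto
    have "t \<ominus>\<^bsub>X\<^esub> s \<in> joint_commutator n K X {}" using s(3) q_eq[of t "Suc q" s] c unfolding XY by simp
    moreover have "t \<ominus>\<^bsub>X\<^esub> s \<in> face_kernel n K A (Suc q) i" if "i \<le> q" for i
      using kernel_minus[OF that] t(1) s(1) that unfolding T by blast
    ultimately have "t \<ominus>\<^bsub>X\<^esub> s \<in> ?DX" unfolding X_def by (rule resolution_commutators[OF A])
    then have "\<beta> t \<ominus>\<^bsub>Y\<^esub> \<beta> s \<in> D" using DXD \<beta>_minus[OF c] by metis
    then have "(\<beta> t \<ominus>\<^bsub>Y\<^esub> \<beta> s) \<oplus>\<^bsub>Y\<^esub> \<beta> s \<in> D" using s(2) unfolding D_def by (rule joint_commutator.add)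
    then show ?thesis using \<beta>c c by (simp add: Y.minus_add_cancel)
  qed
  show "\<beta> ` ?T = {y \<in> joint_commutator n K Y {}. \<forall>i\<le>q. y \<in> face_kernel n K A q i}"
  proof (intro equalityI subsetI)
    fix y assume "y \<in> \<beta> ` ?T"
    then obtain t where "t \<in> ?T" "y = ?d (Suc q) (Suc q) t" unfolding \<beta>_def by blast
    then show "y \<in> {y \<in> joint_commutator n K Y {}. \<forall>i\<le>q. y \<in> face_kernel n K A q i}"
      using face_face unfolding T XY by simp
  next
    fix y assume y: "y \<in> {y \<in> joint_commutator n K Y {}. \<forall>i\<le>q. y \<in> face_kernel n K A q i}"
    then have "y \<in> carrier (?X q)" using Vc[of y q] unfolding XY by simp
    then obtain x where "x \<in> carrier (?X (Suc q))" "?d (Suc q) (Suc q) x = y" "\<forall>i\<le>q. x \<in> face_kernel n K A (Suc q) i"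
      using resolution_lift[OF A, of y q "{..q}"] y by auto
    then show "y \<in> \<beta> ` ?T" using y unfolding \<beta>_def XY by (intro image_eqI[of _ _ x]) (auto simp: T)
  qed
qed

section \<open>Comparison of the two quotients\<close>

lemma (in nalgebra) ideal_inter:
  assumes "\<And>i. i \<in> I \<Longrightarrow> nalg_ideal n K L (N i)"
  shows "nalg_ideal n K L {x \<in> carrier L. \<forall>i\<in>I. x \<in> N i}" (is "nalg_ideal n K L ?M")
proof -
  note E = submoduleE[OF ideal_submodule[OF assms]] and z = submodule_zero[OF ideal_submodule[OF assms]]
  have "submodule ?M K L" using E(3-5) z by (intro submoduleI) auto
  moreover have "bracket L xs \<in> ?M" if "length xs = n" "set xs \<subseteq> carrier L" "x \<in> set xs" "x \<in> ?M" for xs x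
    using ideal_bracket[OF assms that(1-3)] that bracket_closed by auto
  ultimately show ?thesis unfolding nalg_ideal_def by blast
qed

lemma (in nalgebra) nalgebra_ideal:
  assumes N: "nalg_ideal n K L N"
  shows "nalgebra n K (L\<lparr>carrier := N\<rparr>)"
proof (rule nalgebra_subalgebra[OF ideal_submodule[OF N]])
  fix xs assume xs: "length xs = n" "set xs \<subseteq> N"
  have "xs ! 0 \<in> set xs" using xs n_pos by simp
  moreover have "set xs \<subseteq> carrier L" using xs submoduleE(1)[OF ideal_submodule[OF N]] by blast
  ultimately show "bracket L xs \<in> N" using ideal_bracket[OF N xs(1), of "xs ! 0"] xs(2) by blast
qed

lemma inclusion_hom: "N \<subseteq> carrier L \<Longrightarrow> (\<lambda>x. x) \<in> nalg_hom n K (L\<lparr>carrier := N\<rparr>) L"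
  by (rule nalg_homI) auto

lemma (in nalgebra) ideal_in_ideal:
  assumes N: "nalg_ideal n K L N" and D: "nalg_ideal n K L D" and sub: "D \<subseteq> N"
  shows "nalg_ideal n K (L\<lparr>carrier := N\<rparr>) D"
proof -
  interpret N: nalgebra n K "L\<lparr>carrier := N\<rparr>" by (rule nalgebra_ideal[OF N])
  have NL: "N \<subseteq> carrier L" by (rule submoduleE(1)[OF ideal_submodule[OF N]])
  note E = submoduleE[OF ideal_submodule[OF D]]
  note um = nalg_hom_uminus[OF N.nalgebra_axioms nalgebra_axioms inclusion_hom[OF NL]]
  have "submodule D K (L\<lparr>carrier := N\<rparr>)"
    using sub E(3-5) submodule_zero[OF ideal_submodule[OF D]] um by (intro N.submoduleI) auto
  moreover have "bracket L xs \<in> D" if "length xs = n" "set xs \<subseteq> N" "x \<in> set xs" "x \<in> D" for xs x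
    using ideal_bracket[OF D that(1) _ that(3,4)] that(2) NL by blast
  ultimately show ?thesis unfolding nalg_ideal_def by auto
qed

lemma ideal_vimage:
  assumes A: "nalgebra n K A" and B: "nalgebra n K B" and h: "h \<in> nalg_hom n K A B"
    and D: "nalg_ideal n K B D"
  shows "nalg_ideal n K A {x \<in> carrier A. h x \<in> D}"
proof -
  have "a_kernel A (quot_alg B D) (\<lambda>x. coset_map B D (h x)) = {x \<in> carrier A. h x \<in> D}"
    using coset_map_eq_zero[OF B D] nalg_hom_closed[OF h] by (auto simp: a_kernel_def')
  then show ?thesis
    using nalg_hom_kernel_ideal[OF A nalgebra_quot[OF B D] nalg_hom_comp[OF h coset_map_hom[OF B D]]] by simp
qed

lemma ideal_image:
  assumes A: "nalgebra n K A" and B: "nalgebra n K B" and p: "p \<in> nalg_hom n K A B"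
    and surj: "p ` carrier A = carrier B" and N: "nalg_ideal n K A N"
  shows "nalg_ideal n K B (p ` N)"
proof -
  interpret A: nalgebra n K A by fact
  interpret B: nalgebra n K B by fact
  note E = A.submoduleE[OF A.ideal_submodule[OF N]]
  have NA: "x \<in> carrier A" if "x \<in> N" for x using E(1) that by blast
  have "submodule (p ` N) K B"
  proof (rule B.submoduleI)
    show "p ` N \<subseteq> carrier B" using NA surj by blast
    show "\<zero>\<^bsub>B\<^esub> \<in> p ` N"
      using nalg_hom_zero[OF A B p] A.submodule_zero[OF A.ideal_submodule[OF N]] by (metis imageI)
    show "\<ominus>\<^bsub>B\<^esub> a \<in> p ` N" if "a \<in> p ` N" for a
      using that nalg_hom_uminus[OF A B p] NA E(3) by (auto simp flip: nalg_hom_uminus[OF A B p])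
    show "a \<oplus>\<^bsub>B\<^esub> b \<in> p ` N" if "a \<in> p ` N" "b \<in> p ` N" for a b
      using that NA E(5) by (auto simp flip: nalg_hom_add[OF p])
    show "c \<odot>\<^bsub>B\<^esub> a \<in> p ` N" if "c \<in> carrier K" "a \<in> p ` N" for c a
      using that NA E(4) by (auto simp flip: nalg_hom_smult[OF p])
  qed
  moreover have "bracket B ys \<in> p ` N" if ys: "length ys = n" "set ys \<subseteq> carrier B" "y \<in> set ys" "y \<in> p ` N" for ys y
  proof -
    obtain us where us: "ys = map p us" "set us \<subseteq> carrier A" "length us = n"
      using ys(1,2) surj by (metis set_subset_imageE)
    obtain i where i: "i < n" "ys ! i = y" using ys(1,3) by (auto simp: in_set_conv_nth)
    obtain x where x: "x \<in> N" "y = p x" using ys(4) by auto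
    \<comment> \<open>Choose the preimage of the argument \<open>y\<close> inside \<open>N\<close>.\<close>
    have "map p (us[i := x]) = ys" using us i x by (auto intro!: nth_equalityI simp: nth_list_update)
    moreover have "set (us[i := x]) \<subseteq> carrier A" using us NA[OF x(1)] by (intro set_list_update_subset)
    moreover have "x \<in> set (us[i := x])" using i us by (intro set_update_memI) simp
    ultimately show ?thesis
      using nalg_hom_bracket[OF p, of "us[i := x]"] A.ideal_bracket[OF N, of "us[i := x]" x] x(1) us(3)
      by (metis imageI length_list_update)
  qed
  ultimately show ?thesis unfolding nalg_ideal_def by blast
qed

lemma lie_algebraI:
  assumes A: "nalgebra n K A"
    and "\<And>xs \<sigma>. length xs = n \<Longrightarrow> set xs \<subseteq> carrier A \<Longrightarrow> \<sigma> permutes {..<n} \<Longrightarrow> commutator A \<sigma> xs = \<zero>\<^bsub>A\<^esub>"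
  shows "lie_algebra n K A"
proof (intro lie_algebra.intro lie_algebra_axioms.intro)
  interpret A: nalgebra n K A by fact
  show "leibniz_algebra n K A" by (rule A.leibniz_algebra_axioms)
  fix xs \<sigma> assume xs: "length xs = n" "set xs \<subseteq> carrier A" "\<sigma> permutes {..<n}"
  have "[sign \<sigma>] \<cdot>\<^bsub>A\<^esub> bracket A (permute_list \<sigma> xs) \<in> carrier A"
    using A.permuted_bracket_closed[OF xs] by (simp add: A.signed)
  then show "bracket A xs = [sign \<sigma>] \<cdot>\<^bsub>A\<^esub> bracket A (permute_list \<sigma> xs)"
    using assms(2)[OF xs] A.minus_eq_zero_iff A.bracket_closed[OF xs(1,2)] by (simp add: commutator_def)
qed

lemma lie_algebra_bijective:
  assumes A: "nalgebra n K A" and B: "nalgebra n K B" and h: "h \<in> nalg_hom n K A B"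
    and inj: "inj_on h (carrier A)"
    and B0: "\<And>xs \<sigma>. length xs = n \<Longrightarrow> set xs \<subseteq> carrier B \<Longrightarrow> \<sigma> permutes {..<n} \<Longrightarrow> commutator B \<sigma> xs = \<zero>\<^bsub>B\<^esub>"
  shows "lie_algebra n K A"
proof (rule lie_algebraI[OF A])
  interpret A: nalgebra n K A by fact
  fix xs \<sigma> assume xs: "length xs = n" "set xs \<subseteq> carrier A" "\<sigma> permutes {..<n}"
  have "set (map h xs) \<subseteq> carrier B" using nalg_hom_closed[OF h] xs by auto
  then have "h (commutator A \<sigma> xs) = h \<zero>\<^bsub>A\<^esub>"
    using nalg_hom_commutator[OF A B h xs] B0[of "map h xs" \<sigma>] xs nalg_hom_zero[OF A B h] by simp
  then show "commutator A \<sigma> xs = \<zero>\<^bsub>A\<^esub>"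
    using inj A.commutator_closed[OF xs] by (auto dest: inj_onD)
qed

text \<open>
  Only one of the two quotients has to be seen to be a Lie algebra; the other one inherits this.
\<close>

lemma lie_isomorphic_quotients:
  assumes T: "nalgebra n K T" and Z: "nalgebra n K Z" and N: "nalgebra n K N"
    and \<alpha>: "\<alpha> \<in> nalg_hom n K T Z" "\<alpha> ` carrier T = carrier Z" and \<beta>: "\<beta> \<in> nalg_hom n K T N"
    and D: "nalg_ideal n K N D"
    and onto: "\<And>y. y \<in> carrier N \<Longrightarrow> \<exists>t\<in>carrier T. y \<ominus>\<^bsub>N\<^esub> \<beta> t \<in> D"
    and B: "B = \<alpha> ` {t \<in> carrier T. \<beta> t \<in> D}" "\<And>t. t \<in> carrier T \<Longrightarrow> \<alpha> t \<in> B \<Longrightarrow> \<beta> t \<in> D"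
    and lie: "\<And>xs \<sigma>. length xs = n \<Longrightarrow> set xs \<subseteq> carrier N \<Longrightarrow> \<sigma> permutes {..<n} \<Longrightarrow> commutator N \<sigma> xs \<in> D"
  shows "lie_isomorphic n K (quot_alg Z B) (quot_alg N D)"
proof -
  interpret N: nalgebra n K N by fact
  have BI: "nalg_ideal n K Z B"
    unfolding B(1) by (rule ideal_image[OF T Z \<alpha> ideal_vimage[OF T N \<beta> D]])
  let ?Z = "quot_alg Z B" and ?N = "quot_alg N D"
  note qZ = coset_map_hom[OF Z BI] and qN = coset_map_hom[OF N D]
  have Zq: "nalgebra n K ?Z" and Nq: "nalgebra n K ?N"
    by (rule nalgebra_quot[OF Z BI] nalgebra_quot[OF N D])+
  have "\<exists>h \<in> nalg_hom n K ?Z ?N. bij_betw h (carrier ?Z) (carrier ?N)"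
  proof (rule isomorphism_of_common_quotients[OF T Zq Nq])
    show "(\<lambda>t. coset_map Z B (\<alpha> t)) \<in> nalg_hom n K T ?Z" by (rule nalg_hom_comp[OF \<alpha>(1) qZ])
    show "(\<lambda>t. coset_map N D (\<beta> t)) \<in> nalg_hom n K T ?N" by (rule nalg_hom_comp[OF \<beta> qN])
    show "(\<lambda>t. coset_map Z B (\<alpha> t)) ` carrier T = carrier ?Z"
      using coset_map_surj[OF Z BI] \<alpha>(2) by (metis image_image)
    show "(\<lambda>t. coset_map N D (\<beta> t)) ` carrier T = carrier ?N"
    proof (intro equalityI subsetI)
      fix Y assume "Y \<in> carrier ?N"
      then obtain y where y: "y \<in> carrier N" "Y = coset_map N D y" using coset_map_surj[OF N D] by auto
      then obtain t where t: "t \<in> carrier T" "y \<ominus>\<^bsub>N\<^esub> \<beta> t \<in> D" using onto by blast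
      then have "coset_map N D y = coset_map N D (\<beta> t)"
        using N.coset_eq_iff[OF N.ideal_submodule[OF D] y(1)] nalg_hom_closed[OF \<beta>] by simp
      then show "Y \<in> (\<lambda>t. coset_map N D (\<beta> t)) ` carrier T" using t y by auto
    qed (use nalg_hom_closed[OF \<beta>] nalg_hom_closed[OF qN] in auto)
    fix t assume t: "t \<in> carrier T"
    have "\<alpha> t \<in> B \<longleftrightarrow> \<beta> t \<in> D" using B t by auto
    then show "coset_map Z B (\<alpha> t) = \<zero>\<^bsub>?Z\<^esub> \<longleftrightarrow> coset_map N D (\<beta> t) = \<zero>\<^bsub>?N\<^esub>"
      using coset_map_eq_zero[OF Z BI nalg_hom_closed[OF \<alpha>(1) t]]
        coset_map_eq_zero[OF N D nalg_hom_closed[OF \<beta> t]] by simp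
  qed
  then obtain h where h: "h \<in> nalg_hom n K ?Z ?N" "bij_betw h (carrier ?Z) (carrier ?N)" by blast
  have com: "commutator ?N \<sigma> xs = \<zero>\<^bsub>?N\<^esub>" if xs: "length xs = n" "set xs \<subseteq> carrier ?N" "\<sigma> permutes {..<n}" for xs \<sigma>
  proof -
    obtain us where us: "xs = map (coset_map N D) us" "set us \<subseteq> carrier N" "length us = n"
      using xs(1,2) coset_map_surj[OF N D] by (metis set_subset_imageE)
    have "commutator N \<sigma> us \<in> D" "commutator N \<sigma> us \<in> carrier N"
      using lie us xs(3) N.commutator_closed by auto
    then have "coset_map N D (commutator N \<sigma> us) = \<zero>\<^bsub>?N\<^esub>"
      by (simp only: coset_map_eq_zero[OF N D])
    then show ?thesis using nalg_hom_commutator[OF N Nq qN us(3,2) xs(3)] us(1) by simp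
  qed
  have "inj_on h (carrier ?Z)" using h(2) by (rule bij_betw_imp_inj_on)
  then show ?thesis
    unfolding lie_isomorphic_def
    using lie_algebra_bijective[OF Zq Nq h(1) _ com] lie_algebraI[OF Nq com] h by blast
qed

section \<open>The Hopf formula\<close>

lemma fold_extension_cube_extension:
  assumes "fold_extension n K m f" "n > 0"
  shows "cube_extension n K {1..m} f"
proof (intro cube_extension.intro cube_diagram.intro cube_extension_axioms.intro)
  have f: "fold_arrow n K m f" and lim: "\<And>I. I \<subset> {1..m} \<Longrightarrow>
      (\<lambda>y. \<lambda>J\<in>proper_supersets m I. edge f I J y) ` carrier (vertex f I) = cube_limit m f I"
    using assms by (auto simp: fold_extension_def)
  show "nalgebra n K (vertex f I)" if "I \<subseteq> {1..m}" for I
    using f that assms(2) by (auto simp: fold_arrow_def intro: nalgebraI)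
  show "edge f I J \<in> nalg_hom n K (vertex f I) (vertex f J)" if "I \<subseteq> J" "J \<subseteq> {1..m}" for I J
    using f that by (simp add: fold_arrow_def)
  show "edge f I I x = x" if "I \<subseteq> {1..m}" "x \<in> carrier (vertex f I)" for I x
    using f that by (simp add: fold_arrow_def)
  show "edge f J M (edge f I J x) = edge f I M x"
    if "I \<subseteq> J" "J \<subseteq> M" "M \<subseteq> {1..m}" "x \<in> carrier (vertex f I)" for I J M x
    using f that by (simp add: fold_arrow_def)
  fix I x assume I: "I \<subset> {1..m}" and x: "\<And>J. I \<subset> J \<Longrightarrow> J \<subseteq> {1..m} \<Longrightarrow> x J \<in> carrier (vertex f J)"
    and comp: "\<And>J M. I \<subset> J \<Longrightarrow> J \<subseteq> M \<Longrightarrow> M \<subseteq> {1..m} \<Longrightarrow> edge f J M (x J) = x M"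
  have "restrict x (proper_supersets m I) \<in> cube_limit m f I"
    using x comp by (auto simp: cube_limit_def proper_supersets_def)
  then obtain y where y: "y \<in> carrier (vertex f I)"
    "restrict x (proper_supersets m I) = (\<lambda>J\<in>proper_supersets m I. edge f I J y)"
    using lim[OF I] by (metis (no_types, lifting) imageE)
  have "edge f I J y = x J" if "I \<subset> J" "J \<subseteq> {1..m}" for J
    using fun_cong[OF y(2), of J] that by (simp add: proper_supersets_def)
  then show "\<exists>y\<in>carrier (vertex f I). \<forall>J. I \<subset> J \<longrightarrow> J \<subseteq> {1..m} \<longrightarrow> edge f I J y = x J"
    using y(1) by blast
qed simp

lemma cube_map_id: "cube_map n K S (Pow S) f f (\<lambda>_ x. x)"
  by (simp add: cube_map_def nalg_hom_id)

lemma cube_map_comp: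
  assumes g: "cube_map n K S (Pow S) f F g" and h: "cube_map n K S (Pow S) F H h"
  shows "cube_map n K S (Pow S) f H (\<lambda>I x. h I (g I x))"
proof -
  have "(\<lambda>x. h I (g I x)) \<in> nalg_hom n K (vertex f I) (vertex H I)" if "I \<subseteq> S" for I
    using that by (intro nalg_hom_comp[OF cube_map_hom[OF g] cube_map_hom[OF h]]) auto
  moreover have "edge H I J (h I (g I x)) = h J (g J (edge f I J x))"
    if "I \<subseteq> J" "J \<subseteq> S" "x \<in> carrier (vertex f I)" for I J x
    using cube_map_edge[OF g _ that] cube_map_edge[OF h _ that(1,2), of "g I x"]
      nalg_hom_closed[OF cube_map_hom[OF g] that(3)] that by auto
  ultimately show ?thesis by (auto simp: cube_map_def)
qed

lemma extend_from_terminal: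
  assumes f: "cube_extension n K S f" and F: "cube_extension n K S F"
    and proj: "\<And>I. I \<subset> S \<Longrightarrow> projective_alg n K (vertex f I)"
    and h: "h \<in> nalg_hom n K (vertex f S) (vertex F S)"
  shows "\<exists>g. cube_map n K S (Pow S) f F g \<and> g S = h"
proof -
  interpret f: cube_extension n K S f by fact
  interpret F: cube_extension n K S F by fact
  have "cube_map n K S {S} f F (\<lambda>_. h)"
    using h f.edge_refl F.edge_refl nalg_hom_closed[OF h] by (auto simp: cube_map_def)
  moreover have "upward_closed S {S}" by (auto simp: upward_closed_def)
  ultimately obtain g where "\<forall>I\<in>{S}. g I = h" "cube_map n K S (Pow S) f F g"
    using extend_cube_map[OF f.cube_diagram_axioms F, of "{S}" "\<lambda>_. h"] proj by blast
  then show ?thesis by blast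
qed

text \<open>So a map of cubes induces a map between the right-hand sides of the formula.\<close>

lemma cube_map_commutators:
  assumes f: "cube_diagram n K S f" and F: "cube_diagram n K S F" and g: "cube_map n K S (Pow S) f F g"
  shows "\<And>i x. i \<in> S \<Longrightarrow> x \<in> edge_kernel f i \<Longrightarrow> g {} x \<in> edge_kernel F i"
    and "\<And>x. x \<in> joint_commutator n K (vertex f {}) {} \<Longrightarrow>
      g {} x \<in> joint_commutator n K (vertex F {}) {}"
    and "\<And>x. x \<in> joint_commutator n K (vertex f {}) (edge_kernel f ` S) \<Longrightarrow>
      g {} x \<in> joint_commutator n K (vertex F {}) (edge_kernel F ` S)"
proof -
  interpret f: cube_diagram n K S f by fact
  interpret F: cube_diagram n K S F by fact
  have A: "nalgebra n K (vertex f {})" "nalgebra n K (vertex F {})"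
    by (simp_all add: f.vertex_nalgebra F.vertex_nalgebra)
  have g0: "g {} \<in> nalg_hom n K (vertex f {}) (vertex F {})" by (rule cube_map_hom[OF g]) simp
  show k: "g {} x \<in> edge_kernel F i" if i: "i \<in> S" and x: "x \<in> edge_kernel f i" for i x
  proof -
    have xc: "x \<in> carrier (vertex f {})" "edge f {} {i} x = \<zero>\<^bsub>vertex f {i}\<^esub>" using x by (auto simp: in_a_kernel_iff)
    have gi: "g {i} \<in> nalg_hom n K (vertex f {i}) (vertex F {i})" using i by (intro cube_map_hom[OF g]) auto
    have "edge F {} {i} (g {} x) = g {i} (edge f {} {i} x)" using i xc by (intro cube_map_edge[OF g]) auto
    also have "\<dots> = \<zero>\<^bsub>vertex F {i}\<^esub>"
      using nalg_hom_zero[OF _ _ gi] f.vertex_nalgebra[of "{i}"] F.vertex_nalgebra[of "{i}"] i xc by simp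
    finally show ?thesis using nalg_hom_closed[OF g0 xc(1)] by (simp add: in_a_kernel_iff)
  qed
  show "g {} x \<in> joint_commutator n K (vertex F {}) {}" if "x \<in> joint_commutator n K (vertex f {}) {}" for x
    by (rule nalg_hom_joint_commutator[OF A g0 _ that]) simp
  show "g {} x \<in> joint_commutator n K (vertex F {}) (edge_kernel F ` S)"
    if "x \<in> joint_commutator n K (vertex f {}) (edge_kernel f ` S)" for x
    by (rule nalg_hom_joint_commutator[OF A g0 _ that]) (use k in blast)
qed

lemma hopf_denominator_eq:
  assumes "cube_extension n K {1..m} f"
  shows "hopf_denominator n K m f = joint_commutator n K (vertex f {}) (edge_kernel f ` {1..m})"
proof -
  interpret f: cube_extension n K "{1..m}" f by fact
  interpret P: nalgebra n K "vertex f {}" by (rule f.vertex_nalgebra) simp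
  have "kernel_inter f = (\<lambda>I. carrier (vertex f {}) \<inter> (\<Inter>i\<in>I. edge_kernel f i))"
    by (rule ext) (simp add: kernel_inter_def)
  then show ?thesis
    unfolding hopf_denominator_def using P.ideal_sum_covers[of m "edge_kernel f", OF f.edge_kernel_ideal] by simp
qed

lemma hopf_numerator_eq:
  assumes "cube_extension n K {1..m} f"
  shows "hopf_numerator n K m f =
    {x \<in> joint_commutator n K (vertex f {}) {}. \<forall>i\<in>{1..m}. x \<in> edge_kernel f i}"
proof -
  interpret f: cube_extension n K "{1..m}" f by fact
  interpret P: nalgebra n K "vertex f {}" by (rule f.vertex_nalgebra) simp
  show ?thesis
    unfolding hopf_numerator_def P.rel_commutator_total kernel_inter_def
    using P.joint_commutator_carrier by blast
qed

lemma
  assumes "cube_extension n K {1..m} f"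
  shows ideal_hopf_numerator: "nalg_ideal n K (vertex f {}) (hopf_numerator n K m f)"
    and ideal_hopf_denominator: "nalg_ideal n K (vertex f {}) (hopf_denominator n K m f)"
proof -
  interpret f: cube_extension n K "{1..m}" f by fact
  interpret P: nalgebra n K "vertex f {}" by (rule f.vertex_nalgebra) simp
  let ?N = "\<lambda>i. if i = 0 then joint_commutator n K (vertex f {}) {} else edge_kernel f i"
  have "nalg_ideal n K (vertex f {}) {x \<in> carrier (vertex f {}). \<forall>i\<in>{0..m}. x \<in> ?N i}"
    using P.ideal_joint_commutator[of "{}"] f.edge_kernel_ideal by (intro P.ideal_inter) auto
  moreover have "{x \<in> carrier (vertex f {}). \<forall>i\<in>{0..m}. x \<in> ?N i} = hopf_numerator n K m f"
    unfolding hopf_numerator_eq[OF assms] using P.joint_commutator_carrier by (auto split: if_splits)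
  ultimately show "nalg_ideal n K (vertex f {}) (hopf_numerator n K m f)" by simp
  show "nalg_ideal n K (vertex f {}) (hopf_denominator n K m f)"
    unfolding hopf_denominator_eq[OF assms] using f.edge_kernel_ideal by (intro P.ideal_joint_commutator) auto
qed

lemma hopf_denominator_subset:
  assumes "cube_extension n K {1..m} f"
  shows "hopf_denominator n K m f \<subseteq> hopf_numerator n K m f"
proof
  interpret f: cube_extension n K "{1..m}" f by fact
  have P: "nalgebra n K (vertex f {})" by (rule f.vertex_nalgebra) simp
  fix x assume x: "x \<in> hopf_denominator n K m f"
  then have "x \<in> joint_commutator n K (vertex f {}) {}"
    unfolding hopf_denominator_eq[OF assms] by (rule joint_commutator_mono[OF P empty_subsetI])
  moreover have "x \<in> edge_kernel f i" if "i \<in> {1..m}" for i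
    using nalgebra.joint_commutator_subset[OF P _ f.edge_kernel_ideal[OF that], of "edge_kernel f ` {1..m}"] that x
    unfolding hopf_denominator_eq[OF assms] by blast
  ultimately show "x \<in> hopf_numerator n K m f" unfolding hopf_numerator_eq[OF assms] by blast
qed

theorem theorem5p7:
  fixes n m :: nat
    and K :: "('k, 'r) ring_scheme"
    and L :: "('k, 'a) nalg"
    and f :: "('k, 'a) cube"
  assumes "n \<ge> 2"
    and "field K" and "field_char K \<noteq> 2"
    and "m \<ge> 1"
    and "leibniz_algebra n K L"
    and "fold_presentation n K m f L"
  shows "lie_isomorphic n K
           (G_homology n K (m + 1) L (nlie n K) (nlie_map n K))
           (quot_alg ((vertex f {})\<lparr>carrier := hopf_numerator n K m f\<rparr>) (hopf_denominator n K m f))"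
proof -
  have n: "n > 0" using assms(1) by simp
  have L: "nalgebra n K L" using assms(5) n by (rule nalgebraI)
  have A: "nalgebra n K (obj_copy L)" using leibniz_algebra_obj_copy[OF assms(5)] n by (rule nalgebraI)
  obtain q where m: "m = Suc q" using assms(4) by (cases m) auto
  let ?S = "{1..m}"
  define F where "F = resolution_cube n K (obj_copy L) m 0"
  have f: "cube_extension n K ?S f" and fL: "vertex f ?S = L"
    and fproj: "\<And>I. I \<subset> ?S \<Longrightarrow> projective_alg n K (vertex f I)"
    using assms(6) fold_extension_cube_extension[OF _ n] by (auto simp: fold_presentation_def)
  have F: "cube_extension n K ?S F" unfolding F_def by (rule resolution_cube_extension[OF A])
  have Fproj: "projective_alg n K (vertex F I)" if "I \<subset> ?S" for I
    unfolding F_def by (rule resolution_vertices_projective[OF A that])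
  have FL: "vertex F ?S = obj_copy L"
    using vertex_resolution_cube[of ?S m n K "obj_copy L" 0] by (simp add: F_def)
  define Y where "Y = G_pow n K (Suc q) (obj_copy L)"
  have FY: "vertex F {} = Y"
    using vertex_resolution_cube[of "{}" m n K "obj_copy L" 0] by (simp add: F_def Y_def m)
  interpret f: cube_extension n K ?S f by (rule f)
  interpret F: cube_extension n K ?S F by (rule F)
  let ?P = "vertex f {}"
  interpret P: nalgebra n K ?P by (rule f.vertex_nalgebra) simp
  interpret Y: nalgebra n K Y unfolding Y_def by (rule nalgebra_G_pow[OF A])
  \<comment> \<open>Compare the given presentation with the one from the resolution, in both directions.\<close>
  have "Obj \<in> nalg_hom n K L (obj_copy L)" "the_obj \<in> nalg_hom n K (obj_copy L) L"
    by (auto simp: nalg_hom_def obj_copy_def comp_def)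
  then obtain g h where g: "cube_map n K ?S (Pow ?S) f F g" "g ?S = Obj"
    and h: "cube_map n K ?S (Pow ?S) F f h" "h ?S = the_obj"
    using extend_from_terminal[OF f F fproj, of Obj, unfolded fL FL]
      extend_from_terminal[OF F f Fproj, of the_obj, unfolded fL FL] by blast
  note gd = cube_map_commutators[OF f.cube_diagram_axioms F.cube_diagram_axioms g(1)]
  note hd = cube_map_commutators[OF F.cube_diagram_axioms f.cube_diagram_axioms h(1)]
  have g0: "g {} \<in> nalg_hom n K ?P Y" and h0: "h {} \<in> nalg_hom n K Y ?P"
    using cube_map_hom[OF g(1), of "{}"] cube_map_hom[OF h(1), of "{}"] by (simp_all add: FY)
  let ?N = "hopf_numerator n K m f" and ?D = "hopf_denominator n K m f"
  let ?NF = "{y \<in> joint_commutator n K Y {}. \<forall>i\<in>?S. y \<in> edge_kernel F i}"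
  let ?DF = "joint_commutator n K Y (edge_kernel F ` ?S)"
  note N_eq = hopf_numerator_eq[OF f] and D_eq = hopf_denominator_eq[OF f]
  have hg: "x \<ominus>\<^bsub>?P\<^esub> h {} (g {} x) \<in> ?D" if "x \<in> ?N" for x
    unfolding D_eq
  proof (rule cube_maps_agree_modulo_commutators[OF f f fproj cube_map_id cube_map_comp[OF g(1) h(1)]])
    show "y = h ?S (g ?S y)" for y by (simp only: g(2) h(2) lterm.sel)
  qed (use that in \<open>simp_all add: N_eq\<close>)
  have gh: "y \<ominus>\<^bsub>Y\<^esub> g {} (h {} y) \<in> ?DF" if "y \<in> ?NF" for y
  proof -
    have "y \<ominus>\<^bsub>vertex F {}\<^esub> g {} (h {} y) \<in> joint_commutator n K (vertex F {}) (edge_kernel F ` ?S)"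
    proof (rule cube_maps_agree_modulo_commutators[OF F F Fproj cube_map_id cube_map_comp[OF h(1) g(1)]])
      show "x = g ?S (h ?S x)" if "x \<in> carrier (vertex F ?S)" for x
        using that unfolding FL g(2) h(2) by (auto simp: obj_copy_def)
    qed (use that FY in auto)
    then show ?thesis by (simp only: FY)
  qed
  have h_denom: "h {} y \<in> ?D \<longleftrightarrow> y \<in> ?DF" if y: "y \<in> ?NF" for y
  proof
    show "h {} y \<in> ?D" if "y \<in> ?DF" using hd(3)[of y] that by (simp add: D_eq FY)
    assume "h {} y \<in> ?D"
    then have "g {} (h {} y) \<in> ?DF" using gd(3)[of "h {} y"] by (simp add: D_eq FY)
    with gh[OF y] have "(y \<ominus>\<^bsub>Y\<^esub> g {} (h {} y)) \<oplus>\<^bsub>Y\<^esub> g {} (h {} y) \<in> ?DF" by (rule joint_commutator.add)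
    moreover have yc: "y \<in> carrier Y" using y Y.joint_commutator_carrier by blast
    moreover have "g {} (h {} y) \<in> carrier Y"
      using nalg_hom_closed[OF g0 nalg_hom_closed[OF h0 yc]] .
    ultimately show "y \<in> ?DF" by (simp add: Y.minus_add_cancel)
  qed
  \<comment> \<open>The kernels of the resolution cube are those of the faces.\<close>
  have kerF: "edge_kernel F j = face_kernel n K (obj_copy L) q (Suc q - j)" if "j \<in> ?S" for j
    using edge_kernel_resolution_cube[OF A, of j q] that by (simp add: F_def m)
  have rev: "(\<lambda>j. Suc q - j) ` ?S = {..q}"
  proof
    show "{..q} \<subseteq> (\<lambda>j. Suc q - j) ` ?S"
      by (rule subsetI, rule_tac x = "Suc q - x" in image_eqI) (auto simp: m)
  qed (auto simp: m)
  have kersF: "edge_kernel F ` ?S = face_kernel n K (obj_copy L) q ` {..q}"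
    unfolding rev[symmetric] image_image using kerF by (rule image_cong[OF HOL.refl])
  have NF: "?NF = {y \<in> joint_commutator n K Y {}. \<forall>i\<le>q. y \<in> face_kernel n K (obj_copy L) q i}"
  proof -
    have "(\<forall>i\<in>?S. y \<in> edge_kernel F i) \<longleftrightarrow> (\<forall>M\<in>edge_kernel F ` ?S. y \<in> M)" for y by blast
    then show ?thesis unfolding kersF by auto
  qed
  define X where "X = G_pow n K (Suc (Suc q)) (obj_copy L)"
  interpret X: nalgebra n K X unfolding X_def by (rule nalgebra_G_pow[OF A])
  let ?S' = "map_simplicial (nlie n K) (nlie_map n K) (G_resolution n K L)"
  define T where "T = lifted_cycles n K (obj_copy L) q"
  define \<alpha> where "\<alpha> = coset_map X (joint_commutator n K X {})"
  define d where "d = resolution_face n K (obj_copy L) (Suc q) (Suc q)"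
  have cycles: "\<alpha> ` T = moore_cycles ?S' m"
    unfolding \<alpha>_def T_def X_def m by (rule lifted_cycles_image[OF L])
  have boundaries: "moore_boundaries ?S' m = \<alpha> ` {t \<in> T. d t \<in> ?DF}"
    unfolding \<alpha>_def T_def X_def Y_def d_def m kersF[unfolded m] by (rule lifted_boundaries_image[OF L])
  have boundaries': "d t \<in> ?DF" if "t \<in> T" "\<alpha> t \<in> moore_boundaries ?S' m" for t
    using that unfolding \<alpha>_def T_def X_def Y_def d_def m kersF[unfolded m] by (rule lifted_boundaries[OF L])
  have last_face: "d ` T = ?NF"
    unfolding NF unfolding T_def d_def Y_def by (rule last_face_image[OF L])
  have d: "d \<in> nalg_hom n K X Y" unfolding d_def X_def Y_def by (rule resolution_face_hom[OF A]) simp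
  have T: "nalg_ideal n K X T"
  proof -
    let ?M = "\<lambda>i. if i \<le> q then face_kernel n K (obj_copy L) (Suc q) i
      else {x \<in> carrier X. d x \<in> joint_commutator n K Y {}}"
    have "nalg_ideal n K X (?M i)" if "i \<in> {..Suc q}" for i
    proof (cases "i \<le> q")
      case True
      then show ?thesis
        using nalg_hom_kernel_ideal[OF nalgebra_G_pow[OF A] nalgebra_G_pow[OF A] resolution_face_hom[OF A, of i "Suc q"]]
        by (simp add: X_def)
    next
      case False
      then show ?thesis
        using ideal_vimage[OF X.nalgebra_axioms Y.nalgebra_axioms d Y.ideal_joint_commutator[of "{}"]] by simp
    qed
    then have "nalg_ideal n K X {x \<in> carrier X. \<forall>i\<in>{..Suc q}. x \<in> ?M i}" by (rule X.ideal_inter)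
    moreover have "{x \<in> carrier X. \<forall>i\<in>{..Suc q}. x \<in> ?M i} = T"
      by (auto simp: T_def lifted_cycles_def X_def Y_def d_def atMost_Suc)
    ultimately show ?thesis by simp
  qed
  have TX: "T \<subseteq> carrier X" by (rule X.submoduleE(1)[OF X.ideal_submodule[OF T]])
  let ?T = "X\<lparr>carrier := T\<rparr>" and ?Nf = "?P\<lparr>carrier := ?N\<rparr>"
  let ?Z = "(obj ?S' m)\<lparr>carrier := moore_cycles ?S' m\<rparr>"
  have Talg: "nalgebra n K ?T" by (rule X.nalgebra_ideal[OF T])
  have Nalg: "nalgebra n K ?Nf" by (rule P.nalgebra_ideal[OF ideal_hopf_numerator[OF f]])
  have obj: "obj ?S' m = nlie n K X"
    by (simp add: map_simplicial_def G_resolution_def X_def m)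
  have \<alpha>_hom: "\<alpha> \<in> nalg_hom n K ?T ?Z"
  proof -
    have *: "\<alpha> \<in> nalg_hom n K ?T (nlie n K X)"
      using nalg_hom_comp[OF inclusion_hom[OF TX] nlie_coset_hom[OF X.nalgebra_axioms]] by (simp add: \<alpha>_def)
    have "\<alpha> x \<in> carrier ?Z" if "x \<in> carrier ?T" for x using that cycles by auto
    then show ?thesis
      using nalg_hom_add[OF *] nalg_hom_smult[OF *] nalg_hom_bracket[OF *]
      by (intro nalg_homI) (simp_all add: obj)
  qed
  have \<alpha>_surj: "\<alpha> ` carrier ?T = carrier ?Z" using cycles by simp
  have Zalg: "nalgebra n K ?Z"
  proof (rule nalgebra_surj_image[OF Talg \<alpha>_hom \<alpha>_surj])
    show "\<alpha> \<zero>\<^bsub>?T\<^esub> = \<zero>\<^bsub>?Z\<^esub>"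
      using nalg_hom_zero[OF X.nalgebra_axioms nalgebra_nlie[OF X.nalgebra_axioms] nlie_coset_hom[OF X.nalgebra_axioms]]
      by (simp add: obj \<alpha>_def)
  qed
  define \<beta> where "\<beta> = (\<lambda>t. h {} (d t))"
  have dT: "d t \<in> ?NF" if "t \<in> T" for t using last_face that by blast
  have \<beta>_N: "\<beta> t \<in> ?N" if "t \<in> T" for t
    using dT[OF that] hd(1) hd(2)[of "d t"] by (auto simp: \<beta>_def N_eq FY)
  have \<beta>_hom: "\<beta> \<in> nalg_hom n K ?T ?Nf"
  proof -
    have "\<beta> \<in> nalg_hom n K X ?P" unfolding \<beta>_def by (rule nalg_hom_comp[OF d h0])
    from nalg_hom_comp[OF inclusion_hom[OF TX] this]
    have *: "\<beta> \<in> nalg_hom n K ?T ?P" .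
    show ?thesis
      by (rule nalg_homI) (use \<beta>_N nalg_hom_add[OF *] nalg_hom_smult[OF *] nalg_hom_bracket[OF *] in auto)
  qed
  have N_sub: "?N \<subseteq> carrier ?P" by (rule P.submoduleE(1)[OF P.ideal_submodule[OF ideal_hopf_numerator[OF f]]])
  note inc = inclusion_hom[OF N_sub, of n K]
  have \<beta>_denom: "\<beta> t \<in> ?D \<longleftrightarrow> d t \<in> ?DF" if "t \<in> T" for t
    unfolding \<beta>_def by (rule h_denom[OF dT[OF that]])
  have "lie_isomorphic n K (quot_alg ?Z (moore_boundaries ?S' m)) (quot_alg ?Nf ?D)"
  proof (rule lie_isomorphic_quotients[OF Talg Zalg Nalg \<alpha>_hom \<alpha>_surj \<beta>_hom])
    show "nalg_ideal n K ?Nf ?D"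
      by (rule P.ideal_in_ideal[OF ideal_hopf_numerator[OF f] ideal_hopf_denominator[OF f] hopf_denominator_subset[OF f]])
    show "\<exists>t\<in>carrier ?T. y \<ominus>\<^bsub>?Nf\<^esub> \<beta> t \<in> ?D" if "y \<in> carrier ?Nf" for y
    proof -
      have y: "y \<in> ?N" using that by simp
      then have "g {} y \<in> ?NF" using gd(1) gd(2)[of y] by (simp add: N_eq FY)
      then obtain t where t: "t \<in> T" "d t = g {} y" using last_face by (metis (no_types, lifting) imageE)
      then have "y \<ominus>\<^bsub>?P\<^esub> \<beta> t \<in> ?D" using hg[OF y] by (simp add: \<beta>_def)
      moreover have "y \<ominus>\<^bsub>?Nf\<^esub> \<beta> t = y \<ominus>\<^bsub>?P\<^esub> \<beta> t"
        using nalg_hom_minus[OF Nalg P.nalgebra_axioms inc, of y "\<beta> t"] y \<beta>_N[OF t(1)] by simp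
      ultimately have "y \<ominus>\<^bsub>?Nf\<^esub> \<beta> t \<in> ?D" by (simp only:)
      then show ?thesis using t(1) by (intro bexI[of _ t]) simp_all
    qed
    have "{t \<in> carrier ?T. \<beta> t \<in> ?D} = {t \<in> T. d t \<in> ?DF}" using \<beta>_denom by auto
    then show "moore_boundaries ?S' m = \<alpha> ` {t \<in> carrier ?T. \<beta> t \<in> ?D}" using boundaries by simp
    show "\<beta> t \<in> ?D" if "t \<in> carrier ?T" "\<alpha> t \<in> moore_boundaries ?S' m" for t
      using boundaries'[of t] \<beta>_denom[of t] that by simp
    fix xs \<sigma> assume xs: "length xs = n" "set xs \<subseteq> carrier ?Nf" "\<sigma> permutes {..<n}"
    have "commutator ?Nf \<sigma> xs = commutator ?P \<sigma> xs"
      using nalg_hom_commutator[OF Nalg P.nalgebra_axioms inc xs] by simp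
    moreover have "commutator ?P \<sigma> xs \<in> ?D"
    proof -
      \<comment> \<open>A single argument from the numerator lies in all the kernels already.\<close>
      have x0: "xs ! 0 \<in> set xs" using xs(1) n by simp
      then have "xs ! 0 \<in> ?N" using xs(2) by auto
      then have "\<forall>N\<in>edge_kernel f ` ?S. \<exists>x\<in>set xs. x \<in> N" using x0 unfolding N_eq by blast
      then show ?thesis unfolding D_eq using xs N_sub by (intro joint_commutator.commutator) auto
    qed
    ultimately show "commutator ?Nf \<sigma> xs \<in> ?D" by simp
  qed
  then show ?thesis by (simp add: G_homology_def moore_homology_def)
qed

end
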